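(* Let $p\in[1,\infty)$ and $\eta>2$. Suppose the collision cross-section is $\sigma(g,\theta)=C_\Phi\, g\cdot C\sin\theta$ for $\theta\in(0,\pi/2]$ (constants $C_\Phi,C>0$) and $\sigma=0$ when $\cos\theta<0$. Then there is a constant $C'>0$ such that for all suitable $f,h$, $$\|Q^+(f,h)\|_{L^p(\mathbb{R}^3)}\leq C'\|f\|_{L^1_{1/2}(\mathbb{R}^3)}\|h\|_{L^p_{\eta(p-1)+\frac12}(\mathbb{R}^3)}.$$
   Context: Units are normalized so the speed of light and rest mass are 1. For $v\in\mathbb{R}^3$, $v^0=\sqrt{1+|v|^2}$. The relative momentum is $g(v,v_* )=\sqrt{-(v^0-v_*^0)^2+|v-v_*|^2}$, $s=g^2+4$, and the Møller velocity is $v_{\o}=\frac{g\sqrt{s}}{v^0v_*^0}$. For $\omega\in\mathbb{S}^2$, with $\gamma=\frac{v^0+v_*^0}{\sqrt{s}}$, $$v'=\frac{v+v_*}{2}+\frac{g}{2}\Big(\omega+(\gamma-1)(v+v_* )\frac{(v+v_* )\cdot\omega}{|v+v_*|^2}\Big),\quad v_*'=\frac{v+v_*}{2}-\frac{g}{2}\Big(\omega+(\gamma-1)(v+v_* )\frac{(v+v_* )\cdot\omega}{|v+v_*|^2}\Big),$$ and $\theta\in[0,\pi]$ is defined by $\cos\theta=\frac{-(v^0-v_*^0)(v'^0-v_*'^0)+(v-v_* )\cdot(v'-v_*')}{g^2}$. The gain operator is $$Q^+(f,h)(v)=\int_{\mathbb{R}^3}dv_*\int_{\mathbb{S}^2}d\omega\,v_{\o}\,\sigma(g,\theta)\,f(v')h(v_*').$$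 Weighted norms: $\|f\|_{L^p_k}=\big(\int_{\mathbb{R}^3}(v^0)^k|f(v)|^p\,dv\big)^{1/p}$. *)

theory Defs
  imports "HOL-Analysis.Analysis"
begin

type_synonym vec3 = "real^3"

definition vzero :: "vec3 \<Rightarrow> real" where
  "vzero v = sqrt (1 + (norm v)\<^sup>2)"

definition relg :: "vec3 \<Rightarrow> vec3 \<Rightarrow> real" where
  "relg v w = sqrt (- (vzero v - vzero w)\<^sup>2 + (norm (v - w))\<^sup>2)"

definition mandel_s :: "vec3 \<Rightarrow> vec3 \<Rightarrow> real" where
  "mandel_s v w = (relg v w)\<^sup>2 + 4"

definition moller :: "vec3 \<Rightarrow> vec3 \<Rightarrow> real" where
  "moller v w = relg v w * sqrt (mandel_s v w) / (vzero v * vzero w)"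

definition gam :: "vec3 \<Rightarrow> vec3 \<Rightarrow> real" where
  "gam v w = (vzero v + vzero w) / sqrt (mandel_s v w)"

definition boostdir :: "vec3 \<Rightarrow> vec3 \<Rightarrow> vec3 \<Rightarrow> vec3" where
  "boostdir v w \<omega> = \<omega> + ((gam v w - 1) * ((v + w) \<bullet> \<omega>) / (norm (v + w))\<^sup>2) *\<^sub>R (v + w)"

definition vpost :: "vec3 \<Rightarrow> vec3 \<Rightarrow> vec3 \<Rightarrow> vec3" where
  "vpost v w \<omega> = (1/2) *\<^sub>R (v + w) + (relg v w / 2) *\<^sub>R boostdir v w \<omega>"

definition wpost :: "vec3 \<Rightarrow> vec3 \<Rightarrow> vec3 \<Rightarrow> vec3" where
  "wpost v w \<omega> = (1/2) *\<^sub>R (v + w) - (relg v w / 2) *\<^sub>R boostdir v w \<omega>"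

definition cos_theta :: "vec3 \<Rightarrow> vec3 \<Rightarrow> vec3 \<Rightarrow> real" where
  "cos_theta v w \<omega> =
     (- (vzero v - vzero w) * (vzero (vpost v w \<omega>) - vzero (wpost v w \<omega>))
      + (v - w) \<bullet> (vpost v w \<omega> - wpost v w \<omega>)) / (relg v w)\<^sup>2"

definition theta :: "vec3 \<Rightarrow> vec3 \<Rightarrow> vec3 \<Rightarrow> real" where
  "theta v w \<omega> = arccos (cos_theta v w \<omega>)"

definition sphere_pt :: "real \<Rightarrow> real \<Rightarrow> vec3" where
  "sphere_pt \<phi> \<psi> = vector [sin \<phi> * cos \<psi>, sin \<phi> * sin \<psi>, cos \<phi>]"

definition sphere_integral :: "(vec3 \<Rightarrow> real) \<Rightarrow> real" where
  "sphere_integral F =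
     (LBINT \<phi>=0..pi. (LBINT \<psi>=0..2*pi. F (sphere_pt \<phi> \<psi>) * sin \<phi>))"

definition Qplus :: "(real \<Rightarrow> real \<Rightarrow> real) \<Rightarrow> (vec3 \<Rightarrow> real) \<Rightarrow> (vec3 \<Rightarrow> real) \<Rightarrow> vec3 \<Rightarrow> real" where
  "Qplus \<sigma> f h v =
     (\<integral> w. sphere_integral (\<lambda>\<omega>. moller v w * \<sigma> (relg v w) (theta v w \<omega>)
                 * f (vpost v w \<omega>) * h (wpost v w \<omega>)) \<partial>lborel)"

(* ||f||_{L^p_k} (for functions with the relevant integrability) *)
definition wLp_norm :: "real \<Rightarrow> real \<Rightarrow> (vec3 \<Rightarrow> real) \<Rightarrow> real" where
  "wLp_norm p k f = (\<integral> v. vzero v powr k * \<bar>f v\<bar> powr p \<partial>lborel) powr (1/p)"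

end

theory Submission
  imports Defs
begin

text \<open>
  By Hoelder's inequality (here in the elementary form \<open>y \<le> c + c powr (1 - p) * y powr p\<close>), \<open>|Q\<^sup>+(f, h)|\<^sup>p\<close> is, up to a constant, at most
  the \<open>(p-1)\<close>-st power of the gain term of \<open>|f|\<close> and \<open>(v\<^sup>0) powr (-\<eta>)\<close> times the gain term of \<open>|f|\<close>
  and \<open>(v\<^sup>0) powr (\<eta> (p-1)) |h|\<^sup>p\<close>. The first factor is bounded uniformly in \<open>v\<close> by the \<open>L\<^sup>1\<close> norm of \<open>f\<close>,
  and the second is integrated in \<open>v\<close> by means of the invariance of the collision measure under
  the exchange of the momenta before and after the collision. Both estimates become one-dimensional
  after the centre of momentum angle \<open>\<omega>\<close> has been replaced by the direction \<open>k\<close> of momentum transfer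
  (Glassey-Strauss variables): for fixed \<open>k\<close> only the components along \<open>k\<close> change. At fixed total
  momentum the collision is then an involution of a line that preserves the energy. At fixed \<open>v\<close>, the
  component of \<open>w\<close> along \<open>k\<close> can be traded for the signed length \<open>t\<close> of \<open>v' - v = t k\<close>, so that \<open>(t, k)\<close> are polar
  coordinates of \<open>v'\<close> and there remains an integral over the plane orthogonal to \<open>k\<close>; the singularity
  of its kernel is cancelled by the bound of \<open>g sin \<theta>\<close> by twice the relative momentum of \<open>v\<close> and \<open>v'\<close>.
\<close>

section \<open>Changes of variables for the Lebesgue integral\<close>

text \<open>The splitting that stands in for Hoelder's inequality is applied inside the integrand
  with a free constant. Both terms are then linear in nonnegative integrals, and the constant is
  optimised only at the end, for each \<open>v\<close> separately. The two terms need different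
  bounds of the cross-section. In the term without \<open>h\<close> the momentum \<open>v\<close> is
  fixed, and passing from \<open>w\<close> to \<open>v'\<close> costs a factor that blows up like
  the inverse relative momentum of \<open>v\<close> and \<open>v'\<close> as they approach each
  other; \<open>g * sin \<theta>\<close> must make up for it. In the term with \<open>h\<close> the
  factor \<open>g\<close> is kept instead, because it is a collision invariant and survives the
  exchange of the momenta. There the product of \<open>moller\<close> and \<open>g\<close> grows
  like the square root of both energies, which is where the weight exponent 1/2 comes from. Nearly
  everything is stated for integrals of nonnegative extended reals, so that Fubini's theorem and
  substitutions ask for measurability only.\<close>

lemma nn_integral_change_of_variables_lebesgue:
  fixes g g' :: "real \<Rightarrow> real" and F :: "real \<Rightarrow> ennreal"
  assumes S[measurable]: "S \<in> sets borel"
    and der: "\<And>x. x \<in> S \<Longrightarrow> (g has_field_derivative g' x) (at x)"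
    and inj: "inj_on g S"
    and [measurable]: "g \<in> borel_measurable borel" "g' \<in> borel_measurable borel" "F \<in> borel_measurable borel"
  shows "(\<integral>\<^sup>+x. ennreal \<bar>g' x\<bar> * F (g x) * indicator S x \<partial>lborel) = (\<integral>\<^sup>+y. F y * indicator (g ` S) y \<partial>lebesgue)"
proof -
  have Sl: "S \<in> sets lebesgue" using S by simp
  have "g differentiable_on S"
    unfolding differentiable_on_def using der
    by (meson differentiableI has_field_derivative_at_within has_field_derivative_imp_has_derivative)
  then have gS: "g ` S \<in> sets lebesgue"
    using Sl by (intro differentiable_image_in_sets_lebesgue) auto
  \<comment> \<open>The two sides of the claim are the integrals of \<open>F\<close> against these
    two measures. The second is built from \<open>lebesgue\<close>, since the image of
    \<open>S\<close> is only known to be Lebesgue measurable.\<close>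
  define \<mu> where "\<mu> = distr (density lborel (\<lambda>x. ennreal \<bar>g' x\<bar> * indicator S x)) borel g"
  define \<nu> where "\<nu> = distr (density lebesgue (indicator (g ` S))) borel (\<lambda>x. x)"
  have id_meas: "(\<lambda>x. x) \<in> measurable lebesgue (borel :: real measure)"
    by (simp add: measurable_completion)
  \<comment> \<open>Boundedness makes the indicator of \<open>B\<close> absolutely integrable, as
    the change of variables for real functions demands. Arbitrary Borel sets are then exhausted by
    the intervals \<open>{- real n..real n}\<close>.\<close>
  have bounded_eq: "emeasure \<mu> B = emeasure \<nu> B" if B[measurable]: "B \<in> sets borel" and "B \<subseteq> {- real n..real n}" for B n
  proof -
    have "emeasure lborel B \<le> emeasure lborel {- real n..real n}"
      using that by (intro emeasure_mono) auto
    then have Bfin: "emeasure lborel B < \<infinity>"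
      by (simp add: ennreal_less_top order.strict_trans1 less_top top.not_eq_extremum)
    have "(indicator B :: real \<Rightarrow> real) absolutely_integrable_on UNIV"
      using Bfin by (simp add: absolutely_integrable_on_def set_integrable_def integrable_completion )
    then have ai: "(indicator B :: real \<Rightarrow> real) absolutely_integrable_on (g ` S)"
      using gS set_integrable_subset by blast
    obtain b where b: "integral (g ` S) (indicator B :: real \<Rightarrow> real) = b" by blast
    have *: "(\<lambda>x. \<bar>g' x\<bar> * (indicator B (g x) :: real)) absolutely_integrable_on S"
       "integral S (\<lambda>x. \<bar>g' x\<bar> * (indicator B (g x) :: real)) = b"
      using has_absolute_integral_change_of_variables_1'[OF Sl has_field_derivative_at_within[OF der] inj, of "indicator B" b] ai b
      by auto
    have "emeasure \<mu> B = (\<integral>\<^sup>+x. ennreal \<bar>g' x\<bar> * indicator S x * indicator B (g x) \<partial>lborel)"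
      unfolding \<mu>_def
      by (subst nn_integral_indicator[symmetric], simp, subst nn_integral_distr)
        (auto simp: nn_integral_density mult_ac)
    also have "\<dots> = (\<integral>\<^sup>+x. ennreal (indicator S x *\<^sub>R (\<bar>g' x\<bar> * indicator B (g x))) \<partial>lebesgue)"
      by (subst nn_integral_completion) (auto intro!: nn_integral_cong simp: indicator_def)
    also have "\<dots> = ennreal (\<integral>x. indicator S x *\<^sub>R (\<bar>g' x\<bar> * indicator B (g x)) \<partial>lebesgue)"
      using *(1) by (intro nn_integral_eq_integral) (auto simp: set_integrable_def)
    also have "\<dots> = ennreal b"
      using *(2) set_lebesgue_integral_eq_integral(2)[OF *(1)] by (simp add: set_lebesgue_integral_def)
    also have "\<dots> = ennreal (\<integral>x. indicator (g ` S) x *\<^sub>R (indicator B x :: real) \<partial>lebesgue)"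
      using b set_lebesgue_integral_eq_integral(2)[OF ai] by (simp add: set_lebesgue_integral_def)
    also have "\<dots> = (\<integral>\<^sup>+x. ennreal (indicator (g ` S) x *\<^sub>R (indicator B x :: real)) \<partial>lebesgue)"
      using ai by (intro nn_integral_eq_integral[symmetric]) (auto simp: set_integrable_def)
    also have "\<dots> = (\<integral>\<^sup>+x. indicator (g ` S) x * indicator B x \<partial>lebesgue)"
      by (auto intro!: nn_integral_cong simp: indicator_def)
    also have "\<dots> = emeasure \<nu> B"
      unfolding \<nu>_def using gS id_meas
      by (simp add: emeasure_distr emeasure_density)
    finally show ?thesis .
  qed
  have "\<mu> = \<nu>"
  proof (rule measure_eqI)
    show "sets \<mu> = sets \<nu>" by (simp add: \<mu>_def \<nu>_def)
    fix B assume "B \<in> sets \<mu>"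
    then have B[measurable]: "B \<in> sets borel" by (simp add: \<mu>_def)
    define Bn where "Bn n = B \<inter> {- real n..real n}" for n
    have U: "B = (\<Union>n. Bn n)"
    proof -
      have "\<exists>n. \<bar>x\<bar> \<le> real n" for x :: real by (simp add: real_arch_simple)
      then show ?thesis unfolding Bn_def by (auto simp: abs_le_iff) (metis minus_le_iff)
    qed
    have inc: "incseq Bn" unfolding Bn_def incseq_def by auto
    have Bn: "range Bn \<subseteq> sets borel" unfolding Bn_def by auto
    have "emeasure \<mu> B = (SUP n. emeasure \<mu> (Bn n))"
      unfolding U by (rule SUP_emeasure_incseq[symmetric]) (use inc Bn in \<open>auto simp: \<mu>_def\<close>)
    also have "\<dots> = (SUP n. emeasure \<nu> (Bn n))"
      using bounded_eq[of "Bn _"] by (intro SUP_cong) (auto simp: Bn_def)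
    also have "\<dots> = emeasure \<nu> B"
      unfolding U by (rule SUP_emeasure_incseq) (use inc Bn in \<open>auto simp: \<nu>_def\<close>)
    finally show "emeasure \<mu> B = emeasure \<nu> B" .
  qed
  have "(\<integral>\<^sup>+x. ennreal \<bar>g' x\<bar> * F (g x) * indicator S x \<partial>lborel) = (\<integral>\<^sup>+y. F y \<partial>\<mu>)"
    unfolding \<mu>_def by (subst nn_integral_distr) (auto simp: nn_integral_density mult_ac)
  also have "\<dots> = (\<integral>\<^sup>+y. F y \<partial>\<nu>)" using \<open>\<mu> = \<nu>\<close> by simp
  also have "\<dots> = (\<integral>\<^sup>+y. F y * indicator (g ` S) y \<partial>lebesgue)"
    unfolding \<nu>_def using gS id_meas
    by (subst nn_integral_distr) (auto simp: nn_integral_density mult_ac measurable_completion)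
  finally show ?thesis .
qed

lemma nn_integral_change_of_variables:
  fixes g g' :: "real \<Rightarrow> real" and F :: "real \<Rightarrow> ennreal"
  assumes "S \<in> sets borel" "\<And>x. x \<in> S \<Longrightarrow> (g has_field_derivative g' x) (at x)"
    "inj_on g S" "g ` S = T" "T \<in> sets borel"
    "g \<in> borel_measurable borel" "g' \<in> borel_measurable borel" "F \<in> borel_measurable borel"
  shows "(\<integral>\<^sup>+x. ennreal \<bar>g' x\<bar> * F (g x) * indicator S x \<partial>lborel) = (\<integral>\<^sup>+y. F y * indicator T y \<partial>lborel)"
  using nn_integral_change_of_variables_lebesgue[of S g g' F] assms by (simp add: nn_integral_completion)

text \<open>Meant for injective substitutions whose image is not identified: enlarging the image to
  the whole line only increases the integral.\<close>

lemma nn_integral_change_of_variables_le: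
  fixes g g' :: "real \<Rightarrow> real" and F :: "real \<Rightarrow> ennreal"
  assumes "S \<in> sets borel" "\<And>x. x \<in> S \<Longrightarrow> (g has_field_derivative g' x) (at x)" "inj_on g S"
    "g \<in> borel_measurable borel" "g' \<in> borel_measurable borel" "F \<in> borel_measurable borel"
  shows "(\<integral>\<^sup>+x. ennreal \<bar>g' x\<bar> * F (g x) * indicator S x \<partial>lborel) \<le> (\<integral>\<^sup>+y. F y \<partial>lborel)"
proof -
  have "(\<integral>\<^sup>+y. F y * indicator (g ` S) y \<partial>lebesgue) \<le> (\<integral>\<^sup>+y. F y \<partial>lebesgue)"
    by (intro nn_integral_mono) (auto simp: indicator_def)
  then show ?thesis
    using nn_integral_change_of_variables_lebesgue[of S g g' F] assms by (simp add: nn_integral_completion)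
qed

text \<open>Lebesgue measure is determined by its values on boxes. The image measure under
  \<open>f\<close>, rescaled by the determinant, has the right ones because the preimage of a box
  under \<open>f\<close> is its image under the inverse \<open>g\<close>.\<close>

lemma nn_integral_linear_image:
  fixes f g :: "real^'n::{finite,wellorder} \<Rightarrow> real^'n::_" and F :: "real^'n::_ \<Rightarrow> ennreal"
  assumes "linear f" "linear g" and fg: "\<And>x. f (g x) = x" "\<And>x. g (f x) = x"
    and F: "F \<in> borel_measurable borel"
  shows "(\<integral>\<^sup>+x. F x \<partial>lborel) = ennreal \<bar>det (matrix f)\<bar> * (\<integral>\<^sup>+x. F (f x) \<partial>lborel)"
proof -
  have [measurable]: "f \<in> borel_measurable borel"
    using \<open>linear f\<close> by (simp add: borel_measurable_continuous_onI linear_continuous_on linear_linear)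
  note F[measurable]
  have "matrix f ** matrix g = mat 1"
  proof -
    have "f \<circ> g = id" using fg by auto
    then show ?thesis
      using matrix_compose[OF \<open>linear g\<close> \<open>linear f\<close>] by (simp add: matrix_id_mat_1)
  qed
  then have "det (matrix f) * det (matrix g) = 1"
    by (metis det_I det_mul)
  then have d1: "\<bar>det (matrix f)\<bar> * \<bar>det (matrix g)\<bar> = 1"
    by (metis abs_mult abs_one)
  define M where "M = density (distr lborel borel f) (\<lambda>_. ennreal \<bar>det (matrix f)\<bar>)"
  have "lborel = M"
  proof (rule lborel_eqI)
    show "sets M = sets borel" by (simp add: M_def)
    fix l u :: "real^'n::_" assume lu: "\<And>b. b \<in> Basis \<Longrightarrow> l \<bullet> b \<le> u \<bullet> b"
    have vim: "f -` box l u = g ` box l u"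
      using fg by (auto simp: image_iff) metis
    have "emeasure M (box l u) = ennreal \<bar>det (matrix f)\<bar> * emeasure lborel (f -` box l u)"
      unfolding M_def by (simp add: emeasure_density nn_integral_cmult_indicator emeasure_distr)
    also have "emeasure lborel (f -` box l u) = emeasure lebesgue (g ` box l u)"
      unfolding vim[symmetric] using measurable_sets_borel[of f borel "box l u"] by simp
    also have "\<dots> = ennreal (measure lebesgue (g ` box l u))"
      using measurable_linear_image[OF \<open>linear g\<close>, of "box l u"]
      by (intro emeasure_eq_measure2) auto
    also have "\<dots> = ennreal (\<bar>det (matrix g)\<bar> * measure lebesgue (box l u))"
      by (subst measure_linear_image) (use \<open>linear g\<close> in auto)
    also have "ennreal \<bar>det (matrix f)\<bar> * \<dots> = ennreal (measure lebesgue (box l u))"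
      using d1 by (simp add: ennreal_mult[symmetric] mult.assoc[symmetric])
    also have "\<dots> = (\<Prod>b\<in>Basis. (u - l) \<bullet> b)"
      using lu by (simp add: measure_lborel_box_eq)
    finally show "emeasure M (box l u) = (\<Prod>b\<in>Basis. (u - l) \<bullet> b)" .
  qed
  then have "(\<integral>\<^sup>+x. F x \<partial>lborel) = (\<integral>\<^sup>+x. F x \<partial>M)" by simp
  also have "\<dots> = ennreal \<bar>det (matrix f)\<bar> * (\<integral>\<^sup>+x. F (f x) \<partial>lborel)"
    unfolding M_def by (simp add: nn_integral_density nn_integral_distr nn_integral_cmult)
  finally show ?thesis .
qed

lemma nn_integral_orthogonal:
  fixes f :: "real^'n::{finite,wellorder} \<Rightarrow> real^'n::_" and F :: "real^'n::_ \<Rightarrow> ennreal"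
  assumes f: "orthogonal_transformation f" and F: "F \<in> borel_measurable borel"
  shows "(\<integral>\<^sup>+x. F (f x) \<partial>lborel) = (\<integral>\<^sup>+x. F x \<partial>lborel)"
proof -
  have "bij f" using f by (rule orthogonal_transformation_bij)
  have "\<bar>det (matrix f)\<bar> = 1"
    using f orthogonal_transformation_det by blast
  then show ?thesis
    using nn_integral_linear_image[of f "inv f" F] f F \<open>bij f\<close>
    by (simp add: orthogonal_transformation_linear orthogonal_transformation_inv bij_is_surj surj_f_inv_f
        bij_is_inj)
qed

section \<open>Cartesian and polar coordinates\<close>

lemma vector_3_eq: "vector [x, y, z] = x *\<^sub>R axis 1 1 + y *\<^sub>R axis 2 1 + z *\<^sub>R (axis 3 1 :: real^3)"
  by (simp add: vec_eq_iff forall_3 axis_def)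

lemma measurable_vector_3[measurable (raw)]:
  assumes [measurable]: "f \<in> borel_measurable M" "g \<in> borel_measurable M" "h \<in> borel_measurable M"
  shows "(\<lambda>x. vector [f x, g x, h x] :: real^3) \<in> borel_measurable M"
  unfolding vector_3_eq by measurable

lemma nn_integral_vec3:
  fixes F :: "real^3 \<Rightarrow> ennreal"
  assumes [measurable]: "F \<in> borel_measurable borel"
  shows "(\<integral>\<^sup>+x. F x \<partial>lborel) = (\<integral>\<^sup>+x. \<integral>\<^sup>+y. \<integral>\<^sup>+z. F (vector [x, y, z]) \<partial>lborel \<partial>lborel \<partial>lborel)"
proof -
  let ?a = "axis 1 1 :: real^3" and ?b = "axis 2 1 :: real^3" and ?c = "axis 3 1 :: real^3"
  have ne: "?a \<noteq> ?b" "?a \<noteq> ?c" "?b \<noteq> ?c" by (auto simp: axis_eq_axis)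
  have B: "(Basis :: (real^3) set) = {?a, ?b, ?c}"
    by (auto simp: Basis_vec_def UNIV_3)
  interpret product_sigma_finite "\<lambda>_ :: real^3. lborel :: real measure" ..
  have 1: "(\<Sum>b\<in>Basis. f b *\<^sub>R b) = vector [f ?a, f ?b, f ?c]" for f :: "real^3 \<Rightarrow> real"
    unfolding B vector_3_eq using ne by simp
  have "(\<integral>\<^sup>+x. F x \<partial>lborel) = (\<integral>\<^sup>+f. F (vector [f ?a, f ?b, f ?c]) \<partial>(Pi\<^sub>M {?a, ?b, ?c} (\<lambda>_. lborel)))"
    by (subst lborel_eq) (simp add: 1 nn_integral_distr B[symmetric] measurable_vector_3)
  also have "\<dots> = (\<integral>\<^sup>+x. \<integral>\<^sup>+f. F (vector [x, f ?b, f ?c]) \<partial>(Pi\<^sub>M {?b, ?c} (\<lambda>_. lborel)) \<partial>lborel)"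
    using ne by (subst product_nn_integral_insert_rev) (auto)
  also have "\<dots> = (\<integral>\<^sup>+x. \<integral>\<^sup>+y. \<integral>\<^sup>+f. F (vector [x, y, f ?c]) \<partial>(Pi\<^sub>M {?c} (\<lambda>_. lborel)) \<partial>lborel \<partial>lborel)"
    using ne by (subst product_nn_integral_insert_rev) (auto)
  also have "\<dots> = (\<integral>\<^sup>+x. \<integral>\<^sup>+y. \<integral>\<^sup>+z. F (vector [x, y, z]) \<partial>lborel \<partial>lborel \<partial>lborel)"
    by (subst product_nn_integral_singleton) auto
  finally show ?thesis .
qed

text \<open>At height \<open>y\<close> the point with polar angle \<psi> has the abscissa
  \<open>y * cot \<psi>\<close>, so this trades the abscissa for the angle.\<close>

lemma nn_integral_cot:
  fixes G :: "real \<Rightarrow> ennreal"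
  assumes [measurable]: "G \<in> borel_measurable borel" and y: "y > 0"
  shows "(\<integral>\<^sup>+x. G x \<partial>lborel) = (\<integral>\<^sup>+\<psi>. ennreal (y / (sin \<psi>)\<^sup>2) * G (y * cot \<psi>) * indicator {0<..<pi} \<psi> \<partial>lborel)"
proof -
  have cot_eq: "cot \<psi> = tan (pi / 2 - \<psi>)" for \<psi> :: real
    by (simp add: cot_def tan_def sin_diff cos_diff)
  have inv: "pi / 2 - arctan (cot \<psi>) = \<psi>" if "0 < \<psi>" "\<psi> < pi" for \<psi>
    unfolding cot_eq using that by (subst arctan_tan) auto
  have inj: "inj_on (\<lambda>\<psi>. y * cot \<psi>) {0<..<pi}"
  proof (rule inj_onI)
    fix a b assume *: "a \<in> {0<..<pi}" "b \<in> {0<..<pi}" and "y * cot a = y * cot b"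
    then have "cot a = cot b" using y by simp
    then show "a = b" using inv * by (metis greaterThanLessThan_iff)
  qed
  have "x \<in> (\<lambda>\<psi>. y * cot \<psi>) ` {0<..<pi}" for x
    using y arctan_ubound[of "x / y"] arctan_lbound[of "x / y"]
    by (intro image_eqI[of _ _ "pi / 2 - arctan (x / y)"]) (auto simp: cot_eq tan_arctan)
  then have im: "(\<lambda>\<psi>. y * cot \<psi>) ` {0<..<pi} = UNIV" by auto
  have [measurable]: "(cot :: real \<Rightarrow> real) \<in> borel_measurable borel"
    unfolding cot_def[abs_def] by measurable
  have der: "((\<lambda>\<psi>. y * cot \<psi>) has_field_derivative - (y / (sin x)\<^sup>2)) (at x)" if "x \<in> {0<..<pi}" for x
    using that sin_gt_zero[of x] DERIV_cmult[OF DERIV_cot, of x y] by (simp add: divide_inverse)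
  have "(\<integral>\<^sup>+x. G x \<partial>lborel) = (\<integral>\<^sup>+x. G x * indicator UNIV x \<partial>lborel)" by simp
  also have "\<dots> = (\<integral>\<^sup>+\<psi>. ennreal \<bar>- (y / (sin \<psi>)\<^sup>2)\<bar> * G (y * cot \<psi>) * indicator {0<..<pi} \<psi> \<partial>lborel)"
    by (rule nn_integral_change_of_variables[symmetric, OF _ der inj im]) auto
  also have "\<dots> = (\<integral>\<^sup>+\<psi>. ennreal (y / (sin \<psi>)\<^sup>2) * G (y * cot \<psi>) * indicator {0<..<pi} \<psi> \<partial>lborel)"
    using y by simp
  finally show ?thesis .
qed

lemma nn_integral_scale:
  fixes f :: "real \<Rightarrow> ennreal"
  assumes [measurable]: "f \<in> borel_measurable borel" and "c > 0"
  shows "(\<integral>\<^sup>+x. f x \<partial>lborel) = (\<integral>\<^sup>+x. ennreal c * f (c * x) \<partial>lborel)"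
  using nn_integral_real_affine[of f c 0] assms by (simp add: nn_integral_cmult)

text \<open>Two one-dimensional substitutions suffice: the abscissa becomes an angle at fixed
  height, then the height \<open>r * sin \<psi>\<close> becomes a radius at fixed angle. Their
  factors \<open>y / (sin \<psi>)\<^sup>2\<close> and \<open>sin \<psi>\<close> multiply to
  \<open>r\<close>. The half plane also serves for the polar angle of the sphere, with the distance
  from the axis as height.\<close>

lemma nn_integral_polar_half_plane:
  fixes F :: "real \<Rightarrow> real \<Rightarrow> ennreal"
  assumes [measurable]: "case_prod F \<in> borel_measurable (borel \<Otimes>\<^sub>M borel)"
  shows "(\<integral>\<^sup>+y. \<integral>\<^sup>+x. F x y * indicator {0<..} y \<partial>lborel \<partial>lborel) =
    (\<integral>\<^sup>+\<psi>. \<integral>\<^sup>+r. ennreal r * F (r * cos \<psi>) (r * sin \<psi>) * indicator {0<..} r * indicator {0<..<pi} \<psi> \<partial>lborel \<partial>lborel)"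
proof -
  have [measurable]: "(cot :: real \<Rightarrow> real) \<in> borel_measurable borel"
    unfolding cot_def[abs_def] by measurable
  have "(\<integral>\<^sup>+y. \<integral>\<^sup>+x. F x y * indicator {0<..} y \<partial>lborel \<partial>lborel) =
    (\<integral>\<^sup>+y. \<integral>\<^sup>+\<psi>. ennreal (y / (sin \<psi>)\<^sup>2) * F (y * cot \<psi>) y * indicator {0<..<pi} \<psi> * indicator {0<..} y \<partial>lborel \<partial>lborel)"
  proof (rule nn_integral_cong)
    fix y :: real
    show "(\<integral>\<^sup>+x. F x y * indicator {0<..} y \<partial>lborel) =
      (\<integral>\<^sup>+\<psi>. ennreal (y / (sin \<psi>)\<^sup>2) * F (y * cot \<psi>) y * indicator {0<..<pi} \<psi> * indicator {0<..} y \<partial>lborel)"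
      by (cases "y > 0") (use nn_integral_cot[of "\<lambda>x. F x y" y] in auto)
  qed
  also have "\<dots> = (\<integral>\<^sup>+\<psi>. \<integral>\<^sup>+y. ennreal (y / (sin \<psi>)\<^sup>2) * F (y * cot \<psi>) y * indicator {0<..<pi} \<psi> * indicator {0<..} y \<partial>lborel \<partial>lborel)"
    by (rule lborel_pair.Fubini') measurable
  also have "\<dots> = (\<integral>\<^sup>+\<psi>. \<integral>\<^sup>+r. ennreal r * F (r * cos \<psi>) (r * sin \<psi>) * indicator {0<..} r * indicator {0<..<pi} \<psi> \<partial>lborel \<partial>lborel)"
  proof (rule nn_integral_cong)
    fix \<psi> :: real
    show "(\<integral>\<^sup>+y. ennreal (y / (sin \<psi>)\<^sup>2) * F (y * cot \<psi>) y * indicator {0<..<pi} \<psi> * indicator {0<..} y \<partial>lborel)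
      = (\<integral>\<^sup>+r. ennreal r * F (r * cos \<psi>) (r * sin \<psi>) * indicator {0<..} r * indicator {0<..<pi} \<psi> \<partial>lborel)"
    proof (cases "0 < \<psi> \<and> \<psi> < pi")
      case True
      then have s: "sin \<psi> > 0" by (simp add: sin_gt_zero)
      have "ennreal (sin \<psi>) * (ennreal (sin \<psi> * r / (sin \<psi>)\<^sup>2) * F (sin \<psi> * r * cot \<psi>) (sin \<psi> * r) *
          indicator {0<..<pi} \<psi> * indicator {0<..} (sin \<psi> * r)) =
        ennreal r * F (r * cos \<psi>) (r * sin \<psi>) * indicator {0<..} r * indicator {0<..<pi} \<psi>" for r
      proof (cases "r > 0")
        case r: True
        have 1: "sin \<psi> * r * cot \<psi> = r * cos \<psi>" using s by (simp add: cot_def)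
        have 2: "ennreal (sin \<psi>) * ennreal (sin \<psi> * r / (sin \<psi>)\<^sup>2) = ennreal r"
          using s r by (simp add: ennreal_mult[symmetric] power2_eq_square)
        show ?thesis
          unfolding 1 mult.assoc[symmetric] 2 using r s
          by (simp add: mult.commute[of "sin \<psi>" r])
      qed (use s in \<open>simp add: zero_less_mult_iff\<close>)
      note eq = this
      show ?thesis
        unfolding eq[symmetric]
        by (rule nn_integral_scale[OF _ s]) measurable
    qed (auto simp: indicator_def)
  qed
  finally show ?thesis .
qed

text \<open>The point reflection exchanges the two half planes and adds pi to the angle; the line
  \<open>y = 0\<close> and the angle pi are null sets.\<close>

lemma nn_integral_polar:
  fixes F :: "real \<Rightarrow> real \<Rightarrow> ennreal"
  assumes [measurable]: "case_prod F \<in> borel_measurable (borel \<Otimes>\<^sub>M borel)"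
  shows "(\<integral>\<^sup>+x. \<integral>\<^sup>+y. F x y \<partial>lborel \<partial>lborel) =
    (\<integral>\<^sup>+\<psi>. \<integral>\<^sup>+r. ennreal r * F (r * cos \<psi>) (r * sin \<psi>) * indicator {0<..} r * indicator {0<..<2*pi} \<psi> \<partial>lborel \<partial>lborel)"
proof -
  define H where "H \<psi> = (\<integral>\<^sup>+r. ennreal r * F (r * cos \<psi>) (r * sin \<psi>) * indicator {0<..} r \<partial>lborel)" for \<psi>
  have [measurable]: "H \<in> borel_measurable borel" unfolding H_def by measurable
  have Hc: "(\<integral>\<^sup>+r. ennreal r * F (r * cos \<psi>) (r * sin \<psi>) * indicator {0<..} r * indicator A \<psi> \<partial>lborel) = H \<psi> * indicator A \<psi>" for \<psi> A
    unfolding H_def by (simp add: nn_integral_multc)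
  have "(\<integral>\<^sup>+x. \<integral>\<^sup>+y. F x y \<partial>lborel \<partial>lborel) = (\<integral>\<^sup>+y. \<integral>\<^sup>+x. F x y \<partial>lborel \<partial>lborel)"
    by (rule lborel_pair.Fubini') measurable
  also have "\<dots> = (\<integral>\<^sup>+y. (\<integral>\<^sup>+x. F x y * indicator {0<..} y \<partial>lborel) + (\<integral>\<^sup>+x. F x y * indicator {..<0} y \<partial>lborel) \<partial>lborel)"
    by (intro nn_integral_cong_AE AE_I[of _ _ "{0}"]) (auto simp: indicator_def not_less split: if_splits)
  also have "\<dots> = (\<integral>\<^sup>+y. \<integral>\<^sup>+x. F x y * indicator {0<..} y \<partial>lborel \<partial>lborel) + (\<integral>\<^sup>+y. \<integral>\<^sup>+x. F x y * indicator {..<0} y \<partial>lborel \<partial>lborel)"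
    by (rule nn_integral_add) measurable
  also have "(\<integral>\<^sup>+y. \<integral>\<^sup>+x. F x y * indicator {..<0} y \<partial>lborel \<partial>lborel) = (\<integral>\<^sup>+y. \<integral>\<^sup>+x. F (- x) (- y) * indicator {0<..} y \<partial>lborel \<partial>lborel)"
  proof -
    have "(\<integral>\<^sup>+y. \<integral>\<^sup>+x. F x y * indicator {..<0} y \<partial>lborel \<partial>lborel) = (\<integral>\<^sup>+y. \<integral>\<^sup>+x. F x (- y) * indicator {..<0} (- y) \<partial>lborel \<partial>lborel)"
      by (subst nn_integral_real_affine[of _ "-1" 0]) auto
    also have "\<dots> = (\<integral>\<^sup>+y. \<integral>\<^sup>+x. F (- x) (- y) * indicator {0<..} y \<partial>lborel \<partial>lborel)"
      by (rule nn_integral_cong, subst nn_integral_real_affine[of _ "-1" 0]) (auto simp: indicator_def)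
    finally show ?thesis .
  qed
  also have "(\<integral>\<^sup>+y. \<integral>\<^sup>+x. F x y * indicator {0<..} y \<partial>lborel \<partial>lborel) = (\<integral>\<^sup>+\<psi>. H \<psi> * indicator {0<..<pi} \<psi> \<partial>lborel)"
    by (subst nn_integral_polar_half_plane) (simp_all add: Hc)
  also have "(\<integral>\<^sup>+y. \<integral>\<^sup>+x. F (- x) (- y) * indicator {0<..} y \<partial>lborel \<partial>lborel) = (\<integral>\<^sup>+\<psi>. H (pi + \<psi>) * indicator {0<..<pi} \<psi> \<partial>lborel)"
    unfolding H_def by (subst nn_integral_polar_half_plane) (simp_all add: nn_integral_multc)
  also have "\<dots> = (\<integral>\<^sup>+\<psi>. H \<psi> * indicator {pi<..<2*pi} \<psi> \<partial>lborel)"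
  proof -
    have "(\<integral>\<^sup>+\<psi>. H \<psi> * indicator {pi<..<2*pi} \<psi> \<partial>lborel) = (\<integral>\<^sup>+\<psi>. H (pi + \<psi>) * indicator {pi<..<2*pi} (pi + \<psi>) \<partial>lborel)"
      by (subst nn_integral_real_affine[of _ 1 pi]) auto
    also have "\<dots> = (\<integral>\<^sup>+\<psi>. H (pi + \<psi>) * indicator {0<..<pi} \<psi> \<partial>lborel)"
      by (rule nn_integral_cong) (auto simp: indicator_def)
    finally show ?thesis ..
  qed
  also have "(\<integral>\<^sup>+\<psi>. H \<psi> * indicator {0<..<pi} \<psi> \<partial>lborel) + \<dots> = (\<integral>\<^sup>+\<psi>. H \<psi> * indicator {0<..<pi} \<psi> + H \<psi> * indicator {pi<..<2*pi} \<psi> \<partial>lborel)"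
    by (rule nn_integral_add[symmetric]) measurable
  also have "\<dots> = (\<integral>\<^sup>+\<psi>. H \<psi> * indicator {0<..<2*pi} \<psi> \<partial>lborel)"
    by (intro nn_integral_cong_AE AE_I[of _ _ "{pi}"]) (auto simp: indicator_def not_less split: if_splits)
  finally show ?thesis by (simp add: Hc)
qed

section \<open>The surface measure of the sphere\<close>

text \<open>With the density \<open>sin \<phi>\<close> on the open rectangle it reproduces the
  iterated integral of \<open>sphere_integral\<close>, but as a measure it admits Fubini's theorem
  and linear substitutions. It lives on the whole space and is concentrated on the unit
  sphere.\<close>

definition sphere_measure :: "vec3 measure" where
  "sphere_measure = distr (density (lborel \<Otimes>\<^sub>M lborel)
     (\<lambda>(\<phi>, \<psi>). ennreal (sin \<phi>) * indicator {0<..<pi} \<phi> * indicator {0<..<2 * pi} \<psi>))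
     borel (\<lambda>(\<phi>, \<psi>). sphere_pt \<phi> \<psi>)"

lemma sets_sphere_measure[simp, measurable_cong]: "sets sphere_measure = sets borel"
  by (simp add: sphere_measure_def)

lemma space_sphere_measure[simp]: "space sphere_measure = UNIV"
  by (simp add: sphere_measure_def)

lemma measurable_sphere_pt[measurable (raw)]:
  assumes [measurable]: "f \<in> borel_measurable M" "g \<in> borel_measurable M"
  shows "(\<lambda>x. sphere_pt (f x) (g x)) \<in> borel_measurable M"
  unfolding sphere_pt_def by measurable

lemma norm_vector_3: "(norm (vector [x, y, z] :: real^3))\<^sup>2 = x\<^sup>2 + y\<^sup>2 + z\<^sup>2"
  unfolding power2_norm_eq_inner inner_vec_def sum_3 by (simp add: power2_eq_square)

lemma norm_sphere_pt[simp]: "norm (sphere_pt \<phi> \<psi>) = 1"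
proof -
  have "(norm (sphere_pt \<phi> \<psi>))\<^sup>2 = (sin \<phi>)\<^sup>2 * ((sin \<psi>)\<^sup>2 + (cos \<psi>)\<^sup>2) + (cos \<phi>)\<^sup>2"
    unfolding sphere_pt_def norm_vector_3 by algebra
  then have "(norm (sphere_pt \<phi> \<psi>))\<^sup>2 = 1" by simp
  then show ?thesis by (simp add: power2_eq_1_iff) (metis abs_norm_cancel abs_1 abs_minus_cancel)
qed

lemma nn_integral_sphere_measure:
  assumes [measurable]: "F \<in> borel_measurable borel"
  shows "(\<integral>\<^sup>+\<omega>. F \<omega> \<partial>sphere_measure) =
    (\<integral>\<^sup>+\<phi>. \<integral>\<^sup>+\<psi>. ennreal (sin \<phi>) * indicator {0<..<pi} \<phi> * indicator {0<..<2 * pi} \<psi> * F (sphere_pt \<phi> \<psi>) \<partial>lborel \<partial>lborel)"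
  unfolding sphere_measure_def
  by (simp add: nn_integral_distr nn_integral_density split_beta' lborel.nn_integral_fst[symmetric])

lemma AE_sphere_measure: "AE \<omega> in sphere_measure. norm \<omega> = 1"
  unfolding sphere_measure_def by (subst AE_distr_iff) (auto simp: split_beta')

lemma nn_integral_sphere_cong:
  "(\<And>\<omega>. norm \<omega> = 1 \<Longrightarrow> F \<omega> = G \<omega>) \<Longrightarrow> (\<integral>\<^sup>+\<omega>. F \<omega> \<partial>sphere_measure) = (\<integral>\<^sup>+\<omega>. G \<omega> \<partial>sphere_measure)"
  using AE_sphere_measure by (intro nn_integral_cong_AE) auto

lemma nn_integral_sphere_mono:
  "(\<And>\<omega>. norm \<omega> = 1 \<Longrightarrow> F \<omega> \<le> G \<omega>) \<Longrightarrow> (\<integral>\<^sup>+\<omega>. F \<omega> \<partial>sphere_measure) \<le> (\<integral>\<^sup>+\<omega>. G \<omega> \<partial>sphere_measure)"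
  using AE_sphere_measure by (intro nn_integral_mono_AE) auto

text \<open>\<open>sin \<phi>\<close> is replaced by 1, hence \<open>2 * pi\<^sup>2\<close> in place
  of the exact area 4 pi.\<close>

lemma emeasure_sphere_measure_le: "emeasure sphere_measure UNIV \<le> ennreal (2 * pi\<^sup>2)"
proof -
  have "emeasure sphere_measure UNIV = (\<integral>\<^sup>+\<omega>. 1 \<partial>sphere_measure)" by simp
  also have "\<dots> \<le> (\<integral>\<^sup>+\<phi>. \<integral>\<^sup>+\<psi>. indicator {0<..<pi} \<phi> * indicator {0<..<2 * pi} \<psi> \<partial>lborel \<partial>lborel)"
    by (subst nn_integral_sphere_measure) (auto intro!: nn_integral_mono simp: indicator_def)
  also have "\<dots> = ennreal (2 * pi\<^sup>2)"
    by (simp add: nn_integral_cmult nn_integral_multc ennreal_mult[symmetric] power2_eq_square mult_ac)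
  finally show ?thesis .
qed

interpretation sphere: finite_measure sphere_measure
proof
  show "emeasure sphere_measure (space sphere_measure) \<noteq> \<infinity>"
    using emeasure_sphere_measure_le by (auto simp: top_unique)
qed

interpretation sphere_lborel: pair_sigma_finite sphere_measure "lborel :: 'a::euclidean_space measure" ..

text \<open>Polar coordinates are used twice: in the horizontal plane, and then in the half plane of
  the height \<open>z\<close> and the distance from the axis. The factors \<open>r\<close> and
  \<open>r * sin \<phi>\<close> give the volume element.\<close>

lemma nn_integral_spherical:
  fixes F :: "vec3 \<Rightarrow> ennreal"
  assumes [measurable]: "F \<in> borel_measurable borel"
  shows "(\<integral>\<^sup>+x. F x \<partial>lborel) =
    (\<integral>\<^sup>+\<omega>. \<integral>\<^sup>+r. ennreal (r\<^sup>2) * indicator {0<..} r * F (r *\<^sub>R \<omega>) \<partial>lborel \<partial>sphere_measure)"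
proof -
  have "(\<integral>\<^sup>+x. F x \<partial>lborel) = (\<integral>\<^sup>+x. \<integral>\<^sup>+y. \<integral>\<^sup>+z. F (vector [x, y, z]) \<partial>lborel \<partial>lborel \<partial>lborel)"
    by (rule nn_integral_vec3) measurable
  also have "\<dots> = (\<integral>\<^sup>+\<psi>. \<integral>\<^sup>+\<rho>. ennreal \<rho> * (\<integral>\<^sup>+z. F (vector [\<rho> * cos \<psi>, \<rho> * sin \<psi>, z]) \<partial>lborel) *
      indicator {0<..} \<rho> * indicator {0<..<2*pi} \<psi> \<partial>lborel \<partial>lborel)"
    by (rule nn_integral_polar) measurable
  also have "\<dots> = (\<integral>\<^sup>+\<psi>. \<integral>\<^sup>+\<rho>. \<integral>\<^sup>+z. (ennreal \<rho> * F (vector [\<rho> * cos \<psi>, \<rho> * sin \<psi>, z]) *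
      indicator {0<..<2*pi} \<psi>) * indicator {0<..} \<rho> \<partial>lborel \<partial>lborel \<partial>lborel)"
    by (simp add: nn_integral_cmult[symmetric] nn_integral_multc[symmetric] mult_ac)
  also have "\<dots> = (\<integral>\<^sup>+\<psi>. \<integral>\<^sup>+\<phi>. \<integral>\<^sup>+r. ennreal r * (ennreal (r * sin \<phi>) * F (vector [r * sin \<phi> * cos \<psi>, r * sin \<phi> * sin \<psi>, r * cos \<phi>]) *
      indicator {0<..<2*pi} \<psi>) * indicator {0<..} r * indicator {0<..<pi} \<phi> \<partial>lborel \<partial>lborel \<partial>lborel)"
    by (rule nn_integral_cong, rule nn_integral_polar_half_plane) measurable
  also have "\<dots> = (\<integral>\<^sup>+\<phi>. \<integral>\<^sup>+\<psi>. \<integral>\<^sup>+r. ennreal r * (ennreal (r * sin \<phi>) * F (vector [r * sin \<phi> * cos \<psi>, r * sin \<phi> * sin \<psi>, r * cos \<phi>]) *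
      indicator {0<..<2*pi} \<psi>) * indicator {0<..} r * indicator {0<..<pi} \<phi> \<partial>lborel \<partial>lborel \<partial>lborel)"
    by (rule lborel_pair.Fubini') measurable
  also have "\<dots> = (\<integral>\<^sup>+\<phi>. \<integral>\<^sup>+\<psi>. \<integral>\<^sup>+r. ennreal (sin \<phi>) * indicator {0<..<pi} \<phi> * indicator {0<..<2 * pi} \<psi> *
      (ennreal (r\<^sup>2) * indicator {0<..} r * F (r *\<^sub>R sphere_pt \<phi> \<psi>)) \<partial>lborel \<partial>lborel \<partial>lborel)"
  proof (rule nn_integral_cong, rule nn_integral_cong, rule nn_integral_cong)
    fix \<phi> \<psi> r :: real
    have 1: "r *\<^sub>R sphere_pt \<phi> \<psi> = vector [r * sin \<phi> * cos \<psi>, r * sin \<phi> * sin \<psi>, r * cos \<phi>]"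
      by (simp add: sphere_pt_def vec_eq_iff forall_3)
    have 2: "ennreal r * ennreal (r * sin \<phi>) = ennreal (sin \<phi>) * ennreal (r\<^sup>2)" if "r > 0" "0 < \<phi>" "\<phi> < pi"
      using sin_gt_zero[OF that(2,3)] that(1) by (simp add: ennreal_mult[symmetric] power2_eq_square mult_ac)
    show "ennreal r * (ennreal (r * sin \<phi>) * F (vector [r * sin \<phi> * cos \<psi>, r * sin \<phi> * sin \<psi>, r * cos \<phi>]) *
      indicator {0<..<2*pi} \<psi>) * indicator {0<..} r * indicator {0<..<pi} \<phi> =
      ennreal (sin \<phi>) * indicator {0<..<pi} \<phi> * indicator {0<..<2 * pi} \<psi> *
      (ennreal (r\<^sup>2) * indicator {0<..} r * F (r *\<^sub>R sphere_pt \<phi> \<psi>))"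
      unfolding 1 using 2 by (simp add: indicator_def mult.assoc[symmetric])
  qed
  also have "\<dots> = (\<integral>\<^sup>+\<omega>. \<integral>\<^sup>+r. ennreal (r\<^sup>2) * indicator {0<..} r * F (r *\<^sub>R \<omega>) \<partial>lborel \<partial>sphere_measure)"
    by (subst nn_integral_sphere_measure) (simp_all add: nn_integral_cmult)
  finally show ?thesis .
qed

lemma nn_integral_power2_interval:
  assumes "a \<ge> 0"
  shows "(\<integral>\<^sup>+r. ennreal (r\<^sup>2) * indicator {0<..} r * indicator {..<a} r \<partial>lborel) = ennreal (a^3 / 3)"
proof -
  have "(\<integral>\<^sup>+r. ennreal (r\<^sup>2) * indicator {0<..} r * indicator {..<a} r \<partial>lborel) =
    (\<integral>\<^sup>+r. ennreal (r\<^sup>2) * indicator {0..a} r \<partial>lborel)"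
    by (intro nn_integral_cong_AE AE_I[of _ _ "{0, a}"]) (auto simp: indicator_def emeasure_lborel_countable split: if_splits)
  also have "\<dots> = ennreal (a^3 / 3 - 0^3 / 3)"
    using assms by (intro nn_integral_FTC_Icc[where F = "\<lambda>x. x^3/3"]) (auto intro!: derivative_eq_intros simp: power2_eq_square)
  finally show ?thesis by simp
qed

text \<open>Integrals over the sphere are integrals over the ball of functions of \<open>x / norm x\<close>, so that
  linear substitutions of the sphere reduce to those of the space.\<close>
lemma nn_integral_sphere_ball:
  fixes F :: "vec3 \<Rightarrow> ennreal"
  assumes [measurable]: "F \<in> borel_measurable borel"
  shows "(\<integral>\<^sup>+\<omega>. F \<omega> \<partial>sphere_measure) = 3 * (\<integral>\<^sup>+x. F (x /\<^sub>R norm x) * indicator {..<1} (norm x) \<partial>lborel)"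
proof -
  have "(\<integral>\<^sup>+x. F (x /\<^sub>R norm x) * indicator {..<1} (norm x) \<partial>lborel) =
    (\<integral>\<^sup>+\<omega>. \<integral>\<^sup>+r. ennreal (r\<^sup>2) * indicator {0<..} r * (F ((r *\<^sub>R \<omega>) /\<^sub>R norm (r *\<^sub>R \<omega>)) * indicator {..<1} (norm (r *\<^sub>R \<omega>))) \<partial>lborel \<partial>sphere_measure)"
    by (rule nn_integral_spherical) measurable
  also have "\<dots> = (\<integral>\<^sup>+\<omega>. \<integral>\<^sup>+r. F \<omega> * (ennreal (r\<^sup>2) * indicator {0<..} r * indicator {..<1} r) \<partial>lborel \<partial>sphere_measure)"
    by (rule nn_integral_sphere_cong, rule nn_integral_cong) (simp add: indicator_def mult.commute)
  also have "\<dots> = (\<integral>\<^sup>+\<omega>. F \<omega> * ennreal (1/3) \<partial>sphere_measure)"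
    by (simp add: nn_integral_cmult nn_integral_power2_interval)
  also have "\<dots> = (\<integral>\<^sup>+\<omega>. F \<omega> \<partial>sphere_measure) * ennreal (1/3)"
    by (simp add: nn_integral_multc)
  finally have "3 * (\<integral>\<^sup>+x. F (x /\<^sub>R norm x) * indicator {..<1} (norm x) \<partial>lborel) = (\<integral>\<^sup>+\<omega>. F \<omega> \<partial>sphere_measure) * (ennreal 3 * ennreal (1/3))"
    by (simp add: mult_ac)
  also have "ennreal 3 * ennreal (1/3) = 1" by (subst ennreal_mult[symmetric]) auto
  finally show ?thesis by simp
qed

text \<open>After a linear substitution in the ball, the ray through \<omega> leaves the preimage of
  the ball at the radius \<open>1 / norm (f \<omega>)\<close>. The radial integral thus produces the
  third power in the Jacobian of the induced map of the sphere.\<close>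

lemma nn_integral_sphere_linear:
  fixes F :: "vec3 \<Rightarrow> ennreal" and f g :: "vec3 \<Rightarrow> vec3"
  assumes "linear f" "linear g" and fg: "\<And>x. f (g x) = x" "\<And>x. g (f x) = x"
    and [measurable]: "F \<in> borel_measurable borel"
  shows "(\<integral>\<^sup>+\<omega>. F \<omega> \<partial>sphere_measure) =
    ennreal \<bar>det (matrix f)\<bar> * (\<integral>\<^sup>+\<omega>. ennreal (1 / norm (f \<omega>) ^ 3) * F (f \<omega> /\<^sub>R norm (f \<omega>)) \<partial>sphere_measure)"
proof -
  interpret f: linear f by fact
  have [measurable]: "f \<in> borel_measurable borel"
    using \<open>linear f\<close> by (simp add: borel_measurable_continuous_onI linear_continuous_on linear_linear)
  have "(\<integral>\<^sup>+x. F (x /\<^sub>R norm x) * indicator {..<1} (norm x) \<partial>lborel) =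
    ennreal \<bar>det (matrix f)\<bar> * (\<integral>\<^sup>+x. F (f x /\<^sub>R norm (f x)) * indicator {..<1} (norm (f x)) \<partial>lborel)"
    by (rule nn_integral_linear_image[OF assms(1-4)]) measurable
  also have "(\<integral>\<^sup>+x. F (f x /\<^sub>R norm (f x)) * indicator {..<1} (norm (f x)) \<partial>lborel) =
    (\<integral>\<^sup>+\<omega>. \<integral>\<^sup>+r. ennreal (r\<^sup>2) * indicator {0<..} r * (F (f (r *\<^sub>R \<omega>) /\<^sub>R norm (f (r *\<^sub>R \<omega>))) * indicator {..<1} (norm (f (r *\<^sub>R \<omega>)))) \<partial>lborel \<partial>sphere_measure)"
    by (rule nn_integral_spherical) measurable
  also have "\<dots> = (\<integral>\<^sup>+\<omega>. \<integral>\<^sup>+r. F (f \<omega> /\<^sub>R norm (f \<omega>)) * (ennreal (r\<^sup>2) * indicator {0<..} r * indicator {..<1 / norm (f \<omega>)} r) \<partial>lborel \<partial>sphere_measure)"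
  proof (rule nn_integral_sphere_cong, rule nn_integral_cong)
    fix \<omega> :: vec3 and r :: real
    assume "norm \<omega> = 1"
    then have "f \<omega> \<noteq> 0" using fg(2)[of \<omega>] fg(2)[of 0] f.zero by auto
    then show "ennreal (r\<^sup>2) * indicator {0<..} r * (F (f (r *\<^sub>R \<omega>) /\<^sub>R norm (f (r *\<^sub>R \<omega>))) * indicator {..<1} (norm (f (r *\<^sub>R \<omega>)))) =
      F (f \<omega> /\<^sub>R norm (f \<omega>)) * (ennreal (r\<^sup>2) * indicator {0<..} r * indicator {..<1 / norm (f \<omega>)} r)"
      by (cases "r > 0") (auto simp: f.scaleR indicator_def field_simps)
  qed
  also have "\<dots> = (\<integral>\<^sup>+\<omega>. F (f \<omega> /\<^sub>R norm (f \<omega>)) * ennreal ((1 / norm (f \<omega>)) ^ 3 / 3) \<partial>sphere_measure)"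
    by (simp add: nn_integral_cmult nn_integral_power2_interval)
  also have "3 * (ennreal \<bar>det (matrix f)\<bar> * \<dots>) = ennreal \<bar>det (matrix f)\<bar> * (\<integral>\<^sup>+\<omega>. 3 * (F (f \<omega> /\<^sub>R norm (f \<omega>)) * ennreal ((1 / norm (f \<omega>)) ^ 3 / 3)) \<partial>sphere_measure)"
    by (simp add: nn_integral_cmult mult_ac)
  also have "(\<integral>\<^sup>+\<omega>. 3 * (F (f \<omega> /\<^sub>R norm (f \<omega>)) * ennreal ((1 / norm (f \<omega>)) ^ 3 / 3)) \<partial>sphere_measure) =
     (\<integral>\<^sup>+\<omega>. ennreal (1 / norm (f \<omega>) ^ 3) * F (f \<omega> /\<^sub>R norm (f \<omega>)) \<partial>sphere_measure)"
  proof (rule nn_integral_cong)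
    fix \<omega> :: vec3
    have "ennreal 3 * ennreal ((1 / norm (f \<omega>)) ^ 3 / 3) = ennreal (1 / norm (f \<omega>) ^ 3)"
      by (subst ennreal_mult[symmetric]) (auto simp: power_one_over)
    then have e: "3 * ennreal ((1 / norm (f \<omega>)) ^ 3 / 3) = ennreal (1 / norm (f \<omega>) ^ 3)" by simp
    have "3 * (F (f \<omega> /\<^sub>R norm (f \<omega>)) * ennreal ((1 / norm (f \<omega>)) ^ 3 / 3)) =
      3 * ennreal ((1 / norm (f \<omega>)) ^ 3 / 3) * F (f \<omega> /\<^sub>R norm (f \<omega>))" by (simp only: mult_ac)
    then show "3 * (F (f \<omega> /\<^sub>R norm (f \<omega>)) * ennreal ((1 / norm (f \<omega>)) ^ 3 / 3)) = ennreal (1 / norm (f \<omega>) ^ 3) * F (f \<omega> /\<^sub>R norm (f \<omega>))"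
      unfolding e .
  qed
  finally show ?thesis by (subst nn_integral_sphere_ball) auto
qed

lemma nn_integral_sphere_orthogonal:
  fixes F :: "vec3 \<Rightarrow> ennreal"
  assumes f: "orthogonal_transformation f" and [measurable]: "F \<in> borel_measurable borel"
  shows "(\<integral>\<^sup>+\<omega>. F (f \<omega>) \<partial>sphere_measure) = (\<integral>\<^sup>+\<omega>. F \<omega> \<partial>sphere_measure)"
proof -
  have "linear f" using f by (simp add: orthogonal_transformation_linear)
  then have [measurable]: "f \<in> borel_measurable borel"
    by (simp add: borel_measurable_continuous_onI linear_continuous_on linear_linear)
  interpret f: linear f by fact
  have "(\<integral>\<^sup>+\<omega>. F (f \<omega>) \<partial>sphere_measure) = 3 * (\<integral>\<^sup>+x. F (f x /\<^sub>R norm (f x)) * indicator {..<1} (norm (f x)) \<partial>lborel)"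
    using f by (subst nn_integral_sphere_ball) (auto simp: f.scaleR orthogonal_transformation_norm)
  also have "\<dots> = 3 * (\<integral>\<^sup>+x. F (x /\<^sub>R norm x) * indicator {..<1} (norm x) \<partial>lborel)"
    by (subst nn_integral_orthogonal[OF f, of "\<lambda>x. F (x /\<^sub>R norm x) * indicator {..<1} (norm x)"]) auto
  finally show ?thesis by (subst (2) nn_integral_sphere_ball) auto
qed

section \<open>The sphere parametrised by reflections of a point\<close>

lemma measurable_vec_nth[measurable (raw)]:
  fixes f :: "'a \<Rightarrow> real^'n"
  assumes "f \<in> borel_measurable M"
  shows "(\<lambda>x. f x $ i) \<in> borel_measurable M"
proof -
  have "(\<lambda>x :: real^'n. x $ i) \<in> borel_measurable borel"
    by (intro borel_measurable_continuous_onI continuous_intros)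
  then show ?thesis by (rule measurable_compose[OF assms])
qed

lemma orthogonal_transformation_minus: "orthogonal_transformation (uminus :: vec3 \<Rightarrow> vec3)"
  by (simp add: orthogonal_transformation linear_uminus)

text \<open>The reflection in the plane orthogonal to \<open>m\<close> sends the pole to \<omega>,
  and \<open>m\<close> and \<open>- m\<close> give the same \<omega>. On the hemisphere
  \<open>m $ 3 < 0\<close> the azimuths of \<open>m\<close> and \<omega> agree, and the polar angle
  \<open>x\<close> of \<omega> belongs to the angle \<open>pi/2 + x/2\<close> of \<open>m\<close>.
  The factors 1/2, \<open>cos (x/2)\<close> and \<open>2 * sin (x/2)\<close> multiply to half of
  \<open>sin x\<close>, so each hemisphere contributes one half.\<close>

lemma nn_integral_sphere_reflection_axis:
  fixes F :: "vec3 \<Rightarrow> ennreal"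
  assumes [measurable]: "F \<in> borel_measurable borel"
  shows "(\<integral>\<^sup>+\<omega>. F \<omega> \<partial>sphere_measure) =
    (\<integral>\<^sup>+m. ennreal (2 * \<bar>m $ 3\<bar>) * F (axis 3 1 - (2 * m $ 3) *\<^sub>R m) \<partial>sphere_measure)"
proof -
  define G where "G m = ennreal (2 * \<bar>m $ 3\<bar>) * F (axis 3 1 - (2 * m $ 3) *\<^sub>R m)" for m :: vec3
  have [measurable]: "G \<in> borel_measurable borel" unfolding G_def by measurable
  have half: "(\<integral>\<^sup>+m. G m * indicator {0<..} (m $ 3) \<partial>sphere_measure) = (\<integral>\<^sup>+m. G m * indicator {..<0} (m $ 3) \<partial>sphere_measure)"
    by (subst nn_integral_sphere_orthogonal[OF orthogonal_transformation_minus, symmetric])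
      (auto simp: G_def indicator_def intro!: nn_integral_cong)
  have "(\<integral>\<^sup>+m. G m * indicator {..<0} (m $ 3) \<partial>sphere_measure) =
    (\<integral>\<^sup>+\<phi>. \<integral>\<^sup>+\<psi>. ennreal (sin \<phi>) * indicator {0<..<pi} \<phi> * indicator {0<..<2 * pi} \<psi> *
      (G (sphere_pt \<phi> \<psi>) * indicator {..<0} (sphere_pt \<phi> \<psi> $ 3)) \<partial>lborel \<partial>lborel)"
    by (rule nn_integral_sphere_measure) measurable
  also have "\<dots> = ennreal (1/2) * (\<integral>\<^sup>+x. \<integral>\<^sup>+\<psi>. ennreal (sin (pi/2 + 1/2 * x)) * indicator {0<..<pi} (pi/2 + 1/2 * x) * indicator {0<..<2 * pi} \<psi> *
      (G (sphere_pt (pi/2 + 1/2 * x) \<psi>) * indicator {..<0} (sphere_pt (pi/2 + 1/2 * x) \<psi> $ 3)) \<partial>lborel \<partial>lborel)"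
  proof -
    define K where "K x = (\<integral>\<^sup>+\<psi>. ennreal (sin x) * indicator {0<..<pi} x * indicator {0<..<2 * pi} \<psi> *
      (G (sphere_pt x \<psi>) * indicator {..<0} (sphere_pt x \<psi> $ 3)) \<partial>lborel)" for x
    have [measurable]: "K \<in> borel_measurable borel" unfolding K_def by measurable
    show ?thesis
      unfolding K_def[symmetric] using nn_integral_real_affine[of K "1/2" "pi/2"] by simp
  qed
  also have "(\<integral>\<^sup>+x. \<integral>\<^sup>+\<psi>. ennreal (sin (pi/2 + 1/2 * x)) * indicator {0<..<pi} (pi/2 + 1/2 * x) * indicator {0<..<2 * pi} \<psi> *
      (G (sphere_pt (pi/2 + 1/2 * x) \<psi>) * indicator {..<0} (sphere_pt (pi/2 + 1/2 * x) \<psi> $ 3)) \<partial>lborel \<partial>lborel) =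
    (\<integral>\<^sup>+x. \<integral>\<^sup>+\<psi>. ennreal (sin x) * indicator {0<..<pi} x * indicator {0<..<2 * pi} \<psi> * F (sphere_pt x \<psi>) \<partial>lborel \<partial>lborel)"
  proof (rule nn_integral_cong, rule nn_integral_cong)
    fix x \<psi> :: real
    let ?p = "sphere_pt (pi/2 + 1/2 * x) \<psi>"
    have c: "cos (pi/2 + x/2) = - sin (x/2)"
      by (subst cos_add) simp
    have s: "sin (pi/2 + x/2) = cos (x/2)"
      by (subst sin_add) simp
    have sx: "sin x = 2 * sin (x/2) * cos (x/2)" and cx: "cos x = 1 - 2 * (sin (x/2))\<^sup>2"
      using sin_double[of "x/2"] cos_double_sin[of "x/2"] by simp_all
    have p3: "?p $ 3 = - sin (x/2)" by (simp add: sphere_pt_def c)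
    have refl: "axis 3 1 - (2 * ?p $ 3) *\<^sub>R ?p = sphere_pt x \<psi>"
      unfolding p3
      by (simp add: sphere_pt_def vec_eq_iff forall_3 axis_def c s sx cx power2_eq_square del: sin_cos_eq cos_sin_eq)
    have refl': "axis 3 1 + (2 * sin (x/2)) *\<^sub>R sphere_pt (pi/2 + x/2) \<psi> = sphere_pt x \<psi>"
      using refl p3 by simp
    have *: "0 < pi/2 + 1/2 * x \<and> pi/2 + 1/2 * x < pi \<and> - sin (x/2) < 0 \<longleftrightarrow> 0 < x \<and> x < pi"
    proof
      assume a: "0 < pi/2 + 1/2 * x \<and> pi/2 + 1/2 * x < pi \<and> - sin (x/2) < 0"
      have "0 < x"
      proof (rule ccontr)
        assume "\<not> 0 < x"
        then have "sin (- (x/2)) \<ge> 0" using a by (intro sin_ge_zero) auto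
        then show False using a by simp
      qed
      then show "0 < x \<and> x < pi" using a by auto
    qed (auto intro!: sin_gt_zero)
    show "ennreal (sin (pi/2 + 1/2 * x)) * indicator {0<..<pi} (pi/2 + 1/2 * x) * indicator {0<..<2 * pi} \<psi> *
      (G ?p * indicator {..<0} (?p $ 3)) =
      ennreal (sin x) * indicator {0<..<pi} x * indicator {0<..<2 * pi} \<psi> * F (sphere_pt x \<psi>)"
    proof (cases "0 < x \<and> x < pi")
      case True
      then have pos: "sin (x/2) > 0" "cos (x/2) > 0" by (auto intro!: sin_gt_zero cos_gt_zero)
      have "ennreal (cos (x/2)) * ennreal (2 * \<bar>- sin (x/2)\<bar>) = ennreal (sin x)"
        using pos by (simp add: ennreal_mult[symmetric] sx mult_ac)
      then show ?thesis
        using True pos unfolding G_def refl p3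
        by (simp add: indicator_def s refl' mult.assoc[symmetric])
    next
      case False
      then show ?thesis using * p3 by (auto simp: indicator_def)
    qed
  qed
  also have "\<dots> = (\<integral>\<^sup>+\<omega>. F \<omega> \<partial>sphere_measure)"
    by (rule nn_integral_sphere_measure[symmetric]) measurable
  finally have *: "(\<integral>\<^sup>+m. G m * indicator {..<0} (m $ 3) \<partial>sphere_measure) = ennreal (1/2) * (\<integral>\<^sup>+\<omega>. F \<omega> \<partial>sphere_measure)" .
  have "(\<integral>\<^sup>+m. G m \<partial>sphere_measure) = (\<integral>\<^sup>+m. G m * indicator {0<..} (m $ 3) + G m * indicator {..<0} (m $ 3) \<partial>sphere_measure)"
    by (rule nn_integral_cong) (auto simp: indicator_def G_def not_less)
  also have "\<dots> = (\<integral>\<^sup>+m. G m * indicator {0<..} (m $ 3) \<partial>sphere_measure) + (\<integral>\<^sup>+m. G m * indicator {..<0} (m $ 3) \<partial>sphere_measure)"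
    by (rule nn_integral_add) measurable
  also have "\<dots> = (ennreal (1/2) + ennreal (1/2)) * (\<integral>\<^sup>+\<omega>. F \<omega> \<partial>sphere_measure)"
    unfolding half * by (simp add: distrib_right)
  also have "ennreal (1/2) + ennreal (1/2) = 1"
    by (subst ennreal_plus[symmetric]) auto
  finally show ?thesis by (simp add: G_def)
qed

lemma nn_integral_sphere_reflection:
  fixes F :: "vec3 \<Rightarrow> ennreal"
  assumes [measurable]: "F \<in> borel_measurable borel" and n: "norm n = 1"
  shows "(\<integral>\<^sup>+\<omega>. F \<omega> \<partial>sphere_measure) =
    (\<integral>\<^sup>+m. ennreal (2 * \<bar>n \<bullet> m\<bar>) * F (n - (2 * (n \<bullet> m)) *\<^sub>R m) \<partial>sphere_measure)"
proof -
  obtain R :: "vec3 \<Rightarrow> vec3" where R: "orthogonal_transformation R" and Rn: "R (axis 3 1) = n"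
    using orthogonal_transformation_exists_1[of "axis 3 1 :: vec3" n] n by auto
  interpret R: linear R using R by (rule orthogonal_transformation_linear)
  have [measurable]: "R \<in> borel_measurable borel"
    by (simp add: borel_measurable_continuous_onI linear_continuous_on linear_linear R.linear_axioms)
  have nm: "m $ 3 = n \<bullet> R m" for m
  proof -
    have "n \<bullet> R m = axis 3 1 \<bullet> m" using R unfolding Rn[symmetric] orthogonal_transformation_def by blast
    then show ?thesis by (simp add: inner_axis')
  qed
  have "(\<integral>\<^sup>+\<omega>. F \<omega> \<partial>sphere_measure) = (\<integral>\<^sup>+\<omega>. F (R \<omega>) \<partial>sphere_measure)"
    by (rule nn_integral_sphere_orthogonal[OF R, symmetric]) measurable
  also have "\<dots> = (\<integral>\<^sup>+m. ennreal (2 * \<bar>m $ 3\<bar>) * F (R (axis 3 1 - (2 * m $ 3) *\<^sub>R m)) \<partial>sphere_measure)"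
    by (rule nn_integral_sphere_reflection_axis) measurable
  also have "\<dots> = (\<integral>\<^sup>+m. ennreal (2 * \<bar>n \<bullet> R m\<bar>) * F (n - (2 * (n \<bullet> R m)) *\<^sub>R R m) \<partial>sphere_measure)"
    unfolding nm by (simp add: R.diff R.scaleR Rn)
  also have "\<dots> = (\<integral>\<^sup>+m. ennreal (2 * \<bar>n \<bullet> m\<bar>) * F (n - (2 * (n \<bullet> m)) *\<^sub>R m) \<partial>sphere_measure)"
    by (rule nn_integral_sphere_orthogonal[OF R, of "\<lambda>m. ennreal (2 * \<bar>n \<bullet> m\<bar>) * F (n - (2 * (n \<bullet> m)) *\<^sub>R m)"]) measurable
  finally show ?thesis .
qed

section \<open>Dilations along a vector\<close>

definition dilation :: "vec3 \<Rightarrow> real \<Rightarrow> vec3 \<Rightarrow> vec3" where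
  "dilation P c x = x + ((c - 1) * (P \<bullet> x) / (norm P)\<^sup>2) *\<^sub>R P"

lemma linear_dilation: "linear (dilation P c)"
proof -
  define d where "d = (c - 1) / (norm P)\<^sup>2"
  have "dilation P c = (\<lambda>x. x + (d * (P \<bullet> x)) *\<^sub>R P)"
    by (rule ext) (simp add: dilation_def d_def)
  then show ?thesis
    by (auto intro!: linearI simp: inner_add_right algebra_simps)
qed

text \<open>For fixed \<open>P\<close> the dilations form a one-parameter group, so
  \<open>dilation P (1 / c)\<close> inverts \<open>dilation P c\<close>.\<close>

lemma dilation_dilation: "dilation P c (dilation P d x) = dilation P (c * d) x"
proof (cases "P = 0")
  case False
  then have "P \<bullet> dilation P d x = d * (P \<bullet> x)"
    by (simp add: dilation_def inner_add_right dot_square_norm field_simps)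
  then have "dilation P c (dilation P d x) = x + ((d - 1) * (P \<bullet> x) / (norm P)\<^sup>2 + (c - 1) * (d * (P \<bullet> x)) / (norm P)\<^sup>2) *\<^sub>R P"
    by (simp add: dilation_def scaleR_add_left)
  also have "(d - 1) * (P \<bullet> x) / (norm P)\<^sup>2 + (c - 1) * (d * (P \<bullet> x)) / (norm P)\<^sup>2 = (c * d - 1) * (P \<bullet> x) / (norm P)\<^sup>2"
    by (simp add: add_divide_distrib[symmetric] algebra_simps)
  finally show ?thesis by (simp add: dilation_def)
qed (simp add: dilation_def)

lemma dilation_1[simp]: "dilation P 1 x = x"
  by (simp add: dilation_def)

text \<open>Dilations are self-adjoint, so both factors merge into one. This allows norms and inner
  products of dilated vectors to be expressed through the squared factor alone.\<close>

lemma inner_dilation: "dilation P c x \<bullet> dilation P c y = x \<bullet> dilation P (c\<^sup>2) y"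
proof -
  have "dilation P c x \<bullet> z = x \<bullet> dilation P c z" for z
    by (simp add: dilation_def inner_add_left inner_add_right inner_commute)
  then show ?thesis by (simp add: dilation_dilation power2_eq_square)
qed

text \<open>A rank-one perturbation of the identity has as determinant one plus the trace of the
  perturbation, here \<open>1 + (c - 1)\<close>.\<close>

lemma det_dilation:
  assumes "P \<noteq> 0"
  shows "det (matrix (dilation P c)) = c"
proof -
  have n: "(norm P)\<^sup>2 = P$1^2 + P$2^2 + P$3^2"
    unfolding power2_norm_eq_inner inner_vec_def sum_3 by (simp add: power2_eq_square)
  define a where "a = (c - 1) / (norm P)\<^sup>2"
  have "a * (norm P)\<^sup>2 = c - 1" using assms by (simp add: a_def)
  then have c: "a * (P$1^2 + P$2^2 + P$3^2) = c - 1" by (simp add: n)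
  have d: "dilation P c (axis j 1) $ i = (if i = j then 1 else 0) + a * P $ j * P $ i" for i j
  proof -
    have "axis j 1 $ i = (if i = j then 1 else (0::real))" by (simp add: axis_def)
    then show ?thesis by (simp add: dilation_def inner_axis a_def)
  qed
  have "det (matrix (dilation P c)) = 1 + a * (P$1^2 + P$2^2 + P$3^2)"
    unfolding det_3 matrix_def vec_lambda_beta d by (simp add: algebra_simps power2_eq_square)
  then show ?thesis using c by simp
qed

text \<open>The sphere is parametrised by the chords issuing from the point \<open>n\<close>, and these are
  afterwards stretched by the dilation.\<close>
lemma nn_integral_sphere_chords:
  fixes F :: "vec3 \<Rightarrow> ennreal"
  assumes [measurable]: "F \<in> borel_measurable borel" and n: "norm n = 1" and c: "c > 0" "P = 0 \<Longrightarrow> c = 1"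
  defines "B \<equiv> dilation P (1/c)"
  shows "(\<integral>\<^sup>+\<omega>. F (dilation P c \<omega>) \<partial>sphere_measure) =
    (\<integral>\<^sup>+k. ennreal (2 * \<bar>n \<bullet> B k\<bar> / (c * norm (B k) ^ 4)) *
      F (dilation P c n - (2 * (n \<bullet> B k) / (norm (B k))\<^sup>2) *\<^sub>R k) \<partial>sphere_measure)"
proof -
  let ?A = "dilation P c"
  have AB: "?A (B x) = x" "B (?A x) = x" for x
    using c by (simp_all add: B_def dilation_dilation)
  have lA: "linear ?A" and lB: "linear B" by (simp_all add: B_def linear_dilation)
  interpret A: linear ?A by fact
  have [measurable]: "?A \<in> borel_measurable borel" "B \<in> borel_measurable borel"
    using lA lB by (auto simp: borel_measurable_continuous_onI linear_continuous_on linear_linear)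
  have detB: "\<bar>det (matrix B)\<bar> = 1 / c"
  proof (cases "P = 0")
    case True
    then have "B = id" by (auto simp: B_def dilation_def)
    then show ?thesis using True c by (simp add: matrix_id_mat_1)
  qed (use c in \<open>simp add: B_def det_dilation\<close>)
  have "(\<integral>\<^sup>+\<omega>. F (?A \<omega>) \<partial>sphere_measure) =
    (\<integral>\<^sup>+m. ennreal (2 * \<bar>n \<bullet> m\<bar>) * F (?A (n - (2 * (n \<bullet> m)) *\<^sub>R m)) \<partial>sphere_measure)"
    by (rule nn_integral_sphere_reflection[OF _ n]) measurable
  \<comment> \<open>The normal \<open>m\<close> of the reflection is replaced by the normalised
    \<open>B k\<close>, so that \<open>dilation P c\<close> turns the chord along \<open>m\<close>
    into one along \<open>k\<close>.\<close>
  also have "\<dots> = ennreal \<bar>det (matrix B)\<bar> * (\<integral>\<^sup>+k. ennreal (1 / norm (B k) ^ 3) *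
      (ennreal (2 * \<bar>n \<bullet> (B k /\<^sub>R norm (B k))\<bar>) *
       F (?A (n - (2 * (n \<bullet> (B k /\<^sub>R norm (B k)))) *\<^sub>R (B k /\<^sub>R norm (B k))))) \<partial>sphere_measure)"
    by (rule nn_integral_sphere_linear[OF lB lA AB(2) AB(1)]) measurable
  also have "\<dots> = (\<integral>\<^sup>+k. ennreal (1/c) * (ennreal (1 / norm (B k) ^ 3) *
      (ennreal (2 * \<bar>n \<bullet> (B k /\<^sub>R norm (B k))\<bar>) *
       F (?A (n - (2 * (n \<bullet> (B k /\<^sub>R norm (B k)))) *\<^sub>R (B k /\<^sub>R norm (B k)))))) \<partial>sphere_measure)"
    unfolding detB by (rule nn_integral_cmult[symmetric]) measurable
  also have "\<dots> = (\<integral>\<^sup>+k. ennreal (2 * \<bar>n \<bullet> B k\<bar> / (c * norm (B k) ^ 4)) *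
      F (?A n - (2 * (n \<bullet> B k) / (norm (B k))\<^sup>2) *\<^sub>R k) \<partial>sphere_measure)"
  proof (rule nn_integral_cong)
    fix k :: vec3
    have 1: "?A (n - (2 * (n \<bullet> (B k /\<^sub>R norm (B k)))) *\<^sub>R (B k /\<^sub>R norm (B k))) = ?A n - (2 * (n \<bullet> B k) / (norm (B k))\<^sup>2) *\<^sub>R k"
      by (simp add: A.diff A.scaleR AB power2_eq_square divide_inverse mult_ac)
    have 2: "ennreal (1/c) * (ennreal (1 / norm (B k) ^ 3) * (ennreal (2 * \<bar>n \<bullet> (B k /\<^sub>R norm (B k))\<bar>) * X)) =
      ennreal (2 * \<bar>n \<bullet> B k\<bar> / (c * norm (B k) ^ 4)) * X" for X
    proof -
      have "ennreal (1/c) * (ennreal (1 / norm (B k) ^ 3) * ennreal (2 * \<bar>n \<bullet> (B k /\<^sub>R norm (B k))\<bar>)) =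
        ennreal (1/c * (1 / norm (B k) ^ 3 * (2 * \<bar>n \<bullet> (B k /\<^sub>R norm (B k))\<bar>)))"
      proof -
        have "ennreal a * (ennreal b * ennreal d) = ennreal (a * (b * d))" if "0 \<le> a" "0 \<le> b" "0 \<le> d" for a b d :: real
          using that by (simp add: ennreal_mult)
        then show ?thesis using c by simp
      qed
      also have "1/c * (1 / norm (B k) ^ 3 * (2 * \<bar>n \<bullet> (B k /\<^sub>R norm (B k))\<bar>)) = 2 * \<bar>n \<bullet> B k\<bar> / (c * norm (B k) ^ 4)"
        by (simp add: abs_mult divide_inverse power_numeral_reduce mult_ac)
      finally show ?thesis by (simp only: mult.assoc[symmetric])
    qed
    show "ennreal (1/c) * (ennreal (1 / norm (B k) ^ 3) *
      (ennreal (2 * \<bar>n \<bullet> (B k /\<^sub>R norm (B k))\<bar>) *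
       F (?A (n - (2 * (n \<bullet> (B k /\<^sub>R norm (B k)))) *\<^sub>R (B k /\<^sub>R norm (B k)))))) =
      ennreal (2 * \<bar>n \<bullet> B k\<bar> / (c * norm (B k) ^ 4)) *
      F (?A n - (2 * (n \<bullet> B k) / (norm (B k))\<^sup>2) *\<^sub>R k)"
      unfolding 1 2 ..
  qed
  finally show ?thesis .
qed

section \<open>Collisions on a line\<close>

text \<open>\<open>en A x\<close> is the energy of a particle with momentum \<open>x\<close> along a given line, where \<open>A\<close> is one plus the
  square of the transverse momentum.\<close>
definition en :: "real \<Rightarrow> real \<Rightarrow> real" where
  "en A x = sqrt (A + x\<^sup>2)"

text \<open>The root, besides \<open>t = 0\<close>, of
  \<open>en A (x + t) + en B (y - t) = en A x + en B y\<close>, whose left side is strictly convex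
  in \<open>t\<close>. Divided by both energies, \<open>x * en B y - y * en A x\<close> is the
  relative velocity on the line; the denominator is the Minkowski square of the total energy and
  momentum.\<close>

definition line_shift :: "real \<Rightarrow> real \<Rightarrow> real \<Rightarrow> real \<Rightarrow> real" where
  "line_shift A B x y = - 2 * (en A x + en B y) * (x * en B y - y * en A x) / ((en A x + en B y)\<^sup>2 - (x + y)\<^sup>2)"

lemma measurable_en[measurable (raw)]:
  assumes [measurable]: "f \<in> borel_measurable M" "g \<in> borel_measurable M"
  shows "(\<lambda>x. en (f x) (g x)) \<in> borel_measurable M"
  unfolding en_def by measurable

lemma measurable_line_shift[measurable (raw)]:
  assumes [measurable]: "f \<in> borel_measurable M" "g \<in> borel_measurable M" "h \<in> borel_measurable M" "j \<in> borel_measurable M"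
  shows "(\<lambda>x. line_shift (f x) (g x) (h x) (j x)) \<in> borel_measurable M"
  unfolding line_shift_def by measurable

lemma en_power2: "A \<ge> 1 \<Longrightarrow> (en A x)\<^sup>2 = A + x\<^sup>2"
  by (simp add: en_def add_nonneg_nonneg)

lemma en_gt_abs: "A \<ge> 1 \<Longrightarrow> \<bar>x\<bar> < en A x"
  unfolding en_def by (intro real_less_rsqrt) auto

lemma en_ge_sqrt: "sqrt A \<le> en A x"
  by (simp add: en_def)

lemma en_ge_1: "A \<ge> 1 \<Longrightarrow> 1 \<le> en A x"
  using en_ge_sqrt[of A x] by (meson order_trans real_sqrt_ge_1_iff)

lemma en_pos: "A \<ge> 1 \<Longrightarrow> 0 < en A x"
  using en_ge_1[of A x] by simp

lemma en_eqI: "A \<ge> 1 \<Longrightarrow> 0 \<le> y \<Longrightarrow> y\<^sup>2 = A + x\<^sup>2 \<Longrightarrow> en A x = y"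
  unfolding en_def by (metis real_sqrt_unique)

lemma DERIV_en: "A \<ge> 1 \<Longrightarrow> (en A has_real_derivative x / en A x) (at x)"
  using en_pos[of A x] unfolding en_def[abs_def]
  by (auto intro!: derivative_eq_intros simp: divide_simps)

lemma line_den_pos:
  assumes "A \<ge> 1" "B \<ge> 1"
  shows "(en A x + en B y)\<^sup>2 - (x + y)\<^sup>2 > 0"
proof -
  have "\<bar>x + y\<bar> < \<bar>en A x + en B y\<bar>" using en_gt_abs[OF assms(1), of x] en_gt_abs[OF assms(2), of y] by linarith
  then show ?thesis by (metis abs_ge_zero diff_gt_0_iff_gt power2_abs power_strict_mono pos2)
qed

lemma line_shift_commute: "line_shift B A y x = - line_shift A B x y"
proof -
  have *: "(en B y + en A x)\<^sup>2 - (y + x)\<^sup>2 = (en A x + en B y)\<^sup>2 - (x + y)\<^sup>2"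
    by (simp only: add.commute)
  show ?thesis
    unfolding line_shift_def * minus_divide_left by (rule arg_cong2[where f = "(/)"]) (simp_all add: algebra_simps)
qed

context
  fixes X Y x y q t :: real
  assumes X: "\<bar>x\<bar> < X" and Y: "\<bar>y\<bar> < Y"
    and q: "q * ((X + Y)\<^sup>2 - (x + y)\<^sup>2) = x * Y - y * X"
    and t: "t = - 2 * (X + Y) * q"
begin

text \<open>In (energy, momentum) coordinates, subtracting \<open>2 * q\<close> times
  \<open>(x + y, X + Y)\<close> from \<open>(X, x)\<close> is the Lorentz reflection that fixes the
  total vector \<open>(X + Y, x + y)\<close>. It therefore keeps the Minkowski square and reverses
  the sign of the determinant of the two vectors.\<close>

lemma line_reflection:
  shows "(X - 2 * (x + y) * q)\<^sup>2 - (x + t)\<^sup>2 = X\<^sup>2 - x\<^sup>2"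
    and "(x + t) * (Y + 2 * (x + y) * q) - (y - t) * (X - 2 * (x + y) * q) = - (x * Y - y * X)"
  using q unfolding t by algebra+

text \<open>The reflected energy must be positive before it can be recognised as a value of
  \<open>en\<close>. Multiplied by the denominator, the claim follows from \<open>|x| < X\<close>
  and the bound of twice the product of total energy and momentum by the sum of their
  squares.\<close>

lemma line_reflection_pos: "X - 2 * (x + y) * q > 0"
proof -
  have "\<bar>x + y\<bar> < \<bar>X + Y\<bar>" using X Y by linarith
  then have den: "(X + Y)\<^sup>2 - (x + y)\<^sup>2 > 0"
    by (metis abs_ge_zero diff_gt_0_iff_gt power2_abs power_strict_mono pos2)
  have "2 * (x + y) * x * (X + Y) \<le> 2 * \<bar>x + y\<bar> * \<bar>X + Y\<bar> * \<bar>x\<bar>"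
    using abs_ge_self[of "2 * (x + y) * x * (X + Y)"] by (simp only: abs_mult abs_numeral mult_ac)
  also have "\<dots> \<le> ((X + Y)\<^sup>2 + (x + y)\<^sup>2) * \<bar>x\<bar>"
    using sum_squares_bound[of "\<bar>x + y\<bar>" "\<bar>X + Y\<bar>"] by (intro mult_right_mono) auto
  also have "\<dots> < ((X + Y)\<^sup>2 + (x + y)\<^sup>2) * X"
    using X den by (intro mult_strict_left_mono) (auto simp: add_pos_nonneg intro!: add_pos_nonneg)
  finally have "2 * (x + y) * x * (X + Y) < ((X + Y)\<^sup>2 + (x + y)\<^sup>2) * X" .
  moreover have "((X + Y)\<^sup>2 - (x + y)\<^sup>2) * (X - 2 * (x + y) * q) = ((X + Y)\<^sup>2 + (x + y)\<^sup>2) * X - 2 * (x + y) * x * (X + Y)"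
    using q by algebra
  ultimately have "0 < ((X + Y)\<^sup>2 - (x + y)\<^sup>2) * (X - 2 * (x + y) * q)" by simp
  then show ?thesis using den by (simp add: zero_less_mult_iff)
qed

end

lemma en_line_shift_left:
  assumes "A \<ge> 1" "B \<ge> 1"
  shows "en A (x + line_shift A B x y) = en A x - 2 * (x + y) * ((x * en B y - y * en A x) / ((en A x + en B y)\<^sup>2 - (x + y)\<^sup>2))"
    (is "_ = _ - 2 * (x + y) * ?q")
proof (rule en_eqI[OF assms(1)])
  note gt = en_gt_abs[OF assms(1), of x] en_gt_abs[OF assms(2), of y]
  have q: "?q * ((en A x + en B y)\<^sup>2 - (x + y)\<^sup>2) = x * en B y - y * en A x"
    using line_den_pos[OF assms, of x y] by simp
  have t: "line_shift A B x y = - 2 * (en A x + en B y) * ?q"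
    by (simp add: line_shift_def)
  show "0 \<le> en A x - 2 * (x + y) * ?q"
    using line_reflection_pos[OF gt q t] by simp
  show "(en A x - 2 * (x + y) * ?q)\<^sup>2 = A + (x + line_shift A B x y)\<^sup>2"
    using line_reflection(1)[OF gt q t] en_power2[OF assms(1), of x] by simp
qed

lemma en_line_shift_right:
  assumes "A \<ge> 1" "B \<ge> 1"
  shows "en B (y - line_shift A B x y) = en B y + 2 * (x + y) * ((x * en B y - y * en A x) / ((en A x + en B y)\<^sup>2 - (x + y)\<^sup>2))"
proof -
  have *: "(en B y + en A x)\<^sup>2 - (y + x)\<^sup>2 = (en A x + en B y)\<^sup>2 - (x + y)\<^sup>2"
    by (simp only: add.commute)
  have "(y * en A x - x * en B y) / ((en B y + en A x)\<^sup>2 - (y + x)\<^sup>2) =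
    - ((x * en B y - y * en A x) / ((en A x + en B y)\<^sup>2 - (x + y)\<^sup>2))"
    unfolding * minus_divide_left by simp
  then show ?thesis
    using en_line_shift_left[OF assms(2,1), of y x] line_shift_commute[of B A y x]
    by (simp only: diff_minus_eq_add mult_minus_right add.commute[of y x] add_uminus_conv_diff)
qed

lemma line_shift_energy:
  assumes "A \<ge> 1" "B \<ge> 1"
  shows "en A (x + line_shift A B x y) + en B (y - line_shift A B x y) = en A x + en B y"
  using assms by (simp add: en_line_shift_left en_line_shift_right)

lemma line_shift_defect:
  assumes "A \<ge> 1" "B \<ge> 1"
  shows "(x + line_shift A B x y) * en B (y - line_shift A B x y) - (y - line_shift A B x y) * en A (x + line_shift A B x y)
    = - (x * en B y - y * en A x)"
proof -
  let ?q = "(x * en B y - y * en A x) / ((en A x + en B y)\<^sup>2 - (x + y)\<^sup>2)"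
  have q: "?q * ((en A x + en B y)\<^sup>2 - (x + y)\<^sup>2) = x * en B y - y * en A x"
    using line_den_pos[OF assms, of x y] by simp
  have t: "line_shift A B x y = - 2 * (en A x + en B y) * ?q"
    by (simp add: line_shift_def)
  show ?thesis
    unfolding en_line_shift_left[OF assms] en_line_shift_right[OF assms]
    using line_reflection(2)[OF en_gt_abs[OF assms(1)] en_gt_abs[OF assms(2)] q t] .
qed

text \<open>Total momentum and energy are unchanged and the numerator changes sign, so the same
  formula returns the opposite shift.\<close>

lemma line_shift_involution:
  assumes "A \<ge> 1" "B \<ge> 1"
  shows "line_shift A B (x + line_shift A B x y) (y - line_shift A B x y) = - line_shift A B x y"
proof -
  have "x + line_shift A B x y + (y - line_shift A B x y) = x + y" by simp
  then show ?thesis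
    unfolding line_shift_def[of A B "x + line_shift A B x y"] line_shift_energy[OF assms] line_shift_defect[OF assms]
    by (simp only: line_shift_def[of A B x y] mult_minus_right minus_divide_left)
qed

lemma line_shift_eq_0_iff:
  assumes "A \<ge> 1" "B \<ge> 1"
  shows "line_shift A B x y = 0 \<longleftrightarrow> x * en B y - y * en A x = 0"
  using line_den_pos[OF assms, of x y] en_pos[OF assms(1), of x] en_pos[OF assms(2), of y]
  by (auto simp: line_shift_def)

text \<open>Only existence is recorded; the values of derivatives come later from differentiating
  the conservation of energy. The affine arguments cover both a fixed total momentum and a fixed
  first momentum.\<close>

lemma line_shift_differentiable:
  assumes "A \<ge> 1" "B \<ge> 1"
  shows "(\<lambda>z. line_shift A B (a * z + b) (c * z + d)) differentiable (at z)"
proof -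
  have en: "(\<lambda>z. en A (a * z + b)) differentiable (at z)" if "A \<ge> 1" for A a b
    unfolding real_differentiable_def
    by (rule exI, rule DERIV_chain2[OF DERIV_en[OF that]]) (auto intro!: derivative_eq_intros)
  show ?thesis
    unfolding line_shift_def using line_den_pos[OF assms, of "a * z + b" "c * z + d"]
    by (intro derivative_intros en assms) auto
qed

text \<open>On a line with fixed total momentum the collision exchanges the two points of equal energy,
  hence it preserves the measure weighted with the derivative of the energy.\<close>
lemma nn_integral_line_involution:
  fixes G :: "real \<Rightarrow> ennreal"
  assumes A: "A \<ge> 1" "B \<ge> 1" and [measurable]: "G \<in> borel_measurable borel"
  shows "(\<integral>\<^sup>+x. ennreal \<bar>x / en A x - (\<pi> - x) / en B (\<pi> - x)\<bar> * G (x + line_shift A B x (\<pi> - x)) \<partial>lborel) =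
    (\<integral>\<^sup>+x. ennreal \<bar>x / en A x - (\<pi> - x) / en B (\<pi> - x)\<bar> * G x \<partial>lborel)"
proof -
  define \<phi> where "\<phi> x = x + line_shift A B x (\<pi> - x)" for x
  define e where "e x = x / en A x - (\<pi> - x) / en B (\<pi> - x)" for x
  \<comment> \<open>Outside \<open>S\<close> the two points of equal energy coincide and the weight
    vanishes. On \<open>S\<close> the quotient \<open>e x / e (\<phi> x)\<close> below has a nonzero
    denominator.\<close>
  define S where "S = {x. e x \<noteq> 0}"
  have [measurable]: "\<phi> \<in> borel_measurable borel" "e \<in> borel_measurable borel"
    unfolding \<phi>_def e_def by measurable
  have [measurable]: "S \<in> sets borel" unfolding S_def by measurable
  have eD: "e x = (x * en B (\<pi> - x) - (\<pi> - x) * en A x) / (en A x * en B (\<pi> - x))" for x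
    using en_pos[OF A(1), of x] en_pos[OF A(2), of "\<pi> - x"] by (simp add: e_def field_simps)
  have \<phi>': "\<pi> - \<phi> x = \<pi> - x - line_shift A B x (\<pi> - x)" for x by (simp add: \<phi>_def)
  have inv: "\<phi> (\<phi> x) = x" for x
    using line_shift_involution[OF A, of x "\<pi> - x"] unfolding \<phi>_def[of "\<phi> x"] \<phi>' by (simp add: \<phi>_def)
  have energy: "en A (\<phi> x) + en B (\<pi> - \<phi> x) = en A x + en B (\<pi> - x)" for x
    using line_shift_energy[OF A, of x "\<pi> - x"] unfolding \<phi>' by (simp add: \<phi>_def)
  have S\<phi>: "\<phi> x \<in> S" if "x \<in> S" for x
  proof -
    have "x * en B (\<pi> - x) - (\<pi> - x) * en A x \<noteq> 0"
      using that by (auto simp: S_def eD)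
    then have "\<phi> x * en B (\<pi> - \<phi> x) - (\<pi> - \<phi> x) * en A (\<phi> x) \<noteq> 0"
      using line_shift_defect[OF A, of x "\<pi> - x"] unfolding \<phi>' by (simp add: \<phi>_def)
    then show ?thesis
      using en_pos[OF A(1), of "\<phi> x"] en_pos[OF A(2), of "\<pi> - \<phi> x"] by (simp add: S_def eD)
  qed
  have im: "\<phi> ` S = S" using S\<phi> inv by (auto simp: image_iff) metis
  have inj: "inj_on \<phi> S" using inv by (metis inj_onI)
  have der_e: "((\<lambda>x. en A x + en B (\<pi> - x)) has_real_derivative e x) (at x)" for x
  proof -
    have "((\<lambda>x. en B (\<pi> - x)) has_real_derivative (\<pi> - x) / en B (\<pi> - x) * (- 1)) (at x)"
      by (rule DERIV_chain2[OF DERIV_en[OF A(2)]]) (auto intro!: derivative_eq_intros)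
    from DERIV_add[OF DERIV_en[OF A(1)] this] show ?thesis by (simp add: e_def)
  qed
  have der: "(\<phi> has_real_derivative e x / e (\<phi> x)) (at x)" if "x \<in> S" for x
  proof -
    have "(\<lambda>x. line_shift A B (1 * x + 0) (-1 * x + \<pi>)) differentiable (at x)"
      by (rule line_shift_differentiable[OF A])
    then have "\<phi> differentiable (at x)"
      unfolding \<phi>_def by (intro derivative_intros) simp
    then obtain d where d: "(\<phi> has_real_derivative d) (at x)"
      using real_differentiable_def by blast
    \<comment> \<open>The chain rule for the invariant energy determines \<open>d\<close> without
      differentiating the formula for \<open>line_shift\<close>.\<close>
    have "((\<lambda>x. en A (\<phi> x) + en B (\<pi> - \<phi> x)) has_real_derivative e (\<phi> x) * d) (at x)"
      by (rule DERIV_chain2[OF der_e d])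
    then have "e (\<phi> x) * d = e x"
      unfolding energy using der_e DERIV_unique by blast
    then have "d = e x / e (\<phi> x)"
      using S\<phi>[OF that] by (auto simp: S_def field_simps)
    then show ?thesis using d by simp
  qed
  have 0: "(\<integral>\<^sup>+x. ennreal \<bar>e x\<bar> * G x \<partial>lborel) = (\<integral>\<^sup>+x. ennreal \<bar>e x\<bar> * G x * indicator S x \<partial>lborel)" for G
    by (rule nn_integral_cong) (auto simp: S_def indicator_def)
  have "(\<integral>\<^sup>+x. ennreal \<bar>e x\<bar> * G x * indicator S x \<partial>lborel) =
    (\<integral>\<^sup>+x. ennreal \<bar>e x / e (\<phi> x)\<bar> * (ennreal \<bar>e (\<phi> x)\<bar> * G (\<phi> x)) * indicator S x \<partial>lborel)"
    by (rule nn_integral_change_of_variables[symmetric, OF _ der inj im]) measurable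
  also have "\<dots> = (\<integral>\<^sup>+x. ennreal \<bar>e x\<bar> * G (\<phi> x) * indicator S x \<partial>lborel)"
  proof (rule nn_integral_cong)
    fix x
    have "ennreal \<bar>e x / e (\<phi> x)\<bar> * ennreal \<bar>e (\<phi> x)\<bar> = ennreal \<bar>e x\<bar>" if "x \<in> S"
      using S\<phi>[OF that] by (simp add: ennreal_mult[symmetric] S_def abs_divide)
    then show "ennreal \<bar>e x / e (\<phi> x)\<bar> * (ennreal \<bar>e (\<phi> x)\<bar> * G (\<phi> x)) * indicator S x = ennreal \<bar>e x\<bar> * G (\<phi> x) * indicator S x"
      by (cases "x \<in> S") (auto simp: mult.assoc[symmetric])
  qed
  finally have "(\<integral>\<^sup>+x. ennreal \<bar>e x\<bar> * G (\<phi> x) \<partial>lborel) = (\<integral>\<^sup>+x. ennreal \<bar>e x\<bar> * G x \<partial>lborel)"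
    unfolding 0[of G] 0[of "\<lambda>x. G (\<phi> x)"] by simp
  then show ?thesis by (simp add: e_def \<phi>_def)
qed

section \<open>The momentum transfer as a coordinate at a fixed first momentum\<close>

lemma en_diff_power2_less:
  assumes "A \<ge> 1" "t \<noteq> 0"
  shows "(en A (x + t) - en A x)\<^sup>2 < t\<^sup>2"
proof -
  let ?X = "en A x" and ?X' = "en A (x + t)"
  have less: "\<bar>2 * x + t\<bar> < ?X' + ?X"
    using en_gt_abs[OF assms(1), of x] en_gt_abs[OF assms(1), of "x + t"] by linarith
  have "(?X' - ?X) * (?X' + ?X) = t * (2 * x + t)"
    using en_power2[OF assms(1), of x] en_power2[OF assms(1), of "x + t"] by algebra
  then have "\<bar>?X' - ?X\<bar> * (?X' + ?X) = \<bar>t\<bar> * \<bar>2 * x + t\<bar>"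
    using less by (metis abs_ge_zero abs_mult abs_of_nonneg less_eq_real_def order_le_less_trans)
  also have "\<dots> < \<bar>t\<bar> * (?X' + ?X)"
    using less assms(2) by (intro mult_strict_left_mono) auto
  finally have "\<bar>?X' - ?X\<bar> < \<bar>t\<bar>"
    using less by (simp add: mult_less_cancel_right)
  then show ?thesis by (metis abs_ge_zero power2_abs power_strict_mono pos2)
qed

text \<open>For two points of one mass shell the squared determinant equals
  \<open>B * g + g\<^sup>2 / 4\<close>, where \<open>g\<close> is minus the Minkowski square of
  their difference. This bounds from below the factor \<open>N\<close> of the Jacobian in the next
  lemma, which vanishes together with the transfer.\<close>

lemma defect_power2_ge:
  fixes Y Y' y y' B :: real
  assumes "Y\<^sup>2 = B + y\<^sup>2" "Y'\<^sup>2 = B + y'\<^sup>2"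
  shows "B * ((y - y')\<^sup>2 - (Y - Y')\<^sup>2) \<le> (y * Y' - y' * Y)\<^sup>2"
proof -
  define g where "g = (y - y')\<^sup>2 - (Y - Y')\<^sup>2"
  have "4 * (y * Y' - y' * Y)\<^sup>2 = 4 * (B * g) + g\<^sup>2"
    using assms(1,2) unfolding g_def by algebra
  then show ?thesis using zero_le_power2[of g] unfolding g_def[symmetric] by linarith
qed

text \<open>The integrand on the left majorises the collision kernel times the relative momentum of
  \<open>v\<close> and \<open>v'\<close> (the square root) and the weight of \<open>w'\<close>. In
  the variable \<open>t\<close> the kernel acquires \<open>t\<^sup>2\<close>, the radial factor of
  polar coordinates, and the inverse of the determinant \<open>N\<close>, which the square root
  absorbs. The remaining power of \<open>en B\<close> is estimated at its minimum
  \<open>sqrt B\<close>; its exponent \<open>1 - \<eta>\<close> is not positive.\<close>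

lemma nn_integral_line_carleman:
  fixes G :: "real \<Rightarrow> ennreal" and x :: real
  assumes A: "A \<ge> 1" "B \<ge> 1" and \<eta>: "\<eta> \<ge> 1" and [measurable]: "G \<in> borel_measurable borel"
  defines "t \<equiv> \<lambda>z. line_shift A B x z"
  shows "(\<integral>\<^sup>+z. ennreal (16 * en A (x + t z) * en B (z - t z) powr (1 - \<eta>) * (en A x + en B z)\<^sup>2 * \<bar>x * en B z - z * en A x\<bar> /
      (en A x * en B z * ((en A x + en B z)\<^sup>2 - (x + z)\<^sup>2)\<^sup>2) * sqrt ((t z)\<^sup>2 - (en A (x + t z) - en A x)\<^sup>2)) * G (t z) \<partial>lborel)
    \<le> (\<integral>\<^sup>+t. ennreal (4 * sqrt B powr (- \<eta>) * t\<^sup>2) * G t \<partial>lborel)"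
proof -
  define D where "D z = x * en B z - z * en A x" for z
  define N where "N z = z * en B (z - t z) - (z - t z) * en B z" for z
  define den where "den z = (en A x + en B z)\<^sup>2 - (x + z)\<^sup>2" for z
  define T' where "T' z = - N z * en A (x + t z) / (en B z * D z)" for z
  define S where "S = {z. D z \<noteq> 0}"
  define H where "H t = ennreal (4 * sqrt B powr (- \<eta>) * t\<^sup>2) * G t" for t
  have [measurable]: "t \<in> borel_measurable borel" unfolding t_def by measurable
  have [measurable]: "D \<in> borel_measurable borel" "N \<in> borel_measurable borel"
    unfolding D_def N_def by measurable
  have [measurable]: "T' \<in> borel_measurable borel" unfolding T'_def by measurable
  have [measurable]: "S \<in> sets borel" unfolding S_def by measurable
  have [measurable]: "H \<in> borel_measurable borel" unfolding H_def by measurable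
  note pos = en_pos[OF A(1)] en_pos[OF A(2)]
  have energy: "en A (x + t z) + en B (z - t z) = en A x + en B z" for z
    unfolding t_def by (rule line_shift_energy[OF A])
  have defect: "(x + t z) * en B (z - t z) - (z - t z) * en A (x + t z) = - D z" for z
    unfolding t_def D_def by (rule line_shift_defect[OF A])
  have t0: "t z \<noteq> 0" if "z \<in> S" for z
    using that line_shift_eq_0_iff[OF A, of x z] by (auto simp: t_def S_def D_def)
  \<comment> \<open>The difference of two points of a mass shell is spacelike; the positive radicand
    is cancelled as a factor in the proof of injectivity.\<close>
  have gb: "(t z)\<^sup>2 - (en A (x + t z) - en A x)\<^sup>2 > 0" if "z \<in> S" for z
    using en_diff_power2_less[OF A(1) t0[OF that], of x] by simp
  \<comment> \<open>The transfer fixes the energy gain \<open>e\<close> of the first particle. From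
    both, the identities \<open>*\<close> yield the sum of the energies of the second particle
    before and after, and then \<open>2 * z - t\<close>.\<close>
  have inj: "inj_on t S"
  proof (rule inj_onI)
    fix z w assume z: "z \<in> S" and w: "w \<in> S" and eq: "t z = t w"
    define \<tau> where "\<tau> = t z"
    define e where "e = en A (x + \<tau>) - en A x"
    have *: "(en B u + en B (u - \<tau>))\<^sup>2 * (\<tau>\<^sup>2 - e\<^sup>2) = \<tau>\<^sup>2 * (4 * B + \<tau>\<^sup>2 - e\<^sup>2)"
      "(en B u + en B (u - \<tau>)) * e = \<tau> * (2 * u - \<tau>)" if "t u = \<tau>" for u
    proof -
      have e: "e = en B u - en B (u - \<tau>)" using energy[of u] that by (simp add: e_def)
      note sq = en_power2[OF A(2), of u] en_power2[OF A(2), of "u - \<tau>"]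
      show "(en B u + en B (u - \<tau>)) * e = \<tau> * (2 * u - \<tau>)"
        using sq unfolding e by algebra
      show "(en B u + en B (u - \<tau>))\<^sup>2 * (\<tau>\<^sup>2 - e\<^sup>2) = \<tau>\<^sup>2 * (4 * B + \<tau>\<^sup>2 - e\<^sup>2)"
        using sq unfolding e by algebra
    qed
    have "\<tau>\<^sup>2 - e\<^sup>2 > 0" using gb[OF z] by (simp add: \<tau>_def e_def)
    then have "(en B z + en B (z - \<tau>))\<^sup>2 = (en B w + en B (w - \<tau>))\<^sup>2"
      using *(1)[of z] *(1)[of w] eq \<tau>_def by (metis less_irrefl mult_right_cancel)
    then have "en B z + en B (z - \<tau>) = en B w + en B (w - \<tau>)"
      using pos by (meson add_pos_pos less_imp_le power2_eq_imp_eq)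
    then have "\<tau> * (2 * z - \<tau>) = \<tau> * (2 * w - \<tau>)"
      using *(2)[of z] *(2)[of w] eq \<tau>_def by metis
    then show "z = w" using t0[OF z] by (simp add: \<tau>_def)
  qed
  have der: "(t has_real_derivative T' z) (at z)" if z: "z \<in> S" for z
  proof -
    have "(\<lambda>z. line_shift A B (0 * z + x) (1 * z + 0)) differentiable (at z)"
      by (rule line_shift_differentiable[OF A])
    then have "t differentiable (at z)" by (simp add: t_def)
    then obtain d where d: "(t has_real_derivative d) (at z)"
      using real_differentiable_def by blast
    \<comment> \<open>The value of \<open>d\<close> is found by differentiating both sides of the
      conservation of energy.\<close>
    have "((\<lambda>z. en A (x + t z)) has_real_derivative (x + t z) / en A (x + t z) * d) (at z)"
      by (rule DERIV_chain2[OF DERIV_en[OF A(1)]]) (auto intro!: derivative_eq_intros d)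
    moreover have "((\<lambda>z. en B (z - t z)) has_real_derivative (z - t z) / en B (z - t z) * (1 - d)) (at z)"
      by (rule DERIV_chain2[OF DERIV_en[OF A(2)]]) (auto intro!: derivative_eq_intros d)
    ultimately have "((\<lambda>z. en A x + en B z) has_real_derivative
        (x + t z) / en A (x + t z) * d + (z - t z) / en B (z - t z) * (1 - d)) (at z)"
      unfolding energy[symmetric] by (rule DERIV_add)
    moreover have "((\<lambda>z. en A x + en B z) has_real_derivative z / en B z) (at z)"
      using DERIV_add[OF DERIV_const DERIV_en[OF A(2)]] by simp
    ultimately have "(x + t z) / en A (x + t z) * d + (z - t z) / en B (z - t z) * (1 - d) = z / en B z"
      by (rule DERIV_unique)
    moreover define X' Y' Y where "X' = en A (x + t z)" "Y' = en B (z - t z)" "Y = en B z"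
    ultimately have deq: "(x + t z) / X' * d + (z - t z) / Y' * (1 - d) = z / Y" by simp
    have p: "X' > 0" "Y' > 0" "Y > 0" using pos by (auto simp: X'_Y'_Y_def)
    have "d * (Y * D z) = - N z * X'"
    proof -
      have "(x + t z) * d * Y' * Y + (z - t z) * (1 - d) * X' * Y = z * X' * Y'"
        using deq p by (simp add: field_simps)
      moreover have "(x + t z) * Y' - (z - t z) * X' = - D z" using defect[of z] by (simp add: X'_Y'_Y_def)
      moreover have "N z = z * Y' - (z - t z) * Y" by (simp add: N_def X'_Y'_Y_def)
      ultimately show ?thesis by algebra
    qed
    moreover have "D z \<noteq> 0" using z by (simp add: S_def)
    ultimately have "d = T' z"
      using p unfolding T'_def X'_Y'_Y_def[symmetric] by (simp add: field_simps)
    then show ?thesis using d by simp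
  qed
  have bound: "16 * en A (x + t z) * en B (z - t z) powr (1 - \<eta>) * (en A x + en B z)\<^sup>2 * \<bar>D z\<bar> /
      (en A x * en B z * (den z)\<^sup>2) * sqrt ((t z)\<^sup>2 - (en A (x + t z) - en A x)\<^sup>2)
      \<le> \<bar>T' z\<bar> * (4 * sqrt B powr (- \<eta>) * (t z)\<^sup>2)" if z: "z \<in> S" for z
  proof -
    define X X' Y Y' E g s where "X = en A x" "X' = en A (x + t z)" "Y = en B z" "Y' = en B (z - t z)"
      "E = en A x + en B z" "g = (t z)\<^sup>2 - (en A (x + t z) - en A x)\<^sup>2" "s = sqrt B"
    note defs = this
    have p: "X > 0" "X' > 0" "Y > 0" "Y' > 0" "X \<ge> 1" "den z > 0" "g > 0" "s > 0" "\<bar>D z\<bar> > 0"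
      using pos en_ge_1[OF A(1), of x] gb[OF z] line_den_pos[OF A, of x z] A z by (auto simp: defs den_def S_def)
    have "s\<^sup>2 * g \<le> (N z)\<^sup>2"
    proof -
      have "Y - Y' = X' - X" using energy[of z] by (simp add: defs)
      then have g: "(z - (z - t z))\<^sup>2 - (Y - Y')\<^sup>2 = g" by (simp add: defs)
      show ?thesis
        using defect_power2_ge[of Y B z Y' "z - t z"] en_power2[OF A(2)] p A unfolding g by (simp add: defs N_def)
    qed
    then have Ns: "s * sqrt g \<le> \<bar>N z\<bar>"
      using p by (intro power2_le_imp_le[of "s * sqrt g" "\<bar>N z\<bar>"]) (auto simp: power_mult_distrib)
    have Y': "Y' powr (1 - \<eta>) \<le> s * s powr (- \<eta>)"
    proof -
      have "Y' powr (1 - \<eta>) \<le> s powr (1 - \<eta>)"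
        using \<eta> p en_ge_sqrt[of B "z - t z"] by (intro powr_mono2') (auto simp: defs)
      also have "\<dots> = s * s powr (- \<eta>)" using p by (simp add: powr_diff powr_minus divide_inverse)
      finally show ?thesis .
    qed
    have "Y' powr (1 - \<eta>) * sqrt g \<le> s * s powr (- \<eta>) * sqrt g"
      using Y' p by (intro mult_right_mono) auto
    also have "\<dots> = s * sqrt g * s powr (- \<eta>)" by simp
    also have "\<dots> \<le> \<bar>N z\<bar> * s powr (- \<eta>)" using Ns by (intro mult_right_mono) auto
    also have "\<dots> \<le> X * (\<bar>N z\<bar> * s powr (- \<eta>))" using p mult_right_mono[of 1 X "\<bar>N z\<bar> * s powr (- \<eta>)"] by simp
    finally have "Y' powr (1 - \<eta>) * sqrt g / X \<le> \<bar>N z\<bar> * s powr (- \<eta>)"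
      using p by (simp add: field_simps)
    then have "16 * X' * E\<^sup>2 * \<bar>D z\<bar> / (Y * (den z)\<^sup>2) * (Y' powr (1 - \<eta>) * sqrt g / X) \<le>
      16 * X' * E\<^sup>2 * \<bar>D z\<bar> / (Y * (den z)\<^sup>2) * (\<bar>N z\<bar> * s powr (- \<eta>))"
      using p by (intro mult_left_mono) auto
    also have "\<dots> = \<bar>T' z\<bar> * (4 * s powr (- \<eta>) * (t z)\<^sup>2)"
    proof -
      \<comment> \<open>One factor \<open>D z\<close> of \<open>(t z)\<^sup>2\<close> cancels the
        denominator of \<open>T' z\<close>; the other one is that of the kernel.\<close>
      have "t z = - 2 * E * D z / den z" by (simp add: t_def line_shift_def defs D_def den_def)
      then have t2: "(t z)\<^sup>2 = 4 * E\<^sup>2 * \<bar>D z\<bar>\<^sup>2 / (den z)\<^sup>2" by (simp add: power_divide power_mult_distrib)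
      have T: "\<bar>T' z\<bar> = \<bar>N z\<bar> * X' / (Y * \<bar>D z\<bar>)"
        using p unfolding T'_def X_X'_Y_Y'_E_g_s_def[symmetric] by (simp add: abs_mult abs_divide)
      show ?thesis unfolding t2 T using p by (simp add: field_simps power2_eq_square)
    qed
    finally have fin: "16 * X' * E\<^sup>2 * \<bar>D z\<bar> / (Y * (den z)\<^sup>2) * (Y' powr (1 - \<eta>) * sqrt g / X) \<le>
      \<bar>T' z\<bar> * (4 * s powr (- \<eta>) * (t z)\<^sup>2)" .
    have Eg: "X + Y = E" "(t z)\<^sup>2 - (X' - X)\<^sup>2 = g" by (simp_all add: defs)
    show ?thesis
      unfolding defs(1-4,7)[symmetric] Eg using fin p by (simp add: field_simps)
  qed
  have "(\<integral>\<^sup>+z. ennreal (16 * en A (x + t z) * en B (z - t z) powr (1 - \<eta>) * (en A x + en B z)\<^sup>2 * \<bar>D z\<bar> /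
      (en A x * en B z * (den z)\<^sup>2) * sqrt ((t z)\<^sup>2 - (en A (x + t z) - en A x)\<^sup>2)) * G (t z) \<partial>lborel)
    \<le> (\<integral>\<^sup>+z. ennreal \<bar>T' z\<bar> * H (t z) * indicator S z \<partial>lborel)"
  proof (rule nn_integral_mono)
    fix z
    show "ennreal (16 * en A (x + t z) * en B (z - t z) powr (1 - \<eta>) * (en A x + en B z)\<^sup>2 * \<bar>D z\<bar> /
      (en A x * en B z * (den z)\<^sup>2) * sqrt ((t z)\<^sup>2 - (en A (x + t z) - en A x)\<^sup>2)) * G (t z)
      \<le> ennreal \<bar>T' z\<bar> * H (t z) * indicator S z"
    proof (cases "z \<in> S")
      case True
      have "ennreal \<bar>T' z\<bar> * H (t z) = ennreal (\<bar>T' z\<bar> * (4 * sqrt B powr (- \<eta>) * (t z)\<^sup>2)) * G (t z)"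
        unfolding H_def mult.assoc[symmetric] by (simp add: ennreal_mult[symmetric] mult.assoc)
      then show ?thesis using bound[OF True] True by (auto intro!: mult_right_mono ennreal_leI)
    qed (simp add: S_def)
  qed
  also have "\<dots> \<le> (\<integral>\<^sup>+t. H t \<partial>lborel)"
    by (rule nn_integral_change_of_variables_le[OF _ der inj]) measurable
  finally show ?thesis unfolding H_def D_def den_def .
qed

section \<open>Collision kinematics and the Glassey-Strauss variables\<close>

lemma measurable_vzero[measurable (raw)]:
  assumes [measurable]: "f \<in> borel_measurable M"
  shows "(\<lambda>x. vzero (f x)) \<in> borel_measurable M"
  unfolding vzero_def by measurable

lemma measurable_relg[measurable (raw)]:
  assumes [measurable]: "f \<in> borel_measurable M" "g \<in> borel_measurable M"
  shows "(\<lambda>x. relg (f x) (g x)) \<in> borel_measurable M"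
  unfolding relg_def by measurable

lemma measurable_moller[measurable (raw)]:
  assumes [measurable]: "f \<in> borel_measurable M" "g \<in> borel_measurable M"
  shows "(\<lambda>x. moller (f x) (g x)) \<in> borel_measurable M"
  unfolding moller_def mandel_s_def by measurable

lemma measurable_boostdir[measurable (raw)]:
  assumes [measurable]: "f \<in> borel_measurable M" "g \<in> borel_measurable M" "h \<in> borel_measurable M"
  shows "(\<lambda>x. boostdir (f x) (g x) (h x)) \<in> borel_measurable M"
  unfolding boostdir_def gam_def mandel_s_def by measurable

lemma measurable_vpost[measurable (raw)]:
  assumes [measurable]: "f \<in> borel_measurable M" "g \<in> borel_measurable M" "h \<in> borel_measurable M"
  shows "(\<lambda>x. vpost (f x) (g x) (h x)) \<in> borel_measurable M"
  unfolding vpost_def by measurable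

lemma measurable_wpost[measurable (raw)]:
  assumes [measurable]: "f \<in> borel_measurable M" "g \<in> borel_measurable M" "h \<in> borel_measurable M"
  shows "(\<lambda>x. wpost (f x) (g x) (h x)) \<in> borel_measurable M"
  unfolding wpost_def by measurable

lemma vzero_power2: "(vzero v)\<^sup>2 = 1 + (norm v)\<^sup>2"
  by (simp add: vzero_def)

lemma vzero_ge_1: "1 \<le> vzero v"
  by (simp add: vzero_def)

lemma vzero_pos: "0 < vzero v"
  using vzero_ge_1[of v] by linarith

lemma norm_less_vzero: "norm v < vzero v"
  unfolding vzero_def by (intro real_less_rsqrt) simp

text \<open>This is the Cauchy-Schwarz inequality for \<open>(v, 1)\<close> and one of
  \<open>(w, 1)\<close>, \<open>(- w, 1)\<close>. It makes the radicand of \<open>relg\<close>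
  nonnegative and bounds \<open>mandel_s\<close> by the product of the energies.\<close>

lemma abs_inner_vzero: "\<bar>v \<bullet> w\<bar> + 1 \<le> vzero v * vzero w"
proof -
  have "(norm v * norm w + 1)\<^sup>2 + (norm v - norm w)\<^sup>2 = (vzero v * vzero w)\<^sup>2"
    unfolding power_mult_distrib vzero_power2 by algebra
  then have "(norm v * norm w + 1)\<^sup>2 \<le> (vzero v * vzero w)\<^sup>2"
    using zero_le_power2[of "norm v - norm w"] by linarith
  then have "norm v * norm w + 1 \<le> vzero v * vzero w"
    using vzero_pos[of v] vzero_pos[of w] by (intro power2_le_imp_le[of "norm v * norm w + 1"]) auto
  then show ?thesis using Cauchy_Schwarz_ineq2[of v w] by linarith
qed

lemma norm_diff_power2: "(norm (v - w))\<^sup>2 = (norm v)\<^sup>2 + (norm w)\<^sup>2 - 2 * (v \<bullet> w)" for v w :: vec3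
  by (simp add: power2_norm_eq_inner inner_diff_left inner_diff_right inner_commute)

lemma norm_add_power2: "(norm (v + w))\<^sup>2 = (norm v)\<^sup>2 + (norm w)\<^sup>2 + 2 * (v \<bullet> w)" for v w :: vec3
  by (simp add: power2_norm_eq_inner inner_add_left inner_add_right inner_commute)

lemma relg_power2: "(relg v w)\<^sup>2 = 2 * (vzero v * vzero w - v \<bullet> w - 1)"
proof -
  have eq: "- (vzero v - vzero w)\<^sup>2 + (norm (v - w))\<^sup>2 = 2 * (vzero v * vzero w - v \<bullet> w - 1)"
    unfolding norm_diff_power2 power2_diff vzero_power2 by simp
  then show ?thesis
    unfolding relg_def eq using abs_inner_vzero[of v w] by simp
qed

lemma relg_nonneg: "0 \<le> relg v w"
proof -
  have eq: "- (vzero v - vzero w)\<^sup>2 + (norm (v - w))\<^sup>2 = 2 * (vzero v * vzero w - v \<bullet> w - 1)"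
    unfolding norm_diff_power2 power2_diff vzero_power2 by simp
  show ?thesis
    unfolding relg_def eq using abs_inner_vzero[of v w] by simp
qed

lemma mandel_s_eq: "mandel_s v w = 2 * (vzero v * vzero w - v \<bullet> w + 1)"
  by (simp add: mandel_s_def relg_power2)

text \<open>As a function of total energy and momentum alone, \<open>mandel_s\<close> is a collision
  invariant, and with it \<open>relg\<close>.\<close>

lemma mandel_s_eq_total: "mandel_s v w = (vzero v + vzero w)\<^sup>2 - (norm (v + w))\<^sup>2"
  unfolding mandel_s_eq norm_add_power2 power2_sum vzero_power2 by simp

lemma mandel_s_ge_4: "4 \<le> mandel_s v w"
  by (simp add: mandel_s_def)

lemma mandel_s_le: "mandel_s v w \<le> 4 * (vzero v * vzero w)"
  using abs_inner_vzero[of v w] abs_ge_minus_self[of "v \<bullet> w"] unfolding mandel_s_eq by (simp add: algebra_simps)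

text \<open>If \<open>relg v w\<close> vanished, the energies would differ by as much as the
  momenta. Multiplied by the total energy this contradicts the Cauchy-Schwarz inequality, since the
  total energy exceeds the length of the total momentum.\<close>

lemma relg_pos:
  assumes "v \<noteq> w"
  shows "0 < relg v w"
proof (rule ccontr)
  assume "\<not> 0 < relg v w"
  then have 0: "relg v w = 0" using relg_nonneg[of v w] by simp
  have "(vzero v - vzero w)\<^sup>2 = (norm (v - w))\<^sup>2"
    using 0 relg_power2[of v w] unfolding norm_diff_power2 power2_diff vzero_power2 by simp
  moreover have "(vzero v - vzero w) * (vzero v + vzero w) = (v - w) \<bullet> (v + w)"
    using vzero_power2[of v] vzero_power2[of w] unfolding power2_norm_eq_inner
    by (simp add: inner_diff_left inner_add_right inner_commute algebra_simps power2_eq_square)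
  ultimately have "(norm (v - w))\<^sup>2 * (vzero v + vzero w)\<^sup>2 = ((v - w) \<bullet> (v + w))\<^sup>2"
    by (metis power_mult_distrib)
  also have "\<dots> \<le> (norm (v - w) * norm (v + w))\<^sup>2"
    using Cauchy_Schwarz_ineq2[of "v - w" "v + w"] by (intro power2_le_iff_abs_le[THEN iffD2]) auto
  finally have "(norm (v - w))\<^sup>2 * mandel_s v w \<le> 0"
    unfolding mandel_s_eq_total by (simp add: power_mult_distrib algebra_simps)
  moreover have "0 < (norm (v - w))\<^sup>2 * mandel_s v w"
    using assms mandel_s_ge_4[of v w] by (intro mult_pos_pos) auto
  ultimately show False by simp
qed

section \<open>The boost, the energies after the collision and the scattering angle\<close>

lemma boostdir_eq: "boostdir v w \<omega> = dilation (v + w) (gam v w) \<omega>"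
  by (simp add: boostdir_def dilation_def)

lemma gam_power2: "(gam v w)\<^sup>2 = (vzero v + vzero w)\<^sup>2 / mandel_s v w"
  using mandel_s_ge_4[of v w] by (simp add: gam_def power_divide)

lemma gam_pos: "0 < gam v w"
  using mandel_s_ge_4[of v w] vzero_pos[of v] vzero_pos[of w] by (simp add: gam_def add_pos_pos)

lemma gam_eq_1: "v + w = 0 \<Longrightarrow> gam v w = 1"
  using mandel_s_eq_total[of v w] vzero_pos[of v] vzero_pos[of w] by (simp add: gam_def)

lemma inner_total_dilation: "P \<bullet> dilation P c x = c * (P \<bullet> x)"
  by (cases "P = 0") (simp_all add: dilation_def inner_add_right dot_square_norm field_simps)

lemma wpost_eq: "wpost v w \<omega> = v + w - vpost v w \<omega>"
proof -
  have "(1/2) *\<^sub>R (v + w) + (1/2) *\<^sub>R (v + w) = v + w"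
    by (simp flip: scaleR_add_left)
  then show ?thesis by (simp add: wpost_def vpost_def algebra_simps)
qed

text \<open>In the centre of momentum frame the particles leave with energy
  \<open>sqrt s / 2\<close> each and momenta \<open>(g / 2) *\<^sub>R \<omega>\<close> and its
  opposite; the formulas are the boosted energies. Their sum gives the conservation of
  energy.\<close>

lemma vzero_post:
  assumes \<omega>: "norm \<omega> = 1"
  shows "vzero (vpost v w \<omega>) = (vzero v + vzero w) / 2 + relg v w / 2 * ((v + w) \<bullet> \<omega>) / sqrt (mandel_s v w)"
    and "vzero (wpost v w \<omega>) = (vzero v + vzero w) / 2 - relg v w / 2 * ((v + w) \<bullet> \<omega>) / sqrt (mandel_s v w)"
proof -
  define P E g s c where "P = v + w" "E = vzero v + vzero w" "g = relg v w" "s = mandel_s v w" "c = gam v w"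
  note defs = this
  define u where "u = dilation P c \<omega>"
  have s: "s \<ge> 4" "s = g\<^sup>2 + 4" "s = E\<^sup>2 - (norm P)\<^sup>2" "s > 0"
  proof -
    show "s \<ge> 4" by (simp add: defs mandel_s_ge_4)
    then show "s > 0" by simp
  qed (simp_all add: defs mandel_s_eq_total[symmetric], simp add: mandel_s_def)
  have r: "sqrt s > 0" "(sqrt s)\<^sup>2 = s" using s by simp_all
  have g: "g \<ge> 0" by (simp add: defs relg_nonneg)
  have E: "norm P \<le> E" using norm_less_vzero[of v] norm_less_vzero[of w] norm_triangle_ineq[of v w] by (simp add: defs)
  have Pu: "P \<bullet> u = E * (P \<bullet> \<omega>) / sqrt s"
    by (simp add: u_def inner_total_dilation) (simp add: defs gam_def)
  have uu: "u \<bullet> u = 1 + (P \<bullet> \<omega>)\<^sup>2 / s"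
  proof (cases "P = 0")
    case False
    have c2: "(c\<^sup>2 - 1) * s = (norm P)\<^sup>2" using s gam_power2[of v w] by (simp add: defs field_simps)
    have "u \<bullet> u = \<omega> \<bullet> dilation P (c\<^sup>2) \<omega>" by (simp add: u_def inner_dilation)
    also have "\<dots> = 1 + (c\<^sup>2 - 1) * (P \<bullet> \<omega>)\<^sup>2 / (norm P)\<^sup>2"
      using \<omega> by (simp add: dilation_def inner_add_right inner_commute power2_eq_square norm_eq_sqrt_inner)
    also have "(c\<^sup>2 - 1) * (P \<bullet> \<omega>)\<^sup>2 / (norm P)\<^sup>2 = (P \<bullet> \<omega>)\<^sup>2 / s"
    proof -
      have "c\<^sup>2 - 1 = (norm P)\<^sup>2 / s" using c2 s(4) by (simp add: eq_divide_eq)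
      then show ?thesis using False by simp
    qed
    finally show ?thesis .
  qed (use \<omega> in \<open>simp add: u_def dilation_def norm_eq_sqrt_inner\<close>)
  \<comment> \<open>The two signs of \<tau> treat both outgoing particles at once.\<close>
  have main: "vzero ((1/2) *\<^sub>R P + (\<tau> / 2) *\<^sub>R u) = E / 2 + \<tau> / 2 * (P \<bullet> \<omega>) / sqrt s" if \<tau>: "\<bar>\<tau>\<bar> = g" for \<tau>
    unfolding vzero_def
  proof (rule real_sqrt_unique)
    define a where "a = (P \<bullet> \<omega>) / sqrt s"
    have \<tau>2: "\<tau>\<^sup>2 = g\<^sup>2" using \<tau> by (metis power2_abs)
    have a2: "a\<^sup>2 = (P \<bullet> \<omega>)\<^sup>2 / s" using r by (simp add: a_def power_divide)
    have "(norm ((1/2) *\<^sub>R P + (\<tau> / 2) *\<^sub>R u))\<^sup>2 = (norm P)\<^sup>2 / 4 + \<tau> / 2 * (P \<bullet> u) + \<tau>\<^sup>2 / 4 * (u \<bullet> u)"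
      unfolding power2_norm_eq_inner inner_add_left inner_add_right by (simp add: inner_commute power2_eq_square)
    also have "\<dots> = (norm P)\<^sup>2 / 4 + \<tau> / 2 * (E * a) + g\<^sup>2 / 4 * (1 + a\<^sup>2)"
      unfolding Pu uu \<tau>2 a2 by (simp add: a_def)
    finally have n: "(norm ((1/2) *\<^sub>R P + (\<tau> / 2) *\<^sub>R u))\<^sup>2 = (norm P)\<^sup>2 / 4 + \<tau> / 2 * (E * a) + g\<^sup>2 / 4 * (1 + a\<^sup>2)" .
    have "(E / 2 + \<tau> / 2 * a)\<^sup>2 = E\<^sup>2 / 4 + \<tau> / 2 * (E * a) + \<tau>\<^sup>2 / 4 * a\<^sup>2"
      by (simp add: power2_eq_square algebra_simps)
    also have "\<dots> = 1 + (norm ((1/2) *\<^sub>R P + (\<tau> / 2) *\<^sub>R u))\<^sup>2"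
      unfolding n \<tau>2 using s by (simp add: field_simps)
    finally show "(E / 2 + \<tau> / 2 * (P \<bullet> \<omega>) / sqrt s)\<^sup>2 = 1 + (norm ((1/2) *\<^sub>R P + (\<tau> / 2) *\<^sub>R u))\<^sup>2"
      by (simp add: a_def)
    \<comment> \<open>The claimed energy has to be nonnegative to be the square root; this rests on
      \<open>g \<le> sqrt s\<close> and \<open>norm P \<le> E\<close>.\<close>
    have "\<bar>a\<bar> \<le> norm P / sqrt s"
      using Cauchy_Schwarz_ineq2[of P \<omega>] \<omega> r by (simp add: a_def abs_divide divide_right_mono)
    then have "g * \<bar>a\<bar> \<le> g * (norm P / sqrt s)" using g by (intro mult_left_mono)
    also have "\<dots> \<le> norm P"
    proof -
      have "g \<le> sqrt s" using s by (intro real_le_rsqrt) simp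
      then show ?thesis using r mult_right_mono[of g "sqrt s" "norm P"] by (simp add: field_simps)
    qed
    finally have "\<bar>\<tau> * a\<bar> \<le> E" using E \<tau> by (simp add: abs_mult)
    then have "0 \<le> (E + \<tau> * a) / 2" using abs_le_D2[of "\<tau> * a" E] by simp
    also have "(E + \<tau> * a) / 2 = E / 2 + \<tau> / 2 * (P \<bullet> \<omega>) / sqrt s" by (simp add: a_def add_divide_distrib)
    finally show "0 \<le> E / 2 + \<tau> / 2 * (P \<bullet> \<omega>) / sqrt s" .
  qed
  show "vzero (vpost v w \<omega>) = (vzero v + vzero w) / 2 + relg v w / 2 * ((v + w) \<bullet> \<omega>) / sqrt (mandel_s v w)"
    using main[of g] g unfolding u_def by (simp add: vpost_def boostdir_eq defs)
  show "vzero (wpost v w \<omega>) = (vzero v + vzero w) / 2 - relg v w / 2 * ((v + w) \<bullet> \<omega>) / sqrt (mandel_s v w)"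
    using main[of "- g"] g unfolding u_def by (simp add: wpost_def boostdir_eq defs)
qed

text \<open>The angle-free form of the half angle relations: the relative momenta of
  \<open>v\<close> and \<open>w\<close> to \<open>v'\<close> are \<open>g\<close> times the sine and
  the cosine of \<theta>/2. For distinct \<open>v\<close> and \<open>w\<close>, the nonnegative
  squares on the right confine \<open>cos_theta\<close> to [-1, 1], where \<open>arccos\<close> is
  meaningful.\<close>

lemma cos_theta_eq:
  assumes \<omega>: "norm \<omega> = 1"
  shows "cos_theta v w \<omega> * (relg v w)\<^sup>2 = (relg v w)\<^sup>2 - 2 * (relg v (vpost v w \<omega>))\<^sup>2"
    and "cos_theta v w \<omega> * (relg v w)\<^sup>2 = 2 * (relg w (vpost v w \<omega>))\<^sup>2 - (relg v w)\<^sup>2"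
proof -
  define v' w' where "v' = vpost v w \<omega>" "w' = wpost v w \<omega>"
  have w': "w' = v + w - v'" by (simp add: v'_w'_def wpost_eq)
  have energy: "vzero w' = vzero v + vzero w - vzero v'"
    using vzero_post[OF \<omega>, of v w] by (simp add: v'_w'_def)
  have inners: "(norm v)\<^sup>2 = v \<bullet> v" "(norm w)\<^sup>2 = w \<bullet> w" "(norm v')\<^sup>2 = v' \<bullet> v'"
    by (simp_all add: power2_norm_eq_inner)
  note sq = vzero_power2[of v, unfolded inners] vzero_power2[of w, unfolded inners] vzero_power2[of v', unfolded inners]
  \<comment> \<open>The mass shell relation of \<open>w'\<close>. Together with those of
    \<open>v\<close>, \<open>w\<close> and \<open>v'\<close> it implies both identities by
    algebra.\<close>
  have shell: "(vzero v + vzero w - vzero v')\<^sup>2 = 1 + (v \<bullet> v + w \<bullet> w + v' \<bullet> v' + 2 * (v \<bullet> w) - 2 * (v \<bullet> v') - 2 * (w \<bullet> v'))"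
    using vzero_power2[of w'] unfolding energy unfolding w' power2_norm_eq_inner
    by (simp add: inner_add_left inner_add_right inner_diff_left inner_diff_right inner_commute)
  show *: "cos_theta v w \<omega> * (relg v w)\<^sup>2 = (relg v w)\<^sup>2 - 2 * (relg v v')\<^sup>2"
    and "cos_theta v w \<omega> * (relg v w)\<^sup>2 = 2 * (relg w v')\<^sup>2 - (relg v w)\<^sup>2"
  proof -
    have i: "(v - w) \<bullet> (v' - w') = 2 * (v \<bullet> v') - 2 * (w \<bullet> v') - v \<bullet> v + w \<bullet> w"
      unfolding w' inner_diff_left inner_diff_right inner_add_right by (simp add: inner_commute)
    have num: "- (vzero v - vzero w) * (vzero v' - vzero w') + (v - w) \<bullet> (v' - w') = (relg v w)\<^sup>2 - 2 * (relg v v')\<^sup>2"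
      "(relg v w)\<^sup>2 - 2 * (relg v v')\<^sup>2 = 2 * (relg w v')\<^sup>2 - (relg v w)\<^sup>2"
      unfolding i energy relg_power2 using sq shell by algebra+
    show "cos_theta v w \<omega> * (relg v w)\<^sup>2 = (relg v w)\<^sup>2 - 2 * (relg v v')\<^sup>2"
    proof (cases "v = w")
      case True
      then have g: "relg v w = 0" by (simp add: relg_def)
      then have "v' = v" unfolding v'_w'_def vpost_def using True by (simp flip: scaleR_add_left)
      then show ?thesis using g True by simp
    next
      case False
      then have "relg v w > 0" by (rule relg_pos)
      then show ?thesis unfolding num(1)[symmetric] by (simp add: cos_theta_def v'_w'_def)
    qed
    then show "cos_theta v w \<omega> * (relg v w)\<^sup>2 = 2 * (relg w v')\<^sup>2 - (relg v w)\<^sup>2"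
      using num(2) by simp
  qed
qed

text \<open>The sine is twice the product of sine and cosine of the half angle; \<open>g\<close>
  times the former is the relative momentum of \<open>v\<close> and \<open>v'\<close>, and the
  latter is at most 1.\<close>

lemma sin_theta_le:
  assumes \<omega>: "norm \<omega> = 1"
  shows "relg v w * \<bar>sin (theta v w \<omega>)\<bar> \<le> 2 * relg v (vpost v w \<omega>)"
proof (cases "v = w")
  case True
  then show ?thesis by (simp add: relg_def[of w w] relg_nonneg)
next
  case False
  define c g g' where "c = cos_theta v w \<omega>" "g = relg v w" "g' = relg v (vpost v w \<omega>)"
  have g: "g > 0" using relg_pos[OF False] by (simp add: c_g_g'_def)
  have 1: "(1 - c) * g\<^sup>2 = 2 * g'\<^sup>2" "0 \<le> (1 + c) * g\<^sup>2"
    using cos_theta_eq[OF \<omega>, of v w] by (simp_all add: c_g_g'_def algebra_simps)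
  have "0 \<le> (1 - c) * g\<^sup>2" unfolding 1 by simp
  then have c: "\<bar>c\<bar> \<le> 1" using 1(2) g by (auto simp: zero_le_mult_iff abs_le_iff)
  have "(g * \<bar>sin (theta v w \<omega>)\<bar>)\<^sup>2 = g\<^sup>2 * (1 - c\<^sup>2)"
    using c by (simp add: theta_def c_g_g'_def(1)[symmetric] power_mult_distrib sin_arccos_abs abs_square_le_1)
  also have "\<dots> = (1 + c) * ((1 - c) * g\<^sup>2)" by (simp add: algebra_simps power2_eq_square)
  also have "\<dots> \<le> 2 * ((1 - c) * g\<^sup>2)"
    using c \<open>0 \<le> (1 - c) * g\<^sup>2\<close> by (intro mult_right_mono) auto
  also have "\<dots> = (2 * g')\<^sup>2" unfolding 1 by (simp add: power2_eq_square)
  finally show ?thesis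
    unfolding c_g_g'_def[symmetric] by (rule power2_le_imp_le) (simp add: c_g_g'_def relg_nonneg)
qed


text \<open>\<open>gs_shift v w k\<close> is the signed length of the momentum transfer, and \<open>gs_kernel v w k\<close> is \<open>moller v w\<close> times
  the Jacobian of \<open>\<omega>\<close> with respect to \<open>k\<close>.\<close>
definition gs_shift :: "vec3 \<Rightarrow> vec3 \<Rightarrow> vec3 \<Rightarrow> real" where
  "gs_shift v w k = - 2 * (vzero v + vzero w) * ((v \<bullet> k) * vzero w - (w \<bullet> k) * vzero v) /
     ((vzero v + vzero w)\<^sup>2 - ((v + w) \<bullet> k)\<^sup>2)"

definition gs_kernel :: "vec3 \<Rightarrow> vec3 \<Rightarrow> vec3 \<Rightarrow> real" where
  "gs_kernel v w k = 4 * mandel_s v w * (vzero v + vzero w)\<^sup>2 * \<bar>(v \<bullet> k) * vzero w - (w \<bullet> k) * vzero v\<bar> /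
     (vzero v * vzero w * ((vzero v + vzero w)\<^sup>2 - ((v + w) \<bullet> k)\<^sup>2)\<^sup>2)"

lemma measurable_gs_shift[measurable (raw)]:
  assumes [measurable]: "f \<in> borel_measurable M" "g \<in> borel_measurable M" "h \<in> borel_measurable M"
  shows "(\<lambda>x. gs_shift (f x) (g x) (h x)) \<in> borel_measurable M"
  unfolding gs_shift_def by measurable

lemma measurable_gs_kernel[measurable (raw)]:
  assumes [measurable]: "f \<in> borel_measurable M" "g \<in> borel_measurable M" "h \<in> borel_measurable M"
  shows "(\<lambda>x. gs_kernel (f x) (g x) (h x)) \<in> borel_measurable M"
  unfolding gs_kernel_def mandel_s_def by measurable

lemma gs_den_pos:
  assumes k: "norm k = 1"
  shows "0 < (vzero v + vzero w)\<^sup>2 - ((v + w) \<bullet> k)\<^sup>2"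
proof -
  have "\<bar>(v + w) \<bullet> k\<bar> \<le> norm v + norm w"
    using Cauchy_Schwarz_ineq2[of "v + w" k] norm_triangle_ineq[of v w] k by simp
  also have "\<dots> < vzero v + vzero w" by (intro add_strict_mono norm_less_vzero)
  finally have "\<bar>(v + w) \<bullet> k\<bar>\<^sup>2 < (vzero v + vzero w)\<^sup>2" by (intro power_strict_mono) auto
  then show ?thesis by simp
qed

text \<open>The change of variables from the centre of momentum parametrisation of the post-collisional
  momenta to that of Glassey and Strauss, in which \<open>k\<close> is the direction of momentum transfer.\<close>
lemma nn_integral_glassey_strauss:
  fixes F :: "vec3 \<Rightarrow> ennreal"
  assumes [measurable]: "F \<in> borel_measurable borel"
  shows "(\<integral>\<^sup>+\<omega>. ennreal (moller v w) * F (vpost v w \<omega>) \<partial>sphere_measure) =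
    (\<integral>\<^sup>+k. ennreal (gs_kernel v w k) * F (v + gs_shift v w k *\<^sub>R k) \<partial>sphere_measure)"
proof (cases "v = w")
  case True
  then show ?thesis by (simp add: moller_def gs_kernel_def relg_def[of w w])
next
  case False
  define P E g s c where "P = v + w" "E = vzero v + vzero w" "g = relg v w" "s = mandel_s v w" "c = gam v w"
  note defs = this
  define B where "B = dilation P (1 / c)"
  \<comment> \<open>The \<omega> for which the collision leaves \<open>v\<close> unchanged. Chords
    issuing from \<open>n\<close> are therefore the momentum transfers, up to the boost and the
    factor \<open>g / 2\<close>.\<close>
  define n where "n = (1 / g) *\<^sub>R B (v - w)"
  have g: "g > 0" using relg_pos[OF False] by (simp add: defs)
  have c: "c > 0" "P = 0 \<Longrightarrow> c = 1" using gam_pos[of v w] gam_eq_1[of v w] by (simp_all add: defs)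
  have s: "s > 0" using mandel_s_ge_4[of v w] by (simp add: defs)
  have sP: "s = E\<^sup>2 - (norm P)\<^sup>2" by (simp add: defs mandel_s_eq_total)
  have E: "E > 0" using vzero_pos[of v] vzero_pos[of w] by (simp add: defs)
  \<comment> \<open>The inverse square of \<open>c\<close> is one minus the squared velocity of the
    centre of momentum, so the dilation merely subtracts a rank-one term, which makes sense for
    \<open>P = 0\<close> as well.\<close>
  have B2: "x \<bullet> dilation P ((1 / c)\<^sup>2) y = x \<bullet> y - (P \<bullet> x) * (P \<bullet> y) / E\<^sup>2" for x y
  proof (cases "P = 0")
    case False
    have "(1 / c)\<^sup>2 = s / E\<^sup>2" using gam_power2[of v w] by (simp add: defs power_one_over)
    then have "(1 / c)\<^sup>2 - 1 = - ((norm P)\<^sup>2 / E\<^sup>2)" using E sP by (simp add: field_simps)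
    then have "x \<bullet> dilation P ((1 / c)\<^sup>2) y = x \<bullet> y + (- ((norm P)\<^sup>2 / E\<^sup>2) * (P \<bullet> y) / (norm P)\<^sup>2) * (x \<bullet> P)"
      by (simp only: dilation_def inner_add_right inner_scaleR_right)
    then show ?thesis using False E by (simp add: field_simps inner_commute)
  qed (simp add: dilation_def)
  have vw: "P \<bullet> (v - w) = (vzero v)\<^sup>2 - (vzero w)\<^sup>2"
    unfolding vzero_power2 power2_norm_eq_inner defs(1) inner_add_left inner_diff_right by (simp add: inner_commute)
  have BB: "B (v - w) \<bullet> B k = 2 * ((v \<bullet> k) * vzero w - (w \<bullet> k) * vzero v) / E" for k
  proof -
    have "B (v - w) \<bullet> B k = (v - w) \<bullet> k - ((vzero v)\<^sup>2 - (vzero w)\<^sup>2) * (P \<bullet> k) / E\<^sup>2"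
      unfolding B_def inner_dilation B2 vw ..
    also have "((vzero v)\<^sup>2 - (vzero w)\<^sup>2) * (P \<bullet> k) / E\<^sup>2 = (vzero v - vzero w) * (P \<bullet> k) / E"
      using E by (simp add: defs(2) power2_eq_square square_diff_square_factored)
    also have "(v - w) \<bullet> k - (vzero v - vzero w) * (P \<bullet> k) / E = 2 * ((v \<bullet> k) * vzero w - (w \<bullet> k) * vzero v) / E"
      using E by (simp add: field_simps) (simp add: defs inner_add_left inner_diff_left algebra_simps)
    finally show ?thesis .
  qed
  have nB: "(norm (B k))\<^sup>2 = (E\<^sup>2 - (P \<bullet> k)\<^sup>2) / E\<^sup>2" if "norm k = 1" for k
    using that E unfolding power2_norm_eq_inner B_def inner_dilation B2
    by (simp add: field_simps power2_eq_square norm_eq_sqrt_inner)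
  have n: "norm n = 1"
  proof -
    have "(norm (B (v - w)))\<^sup>2 = (norm (v - w))\<^sup>2 - (P \<bullet> (v - w))\<^sup>2 / E\<^sup>2"
      unfolding power2_norm_eq_inner B_def inner_dilation B2 by (simp add: power2_eq_square)
    also have "(P \<bullet> (v - w))\<^sup>2 / E\<^sup>2 = (vzero v - vzero w)\<^sup>2"
      unfolding vw using E by (simp add: defs(2) power2_eq_square square_diff_square_factored)
    also have "(norm (v - w))\<^sup>2 - (vzero v - vzero w)\<^sup>2 = g\<^sup>2"
      unfolding defs(3) relg_power2 norm_diff_power2 power2_diff vzero_power2 by simp
    finally have "norm (B (v - w)) = g" using g by (simp add: power2_eq_iff_nonneg)
    then show ?thesis using g by (simp add: n_def)
  qed
  have An: "(1/2) *\<^sub>R P + (g/2) *\<^sub>R dilation P c n = v"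
  proof -
    interpret A: linear "dilation P c" by (rule linear_dilation)
    have "dilation P c n = (1/g) *\<^sub>R (v - w)"
      unfolding n_def A.scaleR B_def dilation_dilation using c by simp
    then have "(1/2) *\<^sub>R P + (g/2) *\<^sub>R dilation P c n = (1/2) *\<^sub>R (v + w) + (1/2) *\<^sub>R (v - w)"
      using g by (simp add: defs)
    also have "\<dots> = (1/2 + 1/2) *\<^sub>R v" by (simp only: scaleR_add_left scaleR_add_right scaleR_diff_right) simp
    finally show ?thesis by simp
  qed
  have "(\<integral>\<^sup>+\<omega>. ennreal (moller v w) * F (vpost v w \<omega>) \<partial>sphere_measure) =
    ennreal (moller v w) * (\<integral>\<^sup>+\<omega>. F ((1/2) *\<^sub>R P + (g/2) *\<^sub>R dilation P c \<omega>) \<partial>sphere_measure)"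
    unfolding vpost_def boostdir_eq defs by (rule nn_integral_cmult) (simp add: dilation_def)
  also have "(\<integral>\<^sup>+\<omega>. F ((1/2) *\<^sub>R P + (g/2) *\<^sub>R dilation P c \<omega>) \<partial>sphere_measure) =
    (\<integral>\<^sup>+k. ennreal (2 * \<bar>n \<bullet> B k\<bar> / (c * norm (B k) ^ 4)) *
      F ((1/2) *\<^sub>R P + (g/2) *\<^sub>R (dilation P c n - (2 * (n \<bullet> B k) / (norm (B k))\<^sup>2) *\<^sub>R k)) \<partial>sphere_measure)"
    unfolding B_def by (rule nn_integral_sphere_chords[where F = "\<lambda>x. F ((1/2) *\<^sub>R P + (g/2) *\<^sub>R x)"])
      (use n c in \<open>auto\<close>)
  also have "ennreal (moller v w) * \<dots> = (\<integral>\<^sup>+k. ennreal (moller v w) * (ennreal (2 * \<bar>n \<bullet> B k\<bar> / (c * norm (B k) ^ 4)) *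
      F ((1/2) *\<^sub>R P + (g/2) *\<^sub>R (dilation P c n - (2 * (n \<bullet> B k) / (norm (B k))\<^sup>2) *\<^sub>R k))) \<partial>sphere_measure)"
    by (rule nn_integral_cmult[symmetric]) (simp add: dilation_def B_def)
  also have "\<dots> = (\<integral>\<^sup>+k. ennreal (gs_kernel v w k) * F (v + gs_shift v w k *\<^sub>R k) \<partial>sphere_measure)"
  proof (rule nn_integral_sphere_cong)
    fix k :: vec3 assume k: "norm k = 1"
    define D den where "D = (v \<bullet> k) * vzero w - (w \<bullet> k) * vzero v" "den = E\<^sup>2 - (P \<bullet> k)\<^sup>2"
    have den: "den > 0" using gs_den_pos[OF k, of v w] by (simp add: D_den_def defs)
    have nb: "n \<bullet> B k = 2 * D / (g * E)" by (simp add: n_def BB D_den_def)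
    have nB2: "(norm (B k))\<^sup>2 = den / E\<^sup>2" using nB[OF k] by (simp add: D_den_def)
    have nB4: "norm (B k) ^ 4 = (den / E\<^sup>2)\<^sup>2"
      using nB2 by (metis numeral_times_numeral power_mult semiring_norm(11) semiring_norm(13))
    have sh: "(g/2) * (2 * (n \<bullet> B k) / (norm (B k))\<^sup>2) = - gs_shift v w k"
    proof -
      have "gs_shift v w k = - 2 * E * D / den" by (simp add: gs_shift_def D_den_def defs)
      then show ?thesis unfolding nb nB2 using g E den by (simp add: field_simps power2_eq_square)
    qed
    have 1: "(1/2) *\<^sub>R P + (g/2) *\<^sub>R (dilation P c n - (2 * (n \<bullet> B k) / (norm (B k))\<^sup>2) *\<^sub>R k) = v + gs_shift v w k *\<^sub>R k"
    proof -
      have "(1/2) *\<^sub>R P + (g/2) *\<^sub>R (dilation P c n - (2 * (n \<bullet> B k) / (norm (B k))\<^sup>2) *\<^sub>R k) =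
        ((1/2) *\<^sub>R P + (g/2) *\<^sub>R dilation P c n) - ((g/2) * (2 * (n \<bullet> B k) / (norm (B k))\<^sup>2)) *\<^sub>R k"
        by (simp only: scaleR_diff_right scaleR_scaleR add_diff_eq)
      then show ?thesis unfolding An sh by simp
    qed
    \<comment> \<open>\<open>1 / c\<close> supplies a second factor \<open>sqrt s\<close>, hence the
      full \<open>mandel_s\<close> in \<open>gs_kernel\<close>; the factor \<open>g\<close> of
      \<open>moller\<close> cancels the normalisation of \<open>n\<close>.\<close>
    have ker: "moller v w * (2 * \<bar>n \<bullet> B k\<bar> / (c * norm (B k) ^ 4)) = gs_kernel v w k"
    proof -
      have r: "sqrt s > 0" "sqrt s * sqrt s = s" using s by simp_all
      have cE: "c = E / sqrt s" by (simp add: defs gam_def)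
      have m: "moller v w = g * sqrt s / (vzero v * vzero w)" by (simp add: defs moller_def)
      have "moller v w * (2 * \<bar>n \<bullet> B k\<bar> / (c * norm (B k) ^ 4)) =
        4 * (sqrt s * sqrt s) * E\<^sup>2 * \<bar>D\<bar> / (vzero v * vzero w * den\<^sup>2)"
        unfolding m nb nB4 cE using g E den r(1) vzero_pos[of v] vzero_pos[of w]
        by (simp add: abs_mult abs_divide field_simps power2_eq_square)
      then show ?thesis unfolding r by (simp add: gs_kernel_def defs D_den_def)
    qed
    have "ennreal (moller v w) * ennreal (2 * \<bar>n \<bullet> B k\<bar> / (c * norm (B k) ^ 4)) = ennreal (gs_kernel v w k)"
      unfolding ker[symmetric] using c
      by (intro ennreal_mult[symmetric]) (auto simp: moller_def relg_nonneg vzero_pos less_imp_le mandel_s_ge_4 order_trans[OF _ mandel_s_ge_4])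
    then show "ennreal (moller v w) * (ennreal (2 * \<bar>n \<bullet> B k\<bar> / (c * norm (B k) ^ 4)) *
      F ((1/2) *\<^sub>R P + (g/2) *\<^sub>R (dilation P c n - (2 * (n \<bullet> B k) / (norm (B k))\<^sup>2) *\<^sub>R k))) =
      ennreal (gs_kernel v w k) * F (v + gs_shift v w k *\<^sub>R k)"
      unfolding 1 by (simp only: mult.assoc[symmetric])
  qed
  finally show ?thesis .
qed

section \<open>Slicing the space along the direction of momentum transfer\<close>

lemma nn_integral_along_line:
  fixes k :: vec3
  assumes k: "norm k = 1"
  obtains e :: "real \<Rightarrow> real \<Rightarrow> vec3" where "\<And>a b. e a b \<bullet> k = 0" "\<And>a b. (norm (e a b))\<^sup>2 = a\<^sup>2 + b\<^sup>2"
    "(\<lambda>(a, b). e a b) \<in> borel_measurable (borel \<Otimes>\<^sub>M borel)"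
    "\<And>G :: vec3 \<Rightarrow> ennreal. G \<in> borel_measurable borel \<Longrightarrow>
      (\<integral>\<^sup>+w. G w \<partial>lborel) = (\<integral>\<^sup>+a. \<integral>\<^sup>+b. \<integral>\<^sup>+z. G (e a b + z *\<^sub>R k) \<partial>lborel \<partial>lborel \<partial>lborel)"
proof -
  obtain R :: "vec3 \<Rightarrow> vec3" where R: "orthogonal_transformation R" and Rk: "R (axis 3 1) = k"
    using orthogonal_transformation_exists_1[of "axis 3 1 :: vec3" k] k by auto
  interpret R: linear R using R by (rule orthogonal_transformation_linear)
  have [measurable]: "R \<in> borel_measurable borel"
    by (simp add: borel_measurable_continuous_onI linear_continuous_on linear_linear R.linear_axioms)
  define e where "e a b = R (vector [a, b, 0])" for a b
  have "e a b \<bullet> k = 0" for a b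
  proof -
    have "e a b \<bullet> k = vector [a, b, 0] \<bullet> (axis 3 1 :: vec3)"
      using R unfolding e_def Rk[symmetric] orthogonal_transformation_def by blast
    then show ?thesis by (simp add: inner_axis)
  qed
  moreover have "(norm (e a b))\<^sup>2 = a\<^sup>2 + b\<^sup>2" for a b
    using norm_vector_3[of a b 0] orthogonal_transformation_norm[OF R] by (simp add: e_def)
  moreover have "(\<lambda>(a, b). e a b) \<in> borel_measurable (borel \<Otimes>\<^sub>M borel)"
    unfolding e_def by measurable
  moreover have "(\<integral>\<^sup>+w. G w \<partial>lborel) = (\<integral>\<^sup>+a. \<integral>\<^sup>+b. \<integral>\<^sup>+z. G (e a b + z *\<^sub>R k) \<partial>lborel \<partial>lborel \<partial>lborel)"
    if [measurable]: "G \<in> borel_measurable borel" for G :: "vec3 \<Rightarrow> ennreal"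
  proof -
    have "R (vector [a, b, z]) = e a b + z *\<^sub>R k" for a b z
    proof -
      have "vector [a, b, z] = vector [a, b, 0] + z *\<^sub>R (axis 3 1 :: vec3)"
        by (simp add: vec_eq_iff forall_3 axis_def)
      then show ?thesis by (simp add: R.add R.scaleR Rk e_def)
    qed
    moreover have "(\<integral>\<^sup>+w. G w \<partial>lborel) = (\<integral>\<^sup>+w. G (R w) \<partial>lborel)"
      by (rule nn_integral_orthogonal[OF R, symmetric]) measurable
    moreover have "(\<integral>\<^sup>+w. G (R w) \<partial>lborel) = (\<integral>\<^sup>+a. \<integral>\<^sup>+b. \<integral>\<^sup>+z. G (R (vector [a, b, z])) \<partial>lborel \<partial>lborel \<partial>lborel)"
      by (rule nn_integral_vec3) measurable
    ultimately show ?thesis by simp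
  qed
  ultimately show thesis by (rule that)
qed

context
  fixes k :: vec3
  assumes k: "norm k = 1"
begin

lemma inner_line: "e \<bullet> k = 0 \<Longrightarrow> (e + x *\<^sub>R k) \<bullet> k = x"
  using k by (simp add: inner_add_left dot_square_norm)

lemma vzero_line:
  assumes "e \<bullet> k = 0"
  shows "vzero (e + x *\<^sub>R k) = en (1 + (norm e)\<^sup>2) x"
proof -
  have "(norm (e + x *\<^sub>R k))\<^sup>2 = (norm e)\<^sup>2 + x\<^sup>2"
    using k assms by (simp add: norm_add_power2 power_mult_distrib)
  then show ?thesis by (simp add: vzero_def en_def add.assoc)
qed

text \<open>The energy depends on the transverse part only through its norm, that is, through the
  squared transverse mass. This reduces the collision along \<open>k\<close> to one on a
  line.\<close>

lemma gs_shift_line: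
  assumes "d \<bullet> k = 0" "e \<bullet> k = 0"
  shows "gs_shift (d + x *\<^sub>R k) (e + z *\<^sub>R k) k = line_shift (1 + (norm d)\<^sup>2) (1 + (norm e)\<^sup>2) x z"
  unfolding gs_shift_def inner_add_left[of "d + x *\<^sub>R k"] inner_line[OF assms(1)] inner_line[OF assms(2)]
    vzero_line[OF assms(1)] vzero_line[OF assms(2)] line_shift_def ..

lemma decompose_line:
  obtains d where "d \<bullet> k = 0" "v = d + (v \<bullet> k) *\<^sub>R k"
proof
  show "(v - (v \<bullet> k) *\<^sub>R k) \<bullet> k = 0"
    using k by (simp add: inner_diff_left dot_square_norm)
qed simp

lemma gs_energy: "vzero (v + gs_shift v w k *\<^sub>R k) + vzero (w - gs_shift v w k *\<^sub>R k) = vzero v + vzero w"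
proof -
  obtain d where d: "d \<bullet> k = 0" "v = d + (v \<bullet> k) *\<^sub>R k" by (rule decompose_line)
  obtain e where e: "e \<bullet> k = 0" "w = e + (w \<bullet> k) *\<^sub>R k" by (rule decompose_line)
  define x z where "x = v \<bullet> k" "z = w \<bullet> k"
  have v: "v = d + x *\<^sub>R k" and w: "w = e + z *\<^sub>R k" using d e by (simp_all add: x_z_def)
  define \<tau> where "\<tau> = gs_shift v w k"
  have sh: "v + \<tau> *\<^sub>R k = d + (x + \<tau>) *\<^sub>R k" "w - \<tau> *\<^sub>R k = e + (z - \<tau>) *\<^sub>R k"
    by (simp_all add: v w algebra_simps)
  have \<tau>: "\<tau> = line_shift (1 + (norm d)\<^sup>2) (1 + (norm e)\<^sup>2) x z"
    unfolding \<tau>_def v w by (rule gs_shift_line[OF d(1) e(1)])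
  show ?thesis
    unfolding \<tau>_def[symmetric] sh unfolding v w vzero_line[OF d(1)] vzero_line[OF e(1)] \<tau>
    by (rule line_shift_energy) auto
qed

lemma gs_mandel_s: "mandel_s (v + gs_shift v w k *\<^sub>R k) (w - gs_shift v w k *\<^sub>R k) = mandel_s v w"
  unfolding mandel_s_eq_total gs_energy by simp

lemma gs_relg: "relg (v + gs_shift v w k *\<^sub>R k) (w - gs_shift v w k *\<^sub>R k) = relg v w"
  using gs_mandel_s[of v w] relg_nonneg by (simp add: mandel_s_def power2_eq_iff_nonneg)

text \<open>By invariance \<open>mandel_s v w\<close> is at most four times the product of the
  energies of \<open>v'\<close> and \<open>w'\<close>, whence 16 = 4 * 4. The energy of
  \<open>v'\<close> matches the one in the Jacobian of the substitution by the transfer; the energy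
  of \<open>w'\<close> raises the exponent from \<open>- \<eta>\<close> to
  \<open>1 - \<eta>\<close>. The square root is the relative momentum of \<open>v\<close> and
  \<open>v'\<close>, as \<open>v' - v\<close> is a multiple of \<open>k\<close>.\<close>

lemma gs_kernel_bound:
  defines "t \<equiv> \<lambda>v w. gs_shift v w k"
  shows "gs_kernel v w k * (relg v (v + t v w *\<^sub>R k) * vzero (w - t v w *\<^sub>R k) powr (- \<eta>)) \<le>
    16 * vzero (v + t v w *\<^sub>R k) * vzero (w - t v w *\<^sub>R k) powr (1 - \<eta>) * (vzero v + vzero w)\<^sup>2 * \<bar>(v \<bullet> k) * vzero w - (w \<bullet> k) * vzero v\<bar> /
      (vzero v * vzero w * ((vzero v + vzero w)\<^sup>2 - ((v + w) \<bullet> k)\<^sup>2)\<^sup>2) *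
      sqrt ((t v w)\<^sup>2 - (vzero (v + t v w *\<^sub>R k) - vzero v)\<^sup>2)"
proof -
  define v' w' where "v' = v + t v w *\<^sub>R k" "w' = w - t v w *\<^sub>R k"
  define Z where "Z = (vzero v + vzero w)\<^sup>2 * \<bar>(v \<bullet> k) * vzero w - (w \<bullet> k) * vzero v\<bar> /
      (vzero v * vzero w * ((vzero v + vzero w)\<^sup>2 - ((v + w) \<bullet> k)\<^sup>2)\<^sup>2)"
  have Z: "Z \<ge> 0" unfolding Z_def using vzero_pos[of v] vzero_pos[of w] by (intro divide_nonneg_nonneg mult_nonneg_nonneg) auto
  have "relg v v' = sqrt ((t v w)\<^sup>2 - (vzero v' - vzero v)\<^sup>2)"
    using k by (simp add: relg_def v'_w'_def power2_commute)
  moreover have "mandel_s v w \<le> 4 * (vzero v' * vzero w')"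
    using mandel_s_le[of v' w'] gs_mandel_s[of v w] by (simp add: v'_w'_def t_def)
  moreover have "vzero w' powr (1 - \<eta>) = vzero w' * vzero w' powr (- \<eta>)"
    using vzero_pos[of w'] by (simp add: powr_diff powr_minus divide_inverse)
  moreover have "4 * mandel_s v w * (Z * (relg v v' * vzero w' powr (- \<eta>))) \<le> 4 * (4 * (vzero v' * vzero w')) * (Z * (relg v v' * vzero w' powr (- \<eta>)))"
    using calculation(2) Z relg_nonneg[of v v'] by (intro mult_right_mono) auto
  ultimately show ?thesis
    unfolding v'_w'_def[symmetric] gs_kernel_def by (simp add: Z_def mult_ac)
qed

text \<open>For each transverse part of \<open>w\<close> the one-dimensional estimate applies. Its
  bound is a function of that part times an integral over \<open>t\<close> independent of it, hence
  the product.\<close>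

lemma nn_integral_carleman_line:
  fixes f :: "vec3 \<Rightarrow> ennreal"
  assumes \<eta>: "\<eta> \<ge> 1" and [measurable]: "f \<in> borel_measurable borel"
  shows "(\<integral>\<^sup>+w. ennreal (gs_kernel v w k * (relg v (v + gs_shift v w k *\<^sub>R k) * vzero (w - gs_shift v w k *\<^sub>R k) powr (- \<eta>))) *
      f (v + gs_shift v w k *\<^sub>R k) \<partial>lborel) \<le>
    (\<integral>\<^sup>+a. \<integral>\<^sup>+b. ennreal (sqrt (1 + a\<^sup>2 + b\<^sup>2) powr (- \<eta>)) \<partial>lborel \<partial>lborel) * (\<integral>\<^sup>+t. ennreal (4 * t\<^sup>2) * f (v + t *\<^sub>R k) \<partial>lborel)"
    (is "?L \<le> ?J * ?I")
proof -
  obtain d where d: "d \<bullet> k = 0" "v = d + (v \<bullet> k) *\<^sub>R k" by (rule decompose_line)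
  define x where "x = v \<bullet> k"
  have v: "v = d + x *\<^sub>R k" using d by (simp add: x_def)
  obtain e where e: "\<And>a b. e a b \<bullet> k = 0" "\<And>a b. (norm (e a b))\<^sup>2 = a\<^sup>2 + b\<^sup>2"
    and [measurable]: "(\<lambda>(a, b). e a b) \<in> borel_measurable (borel \<Otimes>\<^sub>M borel)"
    and int: "\<And>G :: vec3 \<Rightarrow> ennreal. G \<in> borel_measurable borel \<Longrightarrow>
      (\<integral>\<^sup>+w. G w \<partial>lborel) = (\<integral>\<^sup>+a. \<integral>\<^sup>+b. \<integral>\<^sup>+z. G (e a b + z *\<^sub>R k) \<partial>lborel \<partial>lborel \<partial>lborel)"
    using nn_integral_along_line[OF k] by blast
  define \<Gamma> where "\<Gamma> w = ennreal (gs_kernel v w k * (relg v (v + gs_shift v w k *\<^sub>R k) * vzero (w - gs_shift v w k *\<^sub>R k) powr (- \<eta>))) *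
      f (v + gs_shift v w k *\<^sub>R k)" for w
  have [measurable]: "\<Gamma> \<in> borel_measurable borel" unfolding \<Gamma>_def by measurable
  have inner: "(\<integral>\<^sup>+z. \<Gamma> (e a b + z *\<^sub>R k) \<partial>lborel) \<le> ennreal (sqrt (1 + a\<^sup>2 + b\<^sup>2) powr (- \<eta>)) * ?I" for a b
  proof -
    define A B where "A = 1 + (norm d)\<^sup>2" "B = 1 + a\<^sup>2 + b\<^sup>2"
    have AB: "A \<ge> 1" "B \<ge> 1" by (simp_all add: A_B_def)
    have Be: "1 + (norm (e a b))\<^sup>2 = B" by (simp add: e A_B_def)
    define t where "t z = line_shift A B x z" for z
    have "\<Gamma> (e a b + z *\<^sub>R k) \<le> ennreal (16 * en A (x + t z) * en B (z - t z) powr (1 - \<eta>) * (en A x + en B z)\<^sup>2 * \<bar>x * en B z - z * en A x\<bar> /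
      (en A x * en B z * ((en A x + en B z)\<^sup>2 - (x + z)\<^sup>2)\<^sup>2) * sqrt ((t z)\<^sup>2 - (en A (x + t z) - en A x)\<^sup>2)) * f (v + t z *\<^sub>R k)" for z
    proof -
      define w where "w = e a b + z *\<^sub>R k"
      have sh: "gs_shift v w k = t z"
        unfolding v w_def t_def Be[symmetric] A_B_def(1) by (rule gs_shift_line[OF d(1) e(1)])
      have eq: "v + t z *\<^sub>R k = d + (x + t z) *\<^sub>R k" "w - t z *\<^sub>R k = e a b + (z - t z) *\<^sub>R k"
        unfolding v w_def by (simp_all add: algebra_simps)
      have en: "vzero (v + t z *\<^sub>R k) = en A (x + t z)" "vzero (w - t z *\<^sub>R k) = en B (z - t z)"
        "vzero v = en A x" "vzero w = en B z"
        unfolding eq unfolding v w_def vzero_line[OF d(1)] vzero_line[OF e(1)] Be A_B_def(1) by simp_all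
      have ik: "v \<bullet> k = x" "w \<bullet> k = z"
        unfolding v w_def using inner_line[OF d(1)] inner_line[OF e(1)[of a b]] by simp_all
      have "gs_kernel v w k * (relg v (v + t z *\<^sub>R k) * vzero (w - t z *\<^sub>R k) powr (- \<eta>)) \<le>
        16 * en A (x + t z) * en B (z - t z) powr (1 - \<eta>) * (en A x + en B z)\<^sup>2 * \<bar>x * en B z - z * en A x\<bar> /
      (en A x * en B z * ((en A x + en B z)\<^sup>2 - (x + z)\<^sup>2)\<^sup>2) * sqrt ((t z)\<^sup>2 - (en A (x + t z) - en A x)\<^sup>2)"
        using gs_kernel_bound[of v w \<eta>] unfolding sh en inner_add_left ik .
      then show ?thesis
        unfolding \<Gamma>_def w_def[symmetric] sh by (intro mult_right_mono ennreal_leI) auto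
    qed
    then have "(\<integral>\<^sup>+z. \<Gamma> (e a b + z *\<^sub>R k) \<partial>lborel) \<le> (\<integral>\<^sup>+z. ennreal (16 * en A (x + t z) * en B (z - t z) powr (1 - \<eta>) * (en A x + en B z)\<^sup>2 * \<bar>x * en B z - z * en A x\<bar> /
      (en A x * en B z * ((en A x + en B z)\<^sup>2 - (x + z)\<^sup>2)\<^sup>2) * sqrt ((t z)\<^sup>2 - (en A (x + t z) - en A x)\<^sup>2)) * f (v + t z *\<^sub>R k) \<partial>lborel)"
      by (intro nn_integral_mono)
    also have "\<dots> \<le> (\<integral>\<^sup>+t. ennreal (4 * sqrt B powr (- \<eta>) * t\<^sup>2) * f (v + t *\<^sub>R k) \<partial>lborel)"
      unfolding t_def by (rule nn_integral_line_carleman[OF AB \<eta>, where G = "\<lambda>t. f (v + t *\<^sub>R k)"]) measurable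
    also have "\<dots> = (\<integral>\<^sup>+t. ennreal (sqrt B powr (- \<eta>)) * (ennreal (4 * t\<^sup>2) * f (v + t *\<^sub>R k)) \<partial>lborel)"
    proof (rule nn_integral_cong)
      fix t :: real
      have "ennreal (4 * sqrt B powr (- \<eta>) * t\<^sup>2) = ennreal (sqrt B powr (- \<eta>)) * ennreal (4 * t\<^sup>2)"
        by (subst ennreal_mult[symmetric]) (auto simp: mult_ac)
      then show "ennreal (4 * sqrt B powr (- \<eta>) * t\<^sup>2) * f (v + t *\<^sub>R k) = ennreal (sqrt B powr (- \<eta>)) * (ennreal (4 * t\<^sup>2) * f (v + t *\<^sub>R k))"
        by (simp only: mult.assoc)
    qed
    also have "\<dots> = ennreal (sqrt B powr (- \<eta>)) * ?I"
      by (rule nn_integral_cmult) measurable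
    finally show ?thesis unfolding A_B_def(2) .
  qed
  have "?L = (\<integral>\<^sup>+a. \<integral>\<^sup>+b. \<integral>\<^sup>+z. \<Gamma> (e a b + z *\<^sub>R k) \<partial>lborel \<partial>lborel \<partial>lborel)"
    unfolding \<Gamma>_def[symmetric] by (rule int) measurable
  also have "\<dots> \<le> (\<integral>\<^sup>+a. \<integral>\<^sup>+b. ennreal (sqrt (1 + a\<^sup>2 + b\<^sup>2) powr (- \<eta>)) * ?I \<partial>lborel \<partial>lborel)"
    by (intro nn_integral_mono inner)
  also have "\<dots> = ?J * ?I"
    by (simp add: nn_integral_multc)
  finally show ?thesis .
qed

text \<open>The transfer along \<open>k\<close> keeps the transverse parts of \<open>v\<close> and
  \<open>P - v\<close>, so the one-dimensional invariance holds on each line parallel to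
  \<open>k\<close>.\<close>

lemma nn_integral_involution:
  fixes G :: "vec3 \<Rightarrow> ennreal"
  assumes [measurable]: "G \<in> borel_measurable borel"
  shows "(\<integral>\<^sup>+v. ennreal \<bar>(v \<bullet> k) / vzero v - ((P - v) \<bullet> k) / vzero (P - v)\<bar> * G (v + gs_shift v (P - v) k *\<^sub>R k) \<partial>lborel) =
    (\<integral>\<^sup>+v. ennreal \<bar>(v \<bullet> k) / vzero v - ((P - v) \<bullet> k) / vzero (P - v)\<bar> * G v \<partial>lborel)"
proof -
  obtain d where d: "d \<bullet> k = 0" "P = d + (P \<bullet> k) *\<^sub>R k" by (rule decompose_line)
  define \<pi> where "\<pi> = P \<bullet> k"
  have P: "P = d + \<pi> *\<^sub>R k" using d by (simp add: \<pi>_def)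
  obtain e where e: "\<And>a b. e a b \<bullet> k = 0" "\<And>a b. (norm (e a b))\<^sup>2 = a\<^sup>2 + b\<^sup>2"
    and [measurable]: "(\<lambda>(a, b). e a b) \<in> borel_measurable (borel \<Otimes>\<^sub>M borel)"
    and int: "\<And>G :: vec3 \<Rightarrow> ennreal. G \<in> borel_measurable borel \<Longrightarrow>
      (\<integral>\<^sup>+w. G w \<partial>lborel) = (\<integral>\<^sup>+a. \<integral>\<^sup>+b. \<integral>\<^sup>+z. G (e a b + z *\<^sub>R k) \<partial>lborel \<partial>lborel \<partial>lborel)"
    using nn_integral_along_line[OF k] by blast
  define \<Delta> where "\<Delta> v = ennreal \<bar>(v \<bullet> k) / vzero v - ((P - v) \<bullet> k) / vzero (P - v)\<bar>" for v
  have [measurable]: "\<Delta> \<in> borel_measurable borel" unfolding \<Delta>_def by measurable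
  have "(\<integral>\<^sup>+z. \<Delta> (e a b + z *\<^sub>R k) * G (e a b + z *\<^sub>R k + gs_shift (e a b + z *\<^sub>R k) (P - (e a b + z *\<^sub>R k)) k *\<^sub>R k) \<partial>lborel) =
    (\<integral>\<^sup>+z. \<Delta> (e a b + z *\<^sub>R k) * G (e a b + z *\<^sub>R k) \<partial>lborel)" for a b
  proof -
    define A B where "A = 1 + (norm (e a b))\<^sup>2" "B = 1 + (norm (d - e a b))\<^sup>2"
    have AB: "A \<ge> 1" "B \<ge> 1" by (simp_all add: A_B_def)
    have de: "(d - e a b) \<bullet> k = 0" using d(1) e(1) by (simp add: inner_diff_left)
    have Pv: "P - (e a b + z *\<^sub>R k) = (d - e a b) + (\<pi> - z) *\<^sub>R k" for z
      unfolding P by (simp add: algebra_simps)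
    have \<Delta>: "\<Delta> (e a b + z *\<^sub>R k) = ennreal \<bar>z / en A z - (\<pi> - z) / en B (\<pi> - z)\<bar>" for z
      unfolding \<Delta>_def Pv inner_line[OF e(1)] inner_line[OF de] vzero_line[OF e(1)] vzero_line[OF de] A_B_def ..
    have sh: "e a b + z *\<^sub>R k + gs_shift (e a b + z *\<^sub>R k) (P - (e a b + z *\<^sub>R k)) k *\<^sub>R k = e a b + (z + line_shift A B z (\<pi> - z)) *\<^sub>R k" for z
      unfolding Pv gs_shift_line[OF e(1) de] A_B_def[symmetric] by (simp add: algebra_simps)
    show ?thesis
      unfolding sh \<Delta> by (rule nn_integral_line_involution[OF AB, where G = "\<lambda>z. G (e a b + z *\<^sub>R k)"]) measurable
  qed
  then show ?thesis
    unfolding \<Delta>_def[symmetric] by (simp add: int[of "\<lambda>v. \<Delta> v * G (v + gs_shift v (P - v) k *\<^sub>R k)"] int[of "\<lambda>v. \<Delta> v * G v"])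
qed

end

section \<open>Estimates of the gain term\<close>

lemma nn_integral_bracket_powr_finite:
  fixes q :: real
  assumes q: "q > 1/2"
  shows "(\<integral>\<^sup>+x. ennreal ((1 + x\<^sup>2) powr (- q)) \<partial>lborel) < \<infinity>"
proof -
  define T where "T = (\<lambda>x :: real. ennreal (x powr (- 2 * q)) * indicator {1..} x)"
  have [measurable]: "T \<in> borel_measurable borel" unfolding T_def by measurable
  have "(\<integral>\<^sup>+x. T x \<partial>lborel) = ennreal (-(1 powr (- 2 * q + 1)) / (- 2 * q + 1))"
    unfolding T_def using q by (intro nn_integral_has_integral_lebesgue' has_integral_powr_to_inf) auto
  then have T: "(\<integral>\<^sup>+x. T x \<partial>lborel) < \<infinity>" by simp
  have T': "(\<integral>\<^sup>+x. T (- x) \<partial>lborel) = (\<integral>\<^sup>+x. T x \<partial>lborel)"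
    using nn_integral_real_affine[of T "-1" 0] by simp
  have tail: "(1 + x\<^sup>2) powr (- q) \<le> \<bar>x\<bar> powr (- 2 * q)" if "\<bar>x\<bar> \<ge> 1" for x :: real
  proof -
    have e: "x\<^sup>2 = \<bar>x\<bar> powr 2" using that by simp
    have "(1 + x\<^sup>2) powr (- q) \<le> (x\<^sup>2) powr (- q)"
      using q that by (intro powr_mono2') auto
    also have "\<dots> = \<bar>x\<bar> powr (- 2 * q)" unfolding e powr_powr by simp
    finally show ?thesis .
  qed
  have "(\<integral>\<^sup>+x. ennreal ((1 + x\<^sup>2) powr (- q)) \<partial>lborel) \<le> (\<integral>\<^sup>+x. indicator {-1..1::real} x + (T x + T (- x)) \<partial>lborel)"
  proof (rule nn_integral_mono)
    fix x :: real
    consider "\<bar>x\<bar> \<le> 1" | "x > 1" | "x < - 1" by linarith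
    then show "ennreal ((1 + x\<^sup>2) powr (- q)) \<le> indicator {-1..1::real} x + (T x + T (- x))"
    proof cases
      case 1
      have "(1 + x\<^sup>2) powr (- q) \<le> 1 powr (- q)" using q by (intro powr_mono2') auto
      then have "ennreal ((1 + x\<^sup>2) powr (- q)) \<le> 1" by simp
      also have "\<dots> \<le> indicator {-1..1::real} x + (T x + T (- x))" using 1 by (simp add: indicator_def abs_le_iff)
      finally show ?thesis .
    qed (use tail[of x] in \<open>auto simp: T_def intro!: ennreal_leI\<close>)
  qed
  also have "\<dots> = 2 + ((\<integral>\<^sup>+x. T x \<partial>lborel) + (\<integral>\<^sup>+x. T x \<partial>lborel))"
    by (simp add: nn_integral_add T')
  also have "\<dots> < \<infinity>" using T by (simp add: ennreal_add_eq_top less_top)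
  finally show ?thesis .
qed

definition plane_const :: "real \<Rightarrow> ennreal" where
  "plane_const \<eta> = (\<integral>\<^sup>+a. \<integral>\<^sup>+b. ennreal (sqrt (1 + a\<^sup>2 + b\<^sup>2) powr (- \<eta>)) \<partial>lborel \<partial>lborel)"

text \<open>By \<open>(1 + a\<^sup>2) * (1 + b\<^sup>2) \<le> (1 + a\<^sup>2 +
  b\<^sup>2)\<^sup>2\<close> the integrand is at most a product of two one-dimensional ones with
  exponent \<open>\<eta> / 4\<close>, which exceeds the threshold 1/2 exactly when \<eta> exceeds
  2.\<close>

lemma plane_const_finite:
  assumes \<eta>: "\<eta> > 2"
  shows "plane_const \<eta> < \<infinity>"
proof -
  define I where "I = (\<integral>\<^sup>+x. ennreal ((1 + x\<^sup>2) powr (- (\<eta>/4))) \<partial>lborel)"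
  have bound: "sqrt (1 + a\<^sup>2 + b\<^sup>2) powr (- \<eta>) \<le> (1 + a\<^sup>2) powr (- (\<eta>/4)) * (1 + b\<^sup>2) powr (- (\<eta>/4))" for a b :: real
  proof -
    have "sqrt S = (S\<^sup>2) powr (1/4)" if "S > 0" for S :: real
    proof -
      have e: "S\<^sup>2 = S powr 2" using that by simp
      show ?thesis unfolding e powr_powr using that by (simp add: powr_half_sqrt)
    qed
    from this[of "1 + a\<^sup>2 + b\<^sup>2"] have "sqrt (1 + a\<^sup>2 + b\<^sup>2) = ((1 + a\<^sup>2 + b\<^sup>2)\<^sup>2) powr (1/4)"
      by (simp add: add_pos_nonneg)
    then have "sqrt (1 + a\<^sup>2 + b\<^sup>2) powr (- \<eta>) = ((1 + a\<^sup>2 + b\<^sup>2)\<^sup>2) powr (- (\<eta>/4))"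
      by (simp add: powr_powr)
    also have "\<dots> \<le> ((1 + a\<^sup>2) * (1 + b\<^sup>2)) powr (- (\<eta>/4))"
    proof (rule powr_mono2')
      show "(1 + a\<^sup>2) * (1 + b\<^sup>2) \<le> (1 + a\<^sup>2 + b\<^sup>2)\<^sup>2"
      proof -
        have "(1 + A) * (1 + B) \<le> (1 + A + B)\<^sup>2" if "A \<ge> 0" "B \<ge> 0" for A B :: real
          using that mult_nonneg_nonneg[of A B] by (simp add: power2_eq_square algebra_simps)
        then show ?thesis by simp
      qed
      show "0 < (1 + a\<^sup>2) * (1 + b\<^sup>2)" by (intro mult_pos_pos add_pos_nonneg) auto
    qed (use \<eta> in auto)
    also have "\<dots> = (1 + a\<^sup>2) powr (- (\<eta>/4)) * (1 + b\<^sup>2) powr (- (\<eta>/4))"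
      by (rule powr_mult)
    finally show ?thesis .
  qed
  have "plane_const \<eta> \<le> (\<integral>\<^sup>+a. \<integral>\<^sup>+b. ennreal ((1 + a\<^sup>2) powr (- (\<eta>/4))) * ennreal ((1 + b\<^sup>2) powr (- (\<eta>/4))) \<partial>lborel \<partial>lborel)"
    unfolding plane_const_def
    by (intro nn_integral_mono) (auto simp: ennreal_mult[symmetric] intro!: ennreal_leI bound)
  also have "\<dots> = I * I"
    by (simp add: nn_integral_cmult nn_integral_multc I_def)
  also have "\<dots> < \<infinity>"
    using nn_integral_bracket_powr_finite[of "\<eta>/4"] \<eta> by (simp add: I_def ennreal_mult_less_top)
  finally show ?thesis .
qed

lemma nn_integral_shift:
  fixes f :: "vec3 \<Rightarrow> ennreal"
  assumes [measurable]: "f \<in> borel_measurable borel"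
  shows "(\<integral>\<^sup>+x. f (c + x) \<partial>lborel) = (\<integral>\<^sup>+x. f x \<partial>lborel)"
proof -
  have "(\<integral>\<^sup>+x. f x \<partial>lborel) = (\<integral>\<^sup>+x. f x \<partial>distr lborel borel ((+) c))"
    by (simp add: lborel_distr_plus)
  also have "\<dots> = (\<integral>\<^sup>+x. f (c + x) \<partial>lborel)" by (rule nn_integral_distr) measurable
  finally show ?thesis ..
qed

text \<open>Every point other than \<open>v\<close> is \<open>v + t *\<^sub>R k\<close> for two
  pairs, \<open>(t, k)\<close> and \<open>(- t, - k)\<close>; with the factor 4 this makes
  8.\<close>

lemma nn_integral_sphere_line:
  fixes f :: "vec3 \<Rightarrow> ennreal"
  assumes [measurable]: "f \<in> borel_measurable borel"
  shows "(\<integral>\<^sup>+k. \<integral>\<^sup>+t. ennreal (4 * t\<^sup>2) * f (v + t *\<^sub>R k) \<partial>lborel \<partial>sphere_measure) = 8 * (\<integral>\<^sup>+x. f x \<partial>lborel)"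
proof -
  define H where "H k = (\<integral>\<^sup>+t. ennreal (t\<^sup>2) * indicator {0<..} t * f (v + t *\<^sub>R k) \<partial>lborel)" for k
  have [measurable]: "H \<in> borel_measurable borel" unfolding H_def by measurable
  have split: "(\<integral>\<^sup>+t. ennreal (4 * t\<^sup>2) * f (v + t *\<^sub>R k) \<partial>lborel) = 4 * (H k + H (- k))" for k
  proof -
    have "(\<integral>\<^sup>+t. ennreal (4 * t\<^sup>2) * f (v + t *\<^sub>R k) \<partial>lborel) =
      (\<integral>\<^sup>+t. 4 * (ennreal (t\<^sup>2) * indicator {0<..} t * f (v + t *\<^sub>R k) + ennreal (t\<^sup>2) * indicator {..<0} t * f (v + t *\<^sub>R k)) \<partial>lborel)"
    proof (rule nn_integral_cong)
      fix t :: real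
      have "ennreal (4 * t\<^sup>2) = 4 * ennreal (t\<^sup>2)" by (simp add: ennreal_mult)
      then show "ennreal (4 * t\<^sup>2) * f (v + t *\<^sub>R k) = 4 * (ennreal (t\<^sup>2) * indicator {0<..} t * f (v + t *\<^sub>R k) + ennreal (t\<^sup>2) * indicator {..<0} t * f (v + t *\<^sub>R k))"
        by (cases "t > 0"; cases "t < 0") (auto simp: mult.assoc)
    qed
    also have "\<dots> = 4 * (H k + (\<integral>\<^sup>+t. ennreal (t\<^sup>2) * indicator {..<0} t * f (v + t *\<^sub>R k) \<partial>lborel))"
      by (simp add: nn_integral_cmult nn_integral_add H_def)
    also have "(\<integral>\<^sup>+t. ennreal (t\<^sup>2) * indicator {..<0} t * f (v + t *\<^sub>R k) \<partial>lborel) = H (- k)"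
      using nn_integral_real_affine[of "\<lambda>t. ennreal (t\<^sup>2) * indicator {..<0} t * f (v + t *\<^sub>R k)" "-1" 0]
      by (simp add: H_def indicator_def)
    finally show ?thesis .
  qed
  have "(\<integral>\<^sup>+k. \<integral>\<^sup>+t. ennreal (4 * t\<^sup>2) * f (v + t *\<^sub>R k) \<partial>lborel \<partial>sphere_measure) =
    4 * ((\<integral>\<^sup>+k. H k \<partial>sphere_measure) + (\<integral>\<^sup>+k. H (- k) \<partial>sphere_measure))"
    unfolding split by (simp add: nn_integral_cmult nn_integral_add)
  also have "(\<integral>\<^sup>+k. H (- k) \<partial>sphere_measure) = (\<integral>\<^sup>+k. H k \<partial>sphere_measure)"
    by (rule nn_integral_sphere_orthogonal[OF orthogonal_transformation_minus]) measurable
  also have "(\<integral>\<^sup>+k. H k \<partial>sphere_measure) = (\<integral>\<^sup>+x. f (v + x) \<partial>lborel)"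
    unfolding H_def by (rule nn_integral_spherical[symmetric]) measurable
  also have "\<dots> = (\<integral>\<^sup>+x. f x \<partial>lborel)" by (rule nn_integral_shift) measurable
  also have "4 * ((\<integral>\<^sup>+x. f x \<partial>lborel) + (\<integral>\<^sup>+x. f x \<partial>lborel)) = 8 * (\<integral>\<^sup>+x. f x \<partial>lborel)"
    by (simp flip: mult_2 mult.assoc)
  finally show ?thesis .
qed

text \<open>In the Carleman representation the kernel of the operator acting on \<open>f\<close> is an integral over a plane, which converges precisely because \<open>\<eta> > 2\<close>.\<close>
lemma nn_integral_gain_uniform:
  fixes f :: "vec3 \<Rightarrow> ennreal"
  assumes \<eta>: "\<eta> \<ge> 1" and [measurable]: "f \<in> borel_measurable borel"
  shows "(\<integral>\<^sup>+w. \<integral>\<^sup>+\<omega>. ennreal (moller v w) * (ennreal (relg v (vpost v w \<omega>) * vzero (wpost v w \<omega>) powr (- \<eta>)) *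
      f (vpost v w \<omega>)) \<partial>sphere_measure \<partial>lborel) \<le> 8 * plane_const \<eta> * (\<integral>\<^sup>+x. f x \<partial>lborel)"
proof -
  let ?t = "\<lambda>w k. gs_shift v w k"
  have "(\<integral>\<^sup>+w. \<integral>\<^sup>+\<omega>. ennreal (moller v w) * (ennreal (relg v (vpost v w \<omega>) * vzero (wpost v w \<omega>) powr (- \<eta>)) *
      f (vpost v w \<omega>)) \<partial>sphere_measure \<partial>lborel) =
    (\<integral>\<^sup>+w. \<integral>\<^sup>+k. ennreal (gs_kernel v w k) * (ennreal (relg v (v + ?t w k *\<^sub>R k) * vzero (v + w - (v + ?t w k *\<^sub>R k)) powr (- \<eta>)) *
      f (v + ?t w k *\<^sub>R k)) \<partial>sphere_measure \<partial>lborel)"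
    \<comment> \<open>The change of variables wants a function of \<open>v'\<close> alone, so
      \<open>w'\<close> is written as the total momentum minus \<open>v'\<close>.\<close>
    unfolding wpost_eq
    by (rule nn_integral_cong, rule nn_integral_glassey_strauss[where F = "\<lambda>u. ennreal (relg v u * vzero (v + _ - u) powr (- \<eta>)) * f u"]) measurable
  also have "\<dots> = (\<integral>\<^sup>+k. \<integral>\<^sup>+w. ennreal (gs_kernel v w k) * (ennreal (relg v (v + ?t w k *\<^sub>R k) * vzero (v + w - (v + ?t w k *\<^sub>R k)) powr (- \<eta>)) *
      f (v + ?t w k *\<^sub>R k)) \<partial>lborel \<partial>sphere_measure)"
    by (rule sphere_lborel.Fubini') measurable
  also have "\<dots> \<le> (\<integral>\<^sup>+k. plane_const \<eta> * (\<integral>\<^sup>+t. ennreal (4 * t\<^sup>2) * f (v + t *\<^sub>R k) \<partial>lborel) \<partial>sphere_measure)"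
  proof (rule nn_integral_sphere_mono)
    fix k :: vec3 assume k: "norm k = 1"
    have 1: "ennreal (gs_kernel v w k) * (ennreal (relg v (v + ?t w k *\<^sub>R k) * vzero (v + w - (v + ?t w k *\<^sub>R k)) powr (- \<eta>)) * X) =
      ennreal (gs_kernel v w k * (relg v (v + ?t w k *\<^sub>R k) * vzero (w - ?t w k *\<^sub>R k) powr (- \<eta>))) * X" for w X
    proof -
      have "v + w - (v + ?t w k *\<^sub>R k) = w - ?t w k *\<^sub>R k" by simp
      then show ?thesis
        by (simp add: ennreal_mult'' relg_nonneg mult.assoc)
    qed
    show "(\<integral>\<^sup>+w. ennreal (gs_kernel v w k) * (ennreal (relg v (v + ?t w k *\<^sub>R k) * vzero (v + w - (v + ?t w k *\<^sub>R k)) powr (- \<eta>)) *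
      f (v + ?t w k *\<^sub>R k)) \<partial>lborel) \<le> plane_const \<eta> * (\<integral>\<^sup>+t. ennreal (4 * t\<^sup>2) * f (v + t *\<^sub>R k) \<partial>lborel)"
      unfolding 1 plane_const_def by (rule nn_integral_carleman_line[OF k \<eta>]) measurable
  qed
  also have "\<dots> = plane_const \<eta> * (8 * (\<integral>\<^sup>+x. f x \<partial>lborel))"
    by (simp add: nn_integral_cmult nn_integral_sphere_line)
  finally show ?thesis by (simp add: mult_ac)
qed

section \<open>The L1 estimate by collision invariance\<close>

lemma moller_nonneg: "0 \<le> moller v w"
  using vzero_pos[of v] vzero_pos[of w] mandel_s_ge_4[of v w] by (simp add: moller_def relg_nonneg)

text \<open>The total mass is read off from the change of variables with the constant function 1,
  without integrating the kernel.\<close>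

lemma nn_integral_gs_kernel_le:
  "(\<integral>\<^sup>+k. ennreal (gs_kernel v w k) \<partial>sphere_measure) \<le> ennreal (moller v w * (2 * pi\<^sup>2))"
proof -
  have "(\<integral>\<^sup>+k. ennreal (gs_kernel v w k) \<partial>sphere_measure) = ennreal (moller v w) * emeasure sphere_measure UNIV"
    using nn_integral_glassey_strauss[of "\<lambda>_. 1" v w] by simp
  also have "\<dots> \<le> ennreal (moller v w) * ennreal (2 * pi\<^sup>2)"
    by (intro mult_left_mono emeasure_sphere_measure_le) auto
  also have "\<dots> = ennreal (moller v w * (2 * pi\<^sup>2))"
    by (simp add: ennreal_mult[symmetric] moller_nonneg)
  finally show ?thesis .
qed

text \<open>The origin of the weights with exponent 1/2: the left side is
  \<open>g\<^sup>2 * sqrt s / (vzero v * vzero w)\<close> with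
  \<open>g\<^sup>2 \<le> s \<le> 4 * (vzero v * vzero w)\<close>.\<close>

lemma moller_relg_le: "moller v w * relg v w \<le> 8 * (vzero v powr (1/2) * vzero w powr (1/2))"
proof -
  define X s where "X = vzero v * vzero w" "s = mandel_s v w"
  have X: "X > 0" using vzero_pos[of v] vzero_pos[of w] by (simp add: X_s_def)
  have s: "s \<ge> 4" "s \<le> 4 * X" using mandel_s_ge_4[of v w] mandel_s_le[of v w] by (simp_all add: X_s_def)
  have g: "(relg v w)\<^sup>2 \<le> s" by (simp add: X_s_def mandel_s_def)
  have "(relg v w)\<^sup>2 * sqrt s \<le> (4 * X) * sqrt (4 * X)"
    using g s by (intro mult_mono) auto
  also have "sqrt (4 * X) = 2 * sqrt X" by (simp add: real_sqrt_mult)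
  finally have "(relg v w)\<^sup>2 * sqrt s / X \<le> 8 * sqrt X" using X by (simp add: field_simps)
  moreover have "moller v w * relg v w = (relg v w)\<^sup>2 * sqrt s / X"
    by (simp add: moller_def X_s_def power2_eq_square)
  moreover have "sqrt X = vzero v powr (1/2) * vzero w powr (1/2)"
    using vzero_pos[of v] vzero_pos[of w] by (simp add: X_s_def real_sqrt_mult powr_half_sqrt less_imp_le)
  ultimately show ?thesis by simp
qed

text \<open>The total momentum takes the place of \<open>w\<close>, and \<open>v\<close> is moved
  innermost, where the exchange of the momenta acts at fixed \<open>P\<close> and
  \<open>k\<close>.\<close>

lemma nn_integral_total_momentum:
  fixes Z :: "vec3 \<Rightarrow> vec3 \<Rightarrow> vec3 \<Rightarrow> ennreal"
  assumes Z: "(\<lambda>(P, v, k). Z P v k) \<in> borel_measurable (borel \<Otimes>\<^sub>M borel \<Otimes>\<^sub>M borel)"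
  shows "(\<integral>\<^sup>+v. \<integral>\<^sup>+w. \<integral>\<^sup>+k. Z (v + w) v k \<partial>sphere_measure \<partial>lborel \<partial>lborel) =
    (\<integral>\<^sup>+P. \<integral>\<^sup>+k. \<integral>\<^sup>+v. Z P v k \<partial>lborel \<partial>sphere_measure \<partial>lborel)"
proof -
  have [measurable]: "(\<lambda>x. Z (a x) (b x) (c x)) \<in> borel_measurable M"
    if [measurable]: "a \<in> borel_measurable M" "b \<in> borel_measurable M" "c \<in> borel_measurable M" for a b c :: "'x \<Rightarrow> vec3" and M
    using measurable_compose[of "\<lambda>x. (a x, b x, c x)" M "borel \<Otimes>\<^sub>M borel \<Otimes>\<^sub>M borel", OF _ Z] by simp
  have "(\<integral>\<^sup>+v. \<integral>\<^sup>+w. \<integral>\<^sup>+k. Z (v + w) v k \<partial>sphere_measure \<partial>lborel \<partial>lborel) = (\<integral>\<^sup>+v. \<integral>\<^sup>+P. \<integral>\<^sup>+k. Z P v k \<partial>sphere_measure \<partial>lborel \<partial>lborel)"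
  proof (rule nn_integral_cong)
    fix v :: vec3
    have "(\<lambda>P. \<integral>\<^sup>+k. Z P v k \<partial>sphere_measure) \<in> borel_measurable borel" by measurable
    then show "(\<integral>\<^sup>+w. \<integral>\<^sup>+k. Z (v + w) v k \<partial>sphere_measure \<partial>lborel) = (\<integral>\<^sup>+P. \<integral>\<^sup>+k. Z P v k \<partial>sphere_measure \<partial>lborel)"
      by (rule nn_integral_shift)
  qed
  also have "\<dots> = (\<integral>\<^sup>+P. \<integral>\<^sup>+v. \<integral>\<^sup>+k. Z P v k \<partial>sphere_measure \<partial>lborel \<partial>lborel)"
    by (rule lborel_pair.Fubini') measurable
  also have "\<dots> = (\<integral>\<^sup>+P. \<integral>\<^sup>+k. \<integral>\<^sup>+v. Z P v k \<partial>lborel \<partial>sphere_measure \<partial>lborel)"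
    by (rule nn_integral_cong, rule sphere_lborel.Fubini') measurable
  finally show ?thesis .
qed

text \<open>For a fixed direction \<open>k\<close> and a fixed total momentum \<open>P\<close> the collision \<open>v \<mapsto> v'\<close> preserves the measure
  with density \<open>gs_kernel\<close>.\<close>
lemma nn_integral_gain_L1:
  fixes f h :: "vec3 \<Rightarrow> ennreal"
  assumes [measurable]: "f \<in> borel_measurable borel" "h \<in> borel_measurable borel"
  shows "(\<integral>\<^sup>+v. \<integral>\<^sup>+w. \<integral>\<^sup>+\<omega>. ennreal (moller v w) * (ennreal (relg v w) * (f (vpost v w \<omega>) * h (wpost v w \<omega>)))
      \<partial>sphere_measure \<partial>lborel \<partial>lborel) \<le>
    ennreal (16 * pi\<^sup>2) * ((\<integral>\<^sup>+v. ennreal (vzero v powr (1/2)) * f v \<partial>lborel) * (\<integral>\<^sup>+v. ennreal (vzero v powr (1/2)) * h v \<partial>lborel))"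
proof -
  define K where "K v w k = ennreal (gs_kernel v w k)" for v w k
  have [measurable]: "(\<lambda>x. K (a x) (b x) (c x)) \<in> borel_measurable M"
    if [measurable]: "a \<in> borel_measurable M" "b \<in> borel_measurable M" "c \<in> borel_measurable M" for a b c :: "'x \<Rightarrow> vec3" and M
    unfolding K_def by measurable
  define U where "U P v k = K v (P - v) k * (ennreal (relg v (P - v)) *
      (f (v + gs_shift v (P - v) k *\<^sub>R k) * h (P - (v + gs_shift v (P - v) k *\<^sub>R k))))" for P v k
  define V where "V P v k = K v (P - v) k * (ennreal (relg v (P - v)) * (f v * h (P - v)))" for P v k
  have [measurable]: "(\<lambda>x. U (a x) (b x) (c x)) \<in> borel_measurable M" "(\<lambda>x. V (a x) (b x) (c x)) \<in> borel_measurable M"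
    if [measurable]: "a \<in> borel_measurable M" "b \<in> borel_measurable M" "c \<in> borel_measurable M" for a b c :: "'x \<Rightarrow> vec3" and M
    unfolding U_def V_def K_def by measurable
  have exchange: "(\<integral>\<^sup>+v. U P v k \<partial>lborel) = (\<integral>\<^sup>+v. V P v k \<partial>lborel)" if k: "norm k = 1" for P k
  proof -
    \<comment> \<open>The kernel splits into the derivative of the total energy along
      \<open>k\<close>, which is the weight of the invariance, and a factor \<open>W\<close> built
      from collision invariants, \<open>P\<close> and \<open>k\<close>.\<close>
    define \<Delta> where "\<Delta> v = \<bar>(v \<bullet> k) / vzero v - ((P - v) \<bullet> k) / vzero (P - v)\<bar>" for v
    define W where "W v = 4 * mandel_s v (P - v) * (vzero v + vzero (P - v))\<^sup>2 / ((vzero v + vzero (P - v))\<^sup>2 - (P \<bullet> k)\<^sup>2)\<^sup>2" for v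
    have [measurable]: "W \<in> borel_measurable borel" unfolding W_def mandel_s_def by measurable
    have W0: "W v \<ge> 0" for v
      using mandel_s_ge_4[of v "P - v"] unfolding W_def by (intro divide_nonneg_nonneg mult_nonneg_nonneg) auto
    have K: "K v (P - v) k = ennreal (\<Delta> v) * ennreal (W v)" for v
    proof -
      have "\<Delta> v = \<bar>(v \<bullet> k) * vzero (P - v) - ((P - v) \<bullet> k) * vzero v\<bar> / (vzero v * vzero (P - v))"
        using vzero_pos[of v] vzero_pos[of "P - v"] unfolding \<Delta>_def
        by (simp add: diff_frac_eq abs_divide abs_mult)
      then have "gs_kernel v (P - v) k = \<Delta> v * W v"
        by (simp add: gs_kernel_def W_def)
      then show ?thesis unfolding K_def by (simp add: ennreal_mult W0 \<Delta>_def)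
    qed
    define G where "G v = ennreal (W v) * (ennreal (relg v (P - v)) * (f v * h (P - v)))" for v
    have [measurable]: "G \<in> borel_measurable borel" unfolding G_def by measurable
    have "U P v k = ennreal (\<Delta> v) * G (v + gs_shift v (P - v) k *\<^sub>R k)" for v
    proof -
      define v' where "v' = v + gs_shift v (P - v) k *\<^sub>R k"
      have w': "P - v - gs_shift v (P - v) k *\<^sub>R k = P - v'" by (simp add: v'_def)
      have "W v' = W v" "relg v' (P - v') = relg v (P - v)"
        using gs_mandel_s[OF k, of v "P - v"] gs_energy[OF k, of v "P - v"] gs_relg[OF k, of v "P - v"]
        unfolding w' v'_def[symmetric] by (simp_all add: W_def)
      then show ?thesis
        unfolding U_def G_def K v'_def[symmetric] by (simp add: mult.assoc)
    qed
    moreover have "V P v k = ennreal (\<Delta> v) * G v" for v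
      unfolding V_def G_def K by (simp add: mult.assoc)
    ultimately show ?thesis
      unfolding \<Delta>_def using nn_integral_involution[OF k, of G P] by simp
  qed
  have "(\<integral>\<^sup>+v. \<integral>\<^sup>+w. \<integral>\<^sup>+\<omega>. ennreal (moller v w) * (ennreal (relg v w) * (f (vpost v w \<omega>) * h (wpost v w \<omega>)))
      \<partial>sphere_measure \<partial>lborel \<partial>lborel) = (\<integral>\<^sup>+v. \<integral>\<^sup>+w. \<integral>\<^sup>+k. U (v + w) v k \<partial>sphere_measure \<partial>lborel \<partial>lborel)"
  proof (rule nn_integral_cong, rule nn_integral_cong)
    fix v w :: vec3
    show "(\<integral>\<^sup>+\<omega>. ennreal (moller v w) * (ennreal (relg v w) * (f (vpost v w \<omega>) * h (wpost v w \<omega>))) \<partial>sphere_measure) =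
      (\<integral>\<^sup>+k. U (v + w) v k \<partial>sphere_measure)"
      using nn_integral_glassey_strauss[of "\<lambda>u. ennreal (relg v w) * (f u * h (v + w - u))" v w]
      by (simp add: U_def K_def wpost_eq)
  qed
  also have "\<dots> = (\<integral>\<^sup>+P. \<integral>\<^sup>+k. \<integral>\<^sup>+v. U P v k \<partial>lborel \<partial>sphere_measure \<partial>lborel)"
    by (rule nn_integral_total_momentum) measurable
  also have "\<dots> = (\<integral>\<^sup>+P. \<integral>\<^sup>+k. \<integral>\<^sup>+v. V P v k \<partial>lborel \<partial>sphere_measure \<partial>lborel)"
    by (rule nn_integral_cong, rule nn_integral_sphere_cong, rule exchange)
  also have "\<dots> = (\<integral>\<^sup>+v. \<integral>\<^sup>+w. \<integral>\<^sup>+k. V (v + w) v k \<partial>sphere_measure \<partial>lborel \<partial>lborel)"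
    by (rule nn_integral_total_momentum[symmetric]) measurable
  also have "\<dots> \<le> (\<integral>\<^sup>+v. \<integral>\<^sup>+w. (ennreal (16 * pi\<^sup>2) * (ennreal (vzero v powr (1/2)) * f v)) * (ennreal (vzero w powr (1/2)) * h w) \<partial>lborel \<partial>lborel)"
  proof (intro nn_integral_mono)
    fix v w :: vec3
    \<comment> \<open>After the exchange \<open>f\<close> and \<open>h\<close> stand at the momenta
      before the collision and do not depend on \<open>k\<close>, so the kernel is integrated
      alone.\<close>
    have "(\<integral>\<^sup>+k. V (v + w) v k \<partial>sphere_measure) = (\<integral>\<^sup>+k. ennreal (gs_kernel v w k) \<partial>sphere_measure) * (ennreal (relg v w) * (f v * h w))"
      unfolding V_def K_def by (simp add: nn_integral_multc)
    also have "\<dots> \<le> ennreal (moller v w * (2 * pi\<^sup>2)) * (ennreal (relg v w) * (f v * h w))"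
      by (intro mult_right_mono nn_integral_gs_kernel_le) auto
    also have "\<dots> = ennreal (moller v w * relg v w * (2 * pi\<^sup>2)) * (f v * h w)"
      by (simp add: ennreal_mult[symmetric] moller_nonneg relg_nonneg mult.assoc[symmetric]) (simp add: mult_ac)
    also have "\<dots> \<le> ennreal (8 * (vzero v powr (1/2) * vzero w powr (1/2)) * (2 * pi\<^sup>2)) * (f v * h w)"
      by (intro mult_right_mono ennreal_leI moller_relg_le) auto
    also have "8 * (vzero v powr (1/2) * vzero w powr (1/2)) * (2 * pi\<^sup>2) = 16 * pi\<^sup>2 * (vzero v powr (1/2) * vzero w powr (1/2))" by simp
    also have "ennreal (16 * pi\<^sup>2 * (vzero v powr (1/2) * vzero w powr (1/2))) * (f v * h w) =
      (ennreal (16 * pi\<^sup>2) * (ennreal (vzero v powr (1/2)) * f v)) * (ennreal (vzero w powr (1/2)) * h w)"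
      by (simp add: ennreal_mult mult_ac)
    finally show "(\<integral>\<^sup>+k. V (v + w) v k \<partial>sphere_measure) \<le>
      (ennreal (16 * pi\<^sup>2) * (ennreal (vzero v powr (1/2)) * f v)) * (ennreal (vzero w powr (1/2)) * h w)" .
  qed
  also have "\<dots> = ennreal (16 * pi\<^sup>2) * ((\<integral>\<^sup>+v. ennreal (vzero v powr (1/2)) * f v \<partial>lborel) * (\<integral>\<^sup>+v. ennreal (vzero v powr (1/2)) * h v \<partial>lborel))"
    by (simp add: nn_integral_cmult nn_integral_multc) (simp only: mult.assoc)
  finally show ?thesis .
qed

section \<open>Passage from nonnegative integrals to \<open>Qplus\<close>\<close>

lemma ennreal_abs_integral_le:
  fixes f :: "'a \<Rightarrow> real"
  shows "ennreal \<bar>\<integral>x. f x \<partial>M\<bar> \<le> (\<integral>\<^sup>+x. ennreal \<bar>f x\<bar> \<partial>M)"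
proof (cases "integrable M f")
  case True
  then show ?thesis using integral_norm_bound_ennreal[OF True] by simp
qed (simp add: not_integrable_integral_eq)

text \<open>A Bochner integral that does not exist has the value 0, which only helps; so a
  measurable majorant of \<open>F\<close> on the unit sphere is enough.\<close>

lemma ennreal_abs_sphere_integral_le:
  assumes FG: "\<And>\<omega>. norm \<omega> = 1 \<Longrightarrow> ennreal \<bar>F \<omega>\<bar> \<le> G \<omega>" and [measurable]: "G \<in> borel_measurable borel"
  shows "ennreal \<bar>sphere_integral F\<bar> \<le> (\<integral>\<^sup>+\<omega>. G \<omega> \<partial>sphere_measure)"
proof -
  define I where "I \<phi> = (\<integral>\<psi>. indicator {0<..<2*pi} \<psi> *\<^sub>R (F (sphere_pt \<phi> \<psi>) * sin \<phi>) \<partial>lborel)" for \<phi>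
  have "sphere_integral F = (\<integral>\<phi>. indicator {0<..<pi} \<phi> *\<^sub>R I \<phi> \<partial>lborel)"
  proof -
    have e: "interval_lebesgue_integral lborel 0 (ereal b) g = (\<integral>x. indicator {0<..<b} x *\<^sub>R g x \<partial>lborel)"
      if "b \<ge> 0" for b and g :: "real \<Rightarrow> real"
      using that by (simp add: interval_lebesgue_integral_le_eq set_lebesgue_integral_def zero_ereal_def)
    have "0 \<le> 2 * pi" by simp
    note e2 = e[OF this]
    show ?thesis unfolding sphere_integral_def I_def e[OF pi_ge_zero] e2 by (rule refl)
  qed
  then have "ennreal \<bar>sphere_integral F\<bar> \<le> (\<integral>\<^sup>+\<phi>. ennreal \<bar>indicator {0<..<pi} \<phi> *\<^sub>R I \<phi>\<bar> \<partial>lborel)"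
    using ennreal_abs_integral_le by simp
  also have "\<dots> \<le> (\<integral>\<^sup>+\<phi>. \<integral>\<^sup>+\<psi>. ennreal (sin \<phi>) * indicator {0<..<pi} \<phi> * indicator {0<..<2 * pi} \<psi> * G (sphere_pt \<phi> \<psi>) \<partial>lborel \<partial>lborel)"
  proof (rule nn_integral_mono)
    fix \<phi> :: real
    show "ennreal \<bar>indicator {0<..<pi} \<phi> *\<^sub>R I \<phi>\<bar> \<le> (\<integral>\<^sup>+\<psi>. ennreal (sin \<phi>) * indicator {0<..<pi} \<phi> * indicator {0<..<2 * pi} \<psi> * G (sphere_pt \<phi> \<psi>) \<partial>lborel)"
    proof (cases "0 < \<phi> \<and> \<phi> < pi")
      case True
      then have s: "sin \<phi> > 0" by (simp add: sin_gt_zero)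
      have "ennreal \<bar>I \<phi>\<bar> \<le> (\<integral>\<^sup>+\<psi>. ennreal \<bar>indicator {0<..<2*pi} \<psi> *\<^sub>R (F (sphere_pt \<phi> \<psi>) * sin \<phi>)\<bar> \<partial>lborel)"
        unfolding I_def by (rule ennreal_abs_integral_le)
      also have "\<dots> \<le> (\<integral>\<^sup>+\<psi>. ennreal (sin \<phi>) * indicator {0<..<pi} \<phi> * indicator {0<..<2 * pi} \<psi> * G (sphere_pt \<phi> \<psi>) \<partial>lborel)"
      proof (rule nn_integral_mono)
        fix \<psi> :: real
        have "ennreal \<bar>F (sphere_pt \<phi> \<psi>) * sin \<phi>\<bar> = ennreal (sin \<phi>) * ennreal \<bar>F (sphere_pt \<phi> \<psi>)\<bar>"
          using s by (simp add: abs_mult ennreal_mult mult.commute)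
        also have "\<dots> \<le> ennreal (sin \<phi>) * G (sphere_pt \<phi> \<psi>)" by (intro mult_left_mono FG) auto
        finally show "ennreal \<bar>indicator {0<..<2*pi} \<psi> *\<^sub>R (F (sphere_pt \<phi> \<psi>) * sin \<phi>)\<bar> \<le>
          ennreal (sin \<phi>) * indicator {0<..<pi} \<phi> * indicator {0<..<2 * pi} \<psi> * G (sphere_pt \<phi> \<psi>)"
          using True by (simp add: indicator_def)
      qed
      finally show ?thesis using True by simp
    next
      case False
      then have "indicator {0<..<pi} \<phi> = (0 :: real)" by auto
      then show ?thesis by simp
    qed
  qed
  also have "\<dots> = (\<integral>\<^sup>+\<omega>. G \<omega> \<partial>sphere_measure)"
    by (rule nn_integral_sphere_measure[symmetric]) measurable
  finally show ?thesis .
qed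

text \<open>Outside of \<open>[-1, 1]\<close> the value of \<open>arccos\<close> is the same unspecified constant everywhere.\<close>
lemma measurable_arccos: "arccos \<in> borel_measurable (borel :: real measure)"
proof -
  have eq: "arccos = (\<lambda>x. if x \<in> {-1..1} then arccos x else arccos 2)"
  proof
    fix x :: real
    have no: "(\<lambda>y. 0 \<le> y \<and> y \<le> pi \<and> cos y = z) = (\<lambda>y. False)" if "z \<notin> {-1..1}" for z :: real
      using that by (auto simp: fun_eq_iff)
    show "arccos x = (if x \<in> {-1..1} then arccos x else arccos 2)"
      by (auto simp: arccos_def no)
  qed
  show ?thesis
    by (subst eq, rule borel_measurable_continuous_on_if) (auto intro!: continuous_on_arccos' continuous_on_const)
qed

lemma measurable_theta[measurable (raw)]:
  assumes [measurable]: "f \<in> borel_measurable M" "g \<in> borel_measurable M" "h \<in> borel_measurable M"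
  shows "(\<lambda>x. theta (f x) (g x) (h x)) \<in> borel_measurable M"
proof -
  note [measurable] = measurable_compose[OF _ measurable_arccos]
  show ?thesis unfolding theta_def cos_theta_def by measurable
qed

lemma measurable_Qplus:
  fixes f h :: "vec3 \<Rightarrow> real"
  assumes [measurable]: "f \<in> borel_measurable borel" "h \<in> borel_measurable borel"
    and \<sigma>: "\<sigma> = (\<lambda>g \<theta>. if cos \<theta> < 0 then 0 else a * g * b * sin \<theta>)"
  shows "Qplus \<sigma> f h \<in> borel_measurable borel"
proof -
  have [measurable]: "(\<lambda>x. \<sigma> (g x) (t x)) \<in> borel_measurable M"
    if [measurable]: "g \<in> borel_measurable M" "t \<in> borel_measurable M" for g t :: "'x \<Rightarrow> real" and M
    unfolding \<sigma> by measurable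
  show ?thesis
    unfolding Qplus_def[abs_def] sphere_integral_def
    by (simp add: interval_lebesgue_integral_le_eq set_lebesgue_integral_def zero_ereal_def) measurable
qed

text \<open>If \<open>y\<close> exceeds \<open>c\<close>, then
  \<open>y powr (1 - p) \<le> c powr (1 - p)\<close>. Being linear in \<open>y powr p\<close>, the
  bound can be integrated before \<open>c\<close> is chosen.\<close>

lemma le_add_powr:
  fixes y c p :: real
  assumes "0 \<le> y" "0 < c" "1 \<le> p"
  shows "y \<le> c + c powr (1 - p) * y powr p"
proof (cases "y \<le> c")
  case True
  moreover have "0 \<le> c powr (1 - p) * y powr p" by simp
  ultimately show ?thesis by linarith
next
  case False
  then have "y = y powr (1 - p) * y powr p" using assms by (simp flip: powr_add)
  also have "\<dots> \<le> c powr (1 - p) * y powr p"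
    using False assms by (intro mult_right_mono powr_mono2') auto
  finally show ?thesis using assms by linarith
qed

text \<open>The choice \<open>c = (x / K) powr (1 / p)\<close> balances the two terms and recovers
  the product form of Hoelder's inequality up to \<open>2 powr p\<close>. For \<open>x = 0\<close> a
  small \<open>c\<close> forces \<open>Q = 0\<close>.\<close>

lemma powr_le_of_splitting:
  fixes Q K x p :: real
  assumes "0 \<le> Q" "0 < K" "0 \<le> x" "1 \<le> p"
    and le: "\<And>c. 0 < c \<Longrightarrow> Q \<le> c * K + c powr (1 - p) * x"
  shows "Q powr p \<le> 2 powr p * K powr (p - 1) * x"
proof (cases "x = 0")
  case True
  have "Q = 0"
  proof (rule ccontr)
    assume "Q \<noteq> 0"
    then have "Q \<le> Q / (2 * K) * K" using le[of "Q / (2 * K)"] assms True by simp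
    then show False using \<open>Q \<noteq> 0\<close> assms by simp
  qed
  then show ?thesis using True by simp
next
  case False
  define c where "c = (x / K) powr (1 / p)"
  have c: "c > 0" "c powr p = x / K" using False assms by (simp_all add: c_def powr_powr)
  have "c powr (1 - p) * x = c * K"
    using c False assms by (simp add: powr_diff)
  then have "Q \<le> 2 * c * K" using le[OF c(1)] by (simp add: mult_ac)
  then have "Q powr p \<le> (2 * c * K) powr p" using assms by (intro powr_mono2) auto
  also have "\<dots> = 2 powr p * (x / K) * K powr p" using c assms by (simp add: powr_mult)
  also have "\<dots> = 2 powr p * K powr (p - 1) * x" using assms by (simp add: powr_diff)
  finally show ?thesis .
qed

text \<open>The cross-section is bounded twice: through the relative momentum of \<open>v\<close>
  and \<open>v'\<close> in the first term, where the singularity has to be cancelled, and through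
  the collision invariant \<open>relg v w\<close> in the second.\<close>

lemma ennreal_abs_Qplus_le:
  fixes f h :: "vec3 \<Rightarrow> real" and a b p \<eta> c :: real
  assumes \<sigma>: "\<sigma> = (\<lambda>g \<theta>. if cos \<theta> < 0 then 0 else a * g * b * sin \<theta>)" and ab: "a > 0" "b > 0"
    and c: "c > 0" and p: "1 \<le> p"
    and [measurable]: "f \<in> borel_measurable borel" "h \<in> borel_measurable borel"
  shows "ennreal \<bar>Qplus \<sigma> f h v\<bar> \<le>
    ennreal (c * (2 * (a * b))) * (\<integral>\<^sup>+w. \<integral>\<^sup>+\<omega>. ennreal (moller v w) * (ennreal (relg v (vpost v w \<omega>) * vzero (wpost v w \<omega>) powr (- \<eta>)) *
      ennreal \<bar>f (vpost v w \<omega>)\<bar>) \<partial>sphere_measure \<partial>lborel) +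
    ennreal (c powr (1 - p) * (a * b)) * (\<integral>\<^sup>+w. \<integral>\<^sup>+\<omega>. ennreal (moller v w) * (ennreal (relg v w) * (ennreal \<bar>f (vpost v w \<omega>)\<bar> *
      ennreal (vzero (wpost v w \<omega>) powr (\<eta> * (p - 1)) * \<bar>h (wpost v w \<omega>)\<bar> powr p))) \<partial>sphere_measure \<partial>lborel)"
proof -
  define A where "A w \<omega> = ennreal (moller v w) * (ennreal (relg v (vpost v w \<omega>) * vzero (wpost v w \<omega>) powr (- \<eta>)) *
      ennreal \<bar>f (vpost v w \<omega>)\<bar>)" for w \<omega>
  define B where "B w \<omega> = ennreal (moller v w) * (ennreal (relg v w) * (ennreal \<bar>f (vpost v w \<omega>)\<bar> *
      ennreal (vzero (wpost v w \<omega>) powr (\<eta> * (p - 1)) * \<bar>h (wpost v w \<omega>)\<bar> powr p)))" for w \<omega>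
  have [measurable]: "(\<lambda>x. A (s x) (t x)) \<in> borel_measurable M" "(\<lambda>x. B (s x) (t x)) \<in> borel_measurable M"
    if [measurable]: "s \<in> borel_measurable M" "t \<in> borel_measurable M" for s t :: "'x \<Rightarrow> vec3" and M
    unfolding A_def B_def by measurable
  let ?G = "\<lambda>w \<omega>. ennreal (c * (2 * (a * b))) * A w \<omega> + ennreal (c powr (1 - p) * (a * b)) * B w \<omega>"
  have pointwise: "ennreal \<bar>moller v w * \<sigma> (relg v w) (theta v w \<omega>) * f (vpost v w \<omega>) * h (wpost v w \<omega>)\<bar> \<le> ?G w \<omega>"
    if \<omega>: "norm \<omega> = 1" for w \<omega>
  proof -
    define m S F W H g' where "m = moller v w" "S = \<bar>\<sigma> (relg v w) (theta v w \<omega>)\<bar>" "F = \<bar>f (vpost v w \<omega>)\<bar>"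
      "W = vzero (wpost v w \<omega>)" "H = \<bar>h (wpost v w \<omega>)\<bar>" "g' = relg v (vpost v w \<omega>)"
    note defs = this
    have nn: "m \<ge> 0" "S \<ge> 0" "F \<ge> 0" "W > 0" "H \<ge> 0" "g' \<ge> 0" "relg v w \<ge> 0"
      by (auto simp: defs moller_nonneg relg_nonneg vzero_pos)
    have S0: "S \<le> a * b * (relg v w * \<bar>sin (theta v w \<omega>)\<bar>)"
      using ab relg_nonneg[of v w] by (auto simp: defs \<sigma> abs_mult)
    have S1: "S \<le> 2 * (a * b) * g'"
    proof -
      have "a * b * (relg v w * \<bar>sin (theta v w \<omega>)\<bar>) \<le> a * b * (2 * g')"
        using sin_theta_le[OF \<omega>, of v w] ab by (intro mult_left_mono) (auto simp: defs)
      then show ?thesis using S0 by simp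
    qed
    have S2: "S \<le> a * b * relg v w"
    proof -
      have "a * b * (relg v w * \<bar>sin (theta v w \<omega>)\<bar>) \<le> a * b * (relg v w * 1)"
        using ab nn by (intro mult_left_mono) auto
      then show ?thesis using S0 by simp
    qed
    have H: "H \<le> c * W powr (- \<eta>) + c powr (1 - p) * (W powr (\<eta> * (p - 1)) * H powr p)"
    proof -
      \<comment> \<open>Weighting \<open>h\<close> before the splitting produces
        \<open>W powr (- \<eta>)\<close> in the first term and, after the exponents are combined,
        \<open>W powr (\<eta> * (p - 1))\<close> in the second.\<close>
      define y where "y = W powr \<eta> * H"
      have "H = W powr (- \<eta>) * y" using nn by (simp add: y_def powr_minus)
      also have "\<dots> \<le> W powr (- \<eta>) * (c + c powr (1 - p) * y powr p)"
        using c p nn by (intro mult_left_mono le_add_powr) (auto simp: y_def)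
      also have "\<dots> = c * W powr (- \<eta>) + c powr (1 - p) * ((W powr (- \<eta>) * W powr (\<eta> * p)) * H powr p)"
        using nn by (simp add: y_def powr_mult powr_powr algebra_simps)
      also have "W powr (- \<eta>) * W powr (\<eta> * p) = W powr (\<eta> * (p - 1))"
        by (simp add: powr_add[symmetric] algebra_simps)
      finally show ?thesis .
    qed
    have "m * S * F * H \<le> m * S * F * (c * W powr (- \<eta>) + c powr (1 - p) * (W powr (\<eta> * (p - 1)) * H powr p))"
      using nn H by (intro mult_left_mono) auto
    also have "\<dots> = S * (c * (m * W powr (- \<eta>) * F)) + S * (c powr (1 - p) * (m * F * (W powr (\<eta> * (p - 1)) * H powr p)))"
      by (simp add: algebra_simps)
    also have "\<dots> \<le> 2 * (a * b) * g' * (c * (m * W powr (- \<eta>) * F)) + a * b * relg v w * (c powr (1 - p) * (m * F * (W powr (\<eta> * (p - 1)) * H powr p)))"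
      using S1 S2 nn c by (intro add_mono mult_right_mono) auto
    also have "\<dots> = c * (2 * (a * b)) * (m * (g' * W powr (- \<eta>) * F)) + c powr (1 - p) * (a * b) * (m * (relg v w * (F * (W powr (\<eta> * (p - 1)) * H powr p))))"
      by (simp add: algebra_simps)
    finally have "m * S * F * H \<le> c * (2 * (a * b)) * (m * (g' * W powr (- \<eta>) * F)) + c powr (1 - p) * (a * b) * (m * (relg v w * (F * (W powr (\<eta> * (p - 1)) * H powr p))))" .
    then have "ennreal (m * S * F * H) \<le> ennreal (c * (2 * (a * b)) * (m * (g' * W powr (- \<eta>) * F)) + c powr (1 - p) * (a * b) * (m * (relg v w * (F * (W powr (\<eta> * (p - 1)) * H powr p)))))"
      by (rule ennreal_leI)
    also have "\<dots> = ?G w \<omega>"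
      unfolding A_def B_def defs[symmetric] using nn c ab
      by (simp add: ennreal_mult ennreal_plus)
    also have "m * S * F * H = \<bar>moller v w * \<sigma> (relg v w) (theta v w \<omega>) * f (vpost v w \<omega>) * h (wpost v w \<omega>)\<bar>"
      by (simp add: defs abs_mult moller_nonneg)
    finally show ?thesis .
  qed
  have "ennreal \<bar>Qplus \<sigma> f h v\<bar> \<le> (\<integral>\<^sup>+w. ennreal \<bar>sphere_integral (\<lambda>\<omega>. moller v w * \<sigma> (relg v w) (theta v w \<omega>)
                 * f (vpost v w \<omega>) * h (wpost v w \<omega>))\<bar> \<partial>lborel)"
    unfolding Qplus_def by (rule ennreal_abs_integral_le)
  also have "\<dots> \<le> (\<integral>\<^sup>+w. \<integral>\<^sup>+\<omega>. ?G w \<omega> \<partial>sphere_measure \<partial>lborel)"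
    by (intro nn_integral_mono ennreal_abs_sphere_integral_le pointwise) measurable
  also have "\<dots> = ennreal (c * (2 * (a * b))) * (\<integral>\<^sup>+w. \<integral>\<^sup>+\<omega>. A w \<omega> \<partial>sphere_measure \<partial>lborel) +
    ennreal (c powr (1 - p) * (a * b)) * (\<integral>\<^sup>+w. \<integral>\<^sup>+\<omega>. B w \<omega> \<partial>sphere_measure \<partial>lborel)"
    by (simp add: nn_integral_add nn_integral_cmult)
  finally show ?thesis unfolding A_def B_def .
qed

theorem theorem3p1:
  fixes p \<eta> C\<^sub>\<Phi> C :: real
  assumes "1 \<le> p" and "\<eta> > 2" and "C\<^sub>\<Phi> > 0" and "C > 0"
  defines "\<sigma> \<equiv> (\<lambda>g \<theta>. if cos \<theta> < 0 then 0 else C\<^sub>\<Phi> * g * C * sin \<theta>)"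
  shows "\<exists>C'>0. \<forall>f h :: vec3 \<Rightarrow> real.
           f \<in> borel_measurable lborel \<longrightarrow> h \<in> borel_measurable lborel \<longrightarrow>
           integrable lborel (\<lambda>v. vzero v powr (1/2) * \<bar>f v\<bar>) \<longrightarrow>
           integrable lborel (\<lambda>v. vzero v powr (\<eta> * (p - 1) + 1/2) * \<bar>h v\<bar> powr p) \<longrightarrow>
           (integrable lborel (\<lambda>v. \<bar>Qplus \<sigma> f h v\<bar> powr p) \<and>
            wLp_norm p 0 (Qplus \<sigma> f h)
              \<le> C' * wLp_norm 1 (1/2) f * wLp_norm p (\<eta> * (p - 1) + 1/2) h)"
proof -
  define c where "c = C\<^sub>\<Phi> * C"
  \<comment> \<open>The added 1 makes \<open>J\<close> positive.\<close>
  define J where "J = enn2real (plane_const \<eta>) + 1"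
  \<comment> \<open>In \<open>16 * c * J\<close> a factor 2 comes from \<open>sin_theta_le\<close>
    and 8 from \<open>nn_integral_sphere_line\<close>; \<open>16 * pi\<^sup>2\<close> is the
    constant of the L1 estimate.\<close>
  define D where "D = 2 powr p * (16 * c * J) powr (p - 1) * c * (16 * pi\<^sup>2)"
  have c: "c > 0" using assms by (simp add: c_def)
  have J: "J > 0" by (simp add: J_def add_nonneg_pos)
  have D: "D > 0" using c J by (simp add: D_def)
  have plane: "plane_const \<eta> \<le> ennreal J"
    using plane_const_finite[OF assms(2)] unfolding J_def
    by (metis add_increasing2 enn2real_nonneg ennreal_enn2real ennreal_leI infinity_ennreal_def le_add_same_cancel1 order_refl zero_le_one)
  have "integrable lborel (\<lambda>v. \<bar>Qplus \<sigma> f h v\<bar> powr p) \<and>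
      wLp_norm p 0 (Qplus \<sigma> f h) \<le> D powr (1/p) * wLp_norm 1 (1/2) f * wLp_norm p (\<eta> * (p - 1) + 1/2) h"
    if f: "f \<in> borel_measurable lborel" and h: "h \<in> borel_measurable lborel"
      and fi: "integrable lborel (\<lambda>v. vzero v powr (1/2) * \<bar>f v\<bar>)"
      and hi: "integrable lborel (\<lambda>v. vzero v powr (\<eta> * (p - 1) + 1/2) * \<bar>h v\<bar> powr p)"
    for f h :: "vec3 \<Rightarrow> real"
  proof -
    have [measurable]: "f \<in> borel_measurable borel" "h \<in> borel_measurable borel" using f h by simp_all
    have \<sigma>: "\<sigma> = (\<lambda>g \<theta>. if cos \<theta> < 0 then 0 else C\<^sub>\<Phi> * g * C * sin \<theta>)" by (simp add: \<sigma>_def)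
    define Q where "Q = Qplus \<sigma> f h"
    have [measurable]: "Q \<in> borel_measurable borel"
      unfolding Q_def by (rule measurable_Qplus[OF _ _ \<sigma>]) measurable
    define Nf where "Nf = (\<integral>v. vzero v powr (1/2) * \<bar>f v\<bar> \<partial>lborel)"
    define Nh where "Nh = (\<integral>v. vzero v powr (\<eta> * (p - 1) + 1/2) * \<bar>h v\<bar> powr p \<partial>lborel)"
    have N: "Nf \<ge> 0" "Nh \<ge> 0" by (simp_all add: Nf_def Nh_def)
    define X where "X v = (\<integral>\<^sup>+w. \<integral>\<^sup>+\<omega>. ennreal (moller v w) * (ennreal (relg v w) * (ennreal \<bar>f (vpost v w \<omega>)\<bar> *
      ennreal (vzero (wpost v w \<omega>) powr (\<eta> * (p - 1)) * \<bar>h (wpost v w \<omega>)\<bar> powr p))) \<partial>sphere_measure \<partial>lborel)" for v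
    have [measurable]: "X \<in> borel_measurable borel" unfolding X_def by measurable
    have fN: "(\<integral>\<^sup>+v. ennreal (vzero v powr (1/2)) * ennreal \<bar>f v\<bar> \<partial>lborel) = ennreal Nf"
      unfolding Nf_def using fi by (subst nn_integral_eq_integral[symmetric]) (auto simp: ennreal_mult)
    have hN: "(\<integral>\<^sup>+v. ennreal (vzero v powr (1/2)) * ennreal (vzero v powr (\<eta> * (p - 1)) * \<bar>h v\<bar> powr p) \<partial>lborel) = ennreal Nh"
      unfolding Nh_def using hi
      by (subst nn_integral_eq_integral[symmetric]) (auto simp: ennreal_mult[symmetric] powr_add mult_ac)
    have f1: "(\<integral>\<^sup>+v. ennreal \<bar>f v\<bar> \<partial>lborel) \<le> ennreal Nf"
      unfolding fN[symmetric]
    proof (rule nn_integral_mono)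
      fix v
      have "1 \<le> vzero v powr (1/2)" using vzero_ge_1[of v] by (intro ge_one_powr_ge_zero) auto
      then have "1 * ennreal \<bar>f v\<bar> \<le> ennreal (vzero v powr (1/2)) * ennreal \<bar>f v\<bar>"
        by (intro mult_right_mono) auto
      then show "ennreal \<bar>f v\<bar> \<le> ennreal (vzero v powr (1/2)) * ennreal \<bar>f v\<bar>" by simp
    qed
    have intX: "(\<integral>\<^sup>+v. X v \<partial>lborel) \<le> ennreal (16 * pi\<^sup>2 * (Nf * Nh))"
    proof -
      have "(\<integral>\<^sup>+v. X v \<partial>lborel) \<le> ennreal (16 * pi\<^sup>2) * (ennreal Nf * ennreal Nh)"
        unfolding X_def fN[symmetric] hN[symmetric] by (rule nn_integral_gain_L1) measurable
      also have "\<dots> = ennreal (16 * pi\<^sup>2 * (Nf * Nh))"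
        using N by (simp add: ennreal_mult[symmetric])
      finally show ?thesis .
    qed
    have Qle: "ennreal \<bar>Q v\<bar> \<le> ennreal (\<tau> * (16 * c * J * Nf)) + ennreal (\<tau> powr (1 - p) * c) * X v" if \<tau>: "\<tau> > 0" for \<tau> v
    proof -
      have "(\<integral>\<^sup>+w. \<integral>\<^sup>+\<omega>. ennreal (moller v w) * (ennreal (relg v (vpost v w \<omega>) * vzero (wpost v w \<omega>) powr (- \<eta>)) *
        ennreal \<bar>f (vpost v w \<omega>)\<bar>) \<partial>sphere_measure \<partial>lborel) \<le> 8 * plane_const \<eta> * (\<integral>\<^sup>+x. ennreal \<bar>f x\<bar> \<partial>lborel)"
        using assms(2) by (intro nn_integral_gain_uniform[where f = "\<lambda>x. ennreal \<bar>f x\<bar>"]) auto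
      also have "\<dots> \<le> 8 * ennreal J * ennreal Nf"
        by (intro mult_mono plane f1) auto
      also have "\<dots> = ennreal (8 * J * Nf)" using J N by (simp add: ennreal_mult)
      finally have "ennreal (\<tau> * (2 * c)) * (\<integral>\<^sup>+w. \<integral>\<^sup>+\<omega>. ennreal (moller v w) * (ennreal (relg v (vpost v w \<omega>) * vzero (wpost v w \<omega>) powr (- \<eta>)) *
        ennreal \<bar>f (vpost v w \<omega>)\<bar>) \<partial>sphere_measure \<partial>lborel) \<le> ennreal (\<tau> * (2 * c)) * ennreal (8 * J * Nf)"
        by (intro mult_left_mono) auto
      also have "\<dots> = ennreal (\<tau> * (16 * c * J * Nf))"
        using J N c \<tau> by (subst ennreal_mult[symmetric]) (auto simp: mult_ac)
      finally show ?thesis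
        using ennreal_abs_Qplus_le[OF \<sigma> assms(3,4) \<tau> assms(1), of f h v \<eta>]
        unfolding X_def Q_def c_def[symmetric] by (auto elim!: order_trans intro!: add_right_mono)
    qed
    have main: "(\<integral>\<^sup>+v. ennreal (\<bar>Q v\<bar> powr p) \<partial>lborel) \<le> ennreal (D * (Nf powr p * Nh))"
    \<comment> \<open>\<open>powr_le_of_splitting\<close> needs a positive \<open>K\<close>, so a
      vanishing norm of \<open>f\<close> is treated apart.\<close>
    proof (cases "Nf = 0")
      case True
      have "(\<integral>\<^sup>+v. X v \<partial>lborel) = 0" using intX True by simp
      then have "AE v in lborel. X v = 0" by (simp add: nn_integral_0_iff_AE)
      then have "AE v in lborel. ennreal (\<bar>Q v\<bar> powr p) = 0"
      proof eventually_elim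
        case (elim v)
        then show ?case using Qle[of 1 v] True by simp
      qed
      then have "(\<integral>\<^sup>+v. ennreal (\<bar>Q v\<bar> powr p) \<partial>lborel) = 0" by (simp add: nn_integral_0_iff_AE)
      then show ?thesis by simp
    next
      case False
      define K where "K = 16 * c * J * Nf"
      have K: "K > 0" using False N c J by (simp add: K_def)
      \<comment> \<open>Where \<open>X v\<close> is finite it can be handled as a real number in the
        optimisation over the constant.\<close>
      have "AE v in lborel. X v \<noteq> \<infinity>"
        using intX by (intro nn_integral_PInf_AE) (auto simp: top_unique)
      then have "AE v in lborel. ennreal (\<bar>Q v\<bar> powr p) \<le> ennreal (2 powr p * K powr (p - 1) * c) * X v"
      proof eventually_elim
        case (elim v)
        then obtain x where x: "X v = ennreal x" "x \<ge> 0" by (cases "X v") auto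
        have "\<bar>Q v\<bar> \<le> \<tau> * K + \<tau> powr (1 - p) * (c * x)" if "\<tau> > 0" for \<tau>
        proof -
          have "ennreal \<bar>Q v\<bar> \<le> ennreal (\<tau> * K + \<tau> powr (1 - p) * (c * x))"
            using Qle[OF that, of v] x c K that unfolding K_def[symmetric]
            by (simp add: ennreal_mult[symmetric] ennreal_plus[symmetric] mult.assoc del: ennreal_plus)
          then show ?thesis using x c K that by (subst (asm) ennreal_le_iff) auto
        qed
        then have "\<bar>Q v\<bar> powr p \<le> 2 powr p * K powr (p - 1) * (c * x)"
          using K c x assms(1) by (intro powr_le_of_splitting) auto
        then show ?case using x c by (simp add: ennreal_mult[symmetric] mult.assoc ennreal_leI)
      qed
      then have "(\<integral>\<^sup>+v. ennreal (\<bar>Q v\<bar> powr p) \<partial>lborel) \<le> (\<integral>\<^sup>+v. ennreal (2 powr p * K powr (p - 1) * c) * X v \<partial>lborel)"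
        by (rule nn_integral_mono_AE)
      also have "\<dots> = ennreal (2 powr p * K powr (p - 1) * c) * (\<integral>\<^sup>+v. X v \<partial>lborel)"
        by (rule nn_integral_cmult) measurable
      also have "\<dots> \<le> ennreal (2 powr p * K powr (p - 1) * c) * ennreal (16 * pi\<^sup>2 * (Nf * Nh))"
        by (intro mult_left_mono intX) auto
      also have "\<dots> = ennreal (2 powr p * K powr (p - 1) * c * (16 * pi\<^sup>2 * (Nf * Nh)))"
        using c N by (simp add: ennreal_mult[symmetric])
      also have "2 powr p * K powr (p - 1) * c * (16 * pi\<^sup>2 * (Nf * Nh)) = D * (Nf powr p * Nh)"
      proof -
        have "K powr (p - 1) = (16 * c * J) powr (p - 1) * Nf powr (p - 1)"
          unfolding K_def by (rule powr_mult)
        moreover have "Nf powr p = Nf powr (p - 1) * Nf" using False N by (simp add: powr_diff)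
        ultimately show ?thesis by (simp add: D_def mult_ac)
      qed
      finally show ?thesis .
    qed
    have int: "integrable lborel (\<lambda>v. \<bar>Q v\<bar> powr p)"
      using main by (intro integrableI_bounded) (auto simp: less_top top_unique order.strict_trans1[OF main])
    have "ennreal (\<integral>v. \<bar>Q v\<bar> powr p \<partial>lborel) \<le> ennreal (D * (Nf powr p * Nh))"
      using main int by (subst nn_integral_eq_integral[symmetric]) auto
    then have le: "(\<integral>v. \<bar>Q v\<bar> powr p \<partial>lborel) \<le> D * (Nf powr p * Nh)"
      using D N by (subst (asm) ennreal_le_iff) auto
    \<comment> \<open>\<open>x powr 0\<close> is 1 only for nonzero \<open>x\<close>, hence the
      appeal to the positivity of \<open>vzero\<close>.\<close>
    have "wLp_norm p 0 Q = (\<integral>v. \<bar>Q v\<bar> powr p \<partial>lborel) powr (1/p)"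
      using vzero_pos by (simp add: wLp_norm_def less_imp_neq[symmetric])
    also have "\<dots> \<le> (D * (Nf powr p * Nh)) powr (1/p)"
      using le assms(1) by (intro powr_mono2) auto
    also have "\<dots> = D powr (1/p) * Nf * Nh powr (1/p)"
      using D N assms(1) by (simp add: powr_mult powr_powr)
    also have "Nf = wLp_norm 1 (1/2) f"
      using N by (simp add: wLp_norm_def Nf_def)
    also have "Nh powr (1/p) = wLp_norm p (\<eta> * (p - 1) + 1/2) h"
      by (simp add: wLp_norm_def Nh_def)
    finally show ?thesis using int by (simp add: Q_def)
  qed
  then show ?thesis using D by (intro exI[of _ "D powr (1/p)"]) auto
qed

end
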